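(* Let $d\in\mathbb N^*$ and $q\ge1$. For any $(\beta,p,\mathcal P)\in(0,\infty)^d\times[1,\infty]^d\times\mathfrak P$ such that $\Upsilon(\beta,p,\mathcal P)>0$ and any $\mathcal L\in(0,\infty)^d$, $$\liminf_{n\to\infty}\ \inf_{\widehat f_n}\ \sup_{f\in\mathbf N_{p,d}(\beta,\mathcal L,\mathcal P)}\left(\mathbb E_f^{(n)}\Big[\varphi_n^{-1}(\beta,p,\mathcal P)\,\big\|\widehat f_n-f\big\|_\infty\Big]^q\right)^{1/q}>0,\qquad \varphi_n(\beta,p,\mathcal P)=\left(\frac{\ln n}{n}\right)^{\frac{\Upsilon}{2\Upsilon+1}},$$ where $\Upsilon=\Upsilon(\beta,p,\mathcal P)$ and the infimum is taken over all possible estimators $\widehat f_n$ (i.e. all $X^{(n)}$-measurable maps).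
   Context: **Model.** $X_1,\dots,X_n$ are i.i.d. $\mathbb R^d$-valued random vectors with density $f$ with respect to Lebesgue measure; $X^{(n)}=(X_1,\dots,X_n)$, and $\mathbb E_f^{(n)}$ is expectation under its law. $\|\cdot\|_\infty$ is the supremum norm on $\mathbb R^d$. **Notation.** $\mathcal I_d$ is the set of nonempty subsets of $\{1,\dots,d\}$; for $\mathbf I\in\mathcal I_d$ and a vector $x$, $x_{\mathbf I}=(x_j)_{j\in\mathbf I}$ and $|\mathbf I|$ is the cardinality; $f_{\mathbf I}(x_{\mathbf I})=\int f(x)\,dx_{\bar{\mathbf I}}$, $\bar{\mathbf I}=\{1,\dots,d\}\setminus\mathbf I$, is the marginal density. $\mathfrak P$ is the set of all partitions of $\{1,\dots,d\}$ (including the one-block partition). **Anisotropic Nikol'skii class.** Let $s\ge1$, $r\in[1,\infty]^s$, $\alpha\in(0,\infty)^s$, $Q\in(0,\infty)^s$, and let $\mathbf e_1,\dots,\mathbf e_s$ be the canonical basis of $\mathbb R^s$. A function $g:\mathbb R^s\to\mathbb R$ belongs to $\mathbb N_{r,s}(\alpha,Q)$ if for all $i=1,\dots,s$: $\|D_i^kg\|_{r_i}\le Q_i$ for all $k=0,\dots,\lfloor\alpha_i\rfloor$, and $\big\|D_i^{\lfloor\alpha_i\rfloor}g(\cdot+t\mathbf e_i)-D_i^{\lfloor\alpha_i\rfloor}g(\cdot)\big\|_{r_i}\le Q_i|t|^{\alpha_i-\lfloor\alpha_i\rfloor}$ for all $t\in\mathbb R$. Here $D_i^k$ is the $k$-th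 order partial derivative in the $i$-th variable and $\lfloor\alpha_i\rfloor$ is the largest integer strictly less than $\alpha_i$. **Classes of densities.** A probability density $f$ on $\mathbb R^d$ belongs to $\overline{\mathbb N}_{p,d}(\beta,\mathcal L)$ if $f_{\mathbf I}\in\mathbb N_{p_{\mathbf I},|\mathbf I|}(\beta_{\mathbf I},\mathcal L_{\mathbf I})$ for all $\mathbf I\in\mathcal I_d$, and $$\mathbf N_{p,d}(\beta,\mathcal L,\mathcal P)=\Big\{f\in\overline{\mathbb N}_{p,d}(\beta,\mathcal L):\ f(x)=\prod_{\mathbf I\in\mathcal P}f_{\mathbf I}(x_{\mathbf I})\ \ \forall x\in\mathbb R^d\Big\}.$$ **Effective smoothness.** $$\Upsilon(\beta,p,\mathcal P)=\inf_{\mathbf I\in\mathcal P}\gamma_{\mathbf I}(\beta,p),\qquad \gamma_{\mathbf I}(\beta,p)=\frac{1-\sum_{j\in\mathbf I}\frac1{\beta_jp_j}}{\sum_{j\in\mathbf I}\frac1{\beta_j}}.$$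
   Formalization: The class N_{p,d}(β,L,P) is additionally assumed nonempty; it is empty exactly when some p_j = 1 has L_j < 1 (a density has L_1-norm 1), and then the supremum is over the empty set and the claim fails. *)

theory Defs
  imports "HOL-Analysis.Analysis"
begin

text \<open>
  For a finite index set I, the space R^I is the set of extensional functions
  \<open>I \<rightarrow>\<^sub>E UNIV\<close> with Lebesgue measure \<open>\<Pi>\<^sub>M i\<in>I. lborel\<close>; R^d is the case I = {1..d}.
  Vectors restricted to a subset I of the coordinates keep their original indices, so that
  the spaces R^s carrying the marginals are R^I with card I = s, without renumbering.
  Functions on R^I are only ever evaluated at points of \<open>I \<rightarrow>\<^sub>E UNIV\<close>.
\<close>

abbreviation Rspace :: "nat set \<Rightarrow> (nat \<Rightarrow> real) set" where
  "Rspace I \<equiv> I \<rightarrow>\<^sub>E UNIV"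

abbreviation lebI :: "nat set \<Rightarrow> (nat \<Rightarrow> real) measure" where
  "lebI I \<equiv> (\<Pi>\<^sub>M i\<in>I. lborel)"

text \<open>Only used with exponents a > 0, where \<open>\<infinity>\<close> to the power a is \<open>\<infinity>\<close>.\<close>

definition ennpow :: "ennreal \<Rightarrow> real \<Rightarrow> ennreal" where
  "ennpow x a = (if x = \<infinity> then \<infinity> else ennreal (enn2real x powr a))"

definition sup_norm :: "nat set \<Rightarrow> ((nat \<Rightarrow> real) \<Rightarrow> real) \<Rightarrow> ennreal" where
  "sup_norm I g = (SUP x\<in>Rspace I. ennreal \<bar>g x\<bar>)"

definition Lr_norm :: "nat set \<Rightarrow> ennreal \<Rightarrow> ((nat \<Rightarrow> real) \<Rightarrow> real) \<Rightarrow> ennreal" where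
  "Lr_norm I r g =
    (if r = \<infinity> then sup_norm I g
     else ennpow (\<integral>\<^sup>+x. ennreal (\<bar>g x\<bar> powr enn2real r) \<partial>lebI I) (1 / enn2real r))"

text \<open>The largest integer strictly less than a, for a > 0.\<close>

definition sfloor :: "real \<Rightarrow> nat" where
  "sfloor a = nat (\<lceil>a\<rceil> - 1)"

definition partial :: "nat \<Rightarrow> nat \<Rightarrow> ((nat \<Rightarrow> real) \<Rightarrow> real) \<Rightarrow> (nat \<Rightarrow> real) \<Rightarrow> real" where
  "partial i k g x = (deriv ^^ k) (\<lambda>t. g (x(i := t))) (x i)"

text \<open>The partial derivatives are classical ones; since \<open>deriv\<close> is total, their existence up
  to order \<open>sfloor (\<alpha> i)\<close> is required explicitly.\<close>

definition nikolskii ::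
  "nat set \<Rightarrow> (nat \<Rightarrow> ennreal) \<Rightarrow> (nat \<Rightarrow> real) \<Rightarrow> (nat \<Rightarrow> real) \<Rightarrow> ((nat \<Rightarrow> real) \<Rightarrow> real) set" where
  "nikolskii I r \<alpha> Q =
    {g \<in> borel_measurable (lebI I). \<forall>i\<in>I.
       (\<forall>x\<in>Rspace I. \<forall>k<sfloor (\<alpha> i). \<forall>t.
          (deriv ^^ k) (\<lambda>u. g (x(i := u))) field_differentiable (at t)) \<and>
       (\<forall>k\<le>sfloor (\<alpha> i). Lr_norm I (r i) (partial i k g) \<le> ennreal (Q i)) \<and>
       (\<forall>t. Lr_norm I (r i)
              (\<lambda>x. partial i (sfloor (\<alpha> i)) g (x(i := x i + t)) - partial i (sfloor (\<alpha> i)) g x)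
            \<le> ennreal (Q i * \<bar>t\<bar> powr (\<alpha> i - real (sfloor (\<alpha> i)))))}"

definition prob_density :: "nat \<Rightarrow> ((nat \<Rightarrow> real) \<Rightarrow> real) \<Rightarrow> bool" where
  "prob_density d f \<longleftrightarrow> f \<in> borel_measurable (lebI {1..d}) \<and> (\<forall>x\<in>Rspace {1..d}. 0 \<le> f x) \<and>
     (\<integral>\<^sup>+x. ennreal (f x) \<partial>lebI {1..d}) = 1"

definition marginal ::
  "nat \<Rightarrow> nat set \<Rightarrow> ((nat \<Rightarrow> real) \<Rightarrow> real) \<Rightarrow> (nat \<Rightarrow> real) \<Rightarrow> real" where
  "marginal d I f x = (\<integral>y. f (merge I ({1..d} - I) (x, y)) \<partial>lebI ({1..d} - I))"

text \<open>
  A density is only determined up to null sets, whereas the loss below is a genuine supremum.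
  A density is therefore represented by its continuous version (which exists whenever the
  effective smoothness is positive). Without this convention, for small smoothness indices,
  one could change a density at a single point by an arbitrary amount without leaving the
  class, and the minimax risk would be trivially infinite.
\<close>

definition nikolskii_densities ::
  "nat \<Rightarrow> (nat \<Rightarrow> ennreal) \<Rightarrow> (nat \<Rightarrow> real) \<Rightarrow> (nat \<Rightarrow> real) \<Rightarrow> ((nat \<Rightarrow> real) \<Rightarrow> real) set" where
  "nikolskii_densities d p \<beta> L =
    {f. prob_density d f \<and> continuous_on (Rspace {1..d}) f \<and>
        (\<forall>I. I \<noteq> {} \<and> I \<subseteq> {1..d} \<longrightarrow> marginal d I f \<in> nikolskii I p \<beta> L)}"

definition nikolskii_densities_indep ::
  "nat \<Rightarrow> (nat \<Rightarrow> ennreal) \<Rightarrow> (nat \<Rightarrow> real) \<Rightarrow> (nat \<Rightarrow> real) \<Rightarrow> nat set set \<Rightarrow>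
   ((nat \<Rightarrow> real) \<Rightarrow> real) set" where
  "nikolskii_densities_indep d p \<beta> L P =
    {f \<in> nikolskii_densities d p \<beta> L.
       \<forall>x\<in>Rspace {1..d}. f x = (\<Prod>I\<in>P. marginal d I f (restrict x I))}"

text \<open>The convention \<open>1 / \<infinity> = 0\<close> is that of \<open>inverse\<close> on extended nonnegative reals.\<close>

definition block_smoothness ::
  "(nat \<Rightarrow> real) \<Rightarrow> (nat \<Rightarrow> ennreal) \<Rightarrow> nat set \<Rightarrow> real" where
  "block_smoothness \<beta> p I =
    (1 - (\<Sum>j\<in>I. enn2real (inverse (p j)) / \<beta> j)) / (\<Sum>j\<in>I. 1 / \<beta> j)"

definition eff_smoothness ::
  "(nat \<Rightarrow> real) \<Rightarrow> (nat \<Rightarrow> ennreal) \<Rightarrow> nat set set \<Rightarrow> real" where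
  "eff_smoothness \<beta> p P = (INF I\<in>P. block_smoothness \<beta> p I)"

definition rate :: "(nat \<Rightarrow> real) \<Rightarrow> (nat \<Rightarrow> ennreal) \<Rightarrow> nat set set \<Rightarrow> nat \<Rightarrow> real" where
  "rate \<beta> p P n =
    (ln (real n) / real n) powr (eff_smoothness \<beta> p P / (2 * eff_smoothness \<beta> p P + 1))"

text \<open>The law of n independent observations with density f.\<close>

definition sample_law ::
  "nat \<Rightarrow> nat \<Rightarrow> ((nat \<Rightarrow> real) \<Rightarrow> real) \<Rightarrow> (nat \<Rightarrow> nat \<Rightarrow> real) measure" where
  "sample_law d n f = (\<Pi>\<^sub>M k\<in>{1..n}. density (lebI {1..d}) (\<lambda>x. ennreal (f x)))"

text \<open>An estimator maps a sample to a real function on R^d; measurability in the sample is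
  required pointwise, i.e. with respect to the product sigma-algebra on functions.\<close>

definition estimators :: "nat \<Rightarrow> nat \<Rightarrow> ((nat \<Rightarrow> nat \<Rightarrow> real) \<Rightarrow> (nat \<Rightarrow> real) \<Rightarrow> real) set" where
  "estimators d n =
    {fhat. \<forall>x\<in>Rspace {1..d}.
       (\<lambda>\<omega>. fhat \<omega> x) \<in> borel_measurable (\<Pi>\<^sub>M k\<in>{1..n}. lebI {1..d})}"

text \<open>The loss, a supremum over an uncountable set, need not be measurable in the sample;
  \<open>nn_integral\<close> is then the lower integral, so the lower bound holds for any
  larger notion of expectation.\<close>

definition risk ::
  "nat \<Rightarrow> nat \<Rightarrow> real \<Rightarrow> real \<Rightarrow> ((nat \<Rightarrow> nat \<Rightarrow> real) \<Rightarrow> (nat \<Rightarrow> real) \<Rightarrow> real) \<Rightarrow>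
   ((nat \<Rightarrow> real) \<Rightarrow> real) \<Rightarrow> ennreal" where
  "risk d n q \<phi> fhat f =
    ennpow (\<integral>\<^sup>+\<omega>. ennpow (ennreal (inverse \<phi>) * sup_norm {1..d} (\<lambda>x. fhat \<omega> x - f x)) q
              \<partial>sample_law d n f) (1 / q)"

end

theory Submission
  imports Defs "HOL-Probability.Probability" "HOL-Real_Asymp.Real_Asymp"
begin

text \<open>
  Let J be a block of the partition attaining the effective smoothness \<open>\<gamma>\<close> and write
  \<open>\<rho>\<^sub>j = 1 / p\<^sub>j\<close>. The base density is a tensor product of a polynomial bump
  \<open>(1 - t\<^sup>2)\<^sub>+\<^sup>m\<close>, dilated by a constant R so large that all its marginals lie well inside the
  class; the only norms that dilation cannot shrink are the \<open>L\<^sub>1\<close> norms of the marginals themselves,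
  which equal 1 for every density and are admissible because the class is nonempty.
  To it is added a single bump of height \<open>a \<phi>\<^sub>n\<close> and widths
  \<open>h\<^sub>j = \<phi>\<^sub>n\<close> to the power \<open>(1 + \<rho>\<^sub>j / \<gamma>) / \<beta>\<^sub>j\<close> in the coordinates of J, built from the odd profile
  \<open>t (1 - t\<^sup>2)\<^sub>+\<^sup>m\<close>. Oddness makes every marginal over a set not containing J coincide with that of the
  base density, and the exponents sum to \<open>1 / \<gamma>\<close>, so that the bump has volume \<open>\<phi>\<^sub>n\<close> to the power
  \<open>1 / \<gamma>\<close>, respects the smoothness constraints uniformly in n, and has chi-square size of order
  \<open>ln n / n\<close>.
  Shifting the bump along one coordinate of J already yields polynomially many (in n) alternatives
  with disjoint perturbations. The chi-square distance between the base law and their uniform mixture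
  is at most \<open>exp (n \<kappa>) / M\<close>, which tends to 0 for small a, so no estimator can tell the base
  density from the mixture.
\<close>

section \<open>Bump functions\<close>

text \<open>The widths come from a balance. For a bump of height y, widths h_j and volume V, the
  smoothness condition in direction i asks that y V^\<rho>_i / h_i^\<beta>_i stay bounded. Equality
  with V = y^(1/\<gamma>) forces h_i^\<beta>_i = y^(1 + \<rho>_i/\<gamma>), and these widths
  multiply to V exactly when \<gamma> is the smoothness of the block. The chi-square size per
  observation is of order y^2 V = y^(2 + 1/\<gamma>), which the exponent \<gamma> / (2 \<gamma> + 1)
  turns into ln n / n. The logarithm is paid for by the number of alternatives: the second moment of
  the likelihood ratio grows like n to a power proportional to a^2, while about 1 / h shifts fit
  along one axis, a fixed power of n up to logarithms. The obstacle is that every marginal is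
  constrained, each direction having its own integrability index. Tensor products answer it: a
  marginal is again of the same form, and coordinates outside the block contribute factors bounded
  independently of n. All norms except the L1 norms of densities are then estimated crudely, as a
  sup bound times a power of the volume of a box.\<close>

definition poly_bump :: "real poly \<Rightarrow> nat \<Rightarrow> real \<Rightarrow> real" where
  "poly_bump q m t = poly q t * max 0 (1 - t\<^sup>2) ^ m"

lemma DERIV_max_zero_power:
  fixes s :: real
  assumes "m \<ge> 1"
  shows "((\<lambda>s. max 0 s ^ Suc m) has_real_derivative real (Suc m) * max 0 s ^ m) (at s)"
proof -
  consider "s > 0" | "s < 0" | "s = 0" by linarith
  then show ?thesis
  proof cases
    case 1
    have "((\<lambda>s. s ^ Suc m) has_real_derivative real (Suc m) * s ^ m) (at s)"
      using DERIV_pow[of "Suc m" s] by simp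
    moreover have "\<forall>\<^sub>F x in nhds s. x > 0"
      using 1 order_tendstoD(1)[OF filterlim_ident, of 0 s] by simp
    ultimately show ?thesis
      using 1 by (subst DERIV_cong_ev[of s s _ "\<lambda>s. s ^ Suc m"])
        (auto elim!: eventually_mono)
  next
    case 2
    have "((\<lambda>s. 0) has_real_derivative 0) (at s)"
      by (auto intro!: derivative_eq_intros)
    moreover have "\<forall>\<^sub>F x in nhds s. x < 0"
      using 2 order_tendstoD(2)[OF filterlim_ident, of s 0] by simp
    ultimately show ?thesis
      using 2 assms by (subst DERIV_cong_ev[of s s _ "\<lambda>s. 0"])
        (auto elim!: eventually_mono simp: zero_power)
  next
    case 3
    \<comment> \<open>Caratheodory's criterion at the kink:
      \<open>max 0 z ^ Suc m = max 0 z ^ m * z\<close>, and the slope \<open>max 0 z ^ m\<close> is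
      continuous with value 0 at 0 because m is at least 1.\<close>
    have "isCont (\<lambda>z::real. max 0 z ^ m) 0"
      by (intro continuous_intros)
    then show ?thesis
      unfolding CARAT_DERIV using 3 assms
      by (intro exI[of _ "\<lambda>z. max 0 z ^ m"]) (auto simp: max_def)
  qed
qed

text \<open>Differentiation stays inside the family: it lowers the exponent by one and only changes
  the polynomial factor, which is why \<open>poly_bump\<close> carries an arbitrary polynomial.
  Iterated derivatives thus need no explicit formula.\<close>

lemma DERIV_poly_bump:
  assumes "m \<ge> 1"
  shows "(poly_bump q (Suc m) has_real_derivative
    poly_bump (pderiv q * [:1, 0, -1:] - smult (2 * real (Suc m)) ([:0, 1:] * q)) m t) (at t)"
proof -
  have "((\<lambda>t. max 0 (1 - t\<^sup>2) ^ Suc m) has_real_derivative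
      real (Suc m) * max 0 (1 - t\<^sup>2) ^ m * (- 2 * t)) (at t)"
    by (rule DERIV_chain2[where g = "\<lambda>t. 1 - t\<^sup>2", OF DERIV_max_zero_power[OF assms]])
       (auto intro!: derivative_eq_intros)
  then have "((\<lambda>t. poly q t * max 0 (1 - t\<^sup>2) ^ Suc m) has_real_derivative
      poly (pderiv q) t * max 0 (1 - t\<^sup>2) ^ Suc m
        + real (Suc m) * max 0 (1 - t\<^sup>2) ^ m * (- 2 * t) * poly q t) (at t)"
    by (rule DERIV_mult[OF poly_DERIV])
  moreover have "max 0 (1 - t\<^sup>2) ^ Suc m = (1 - t\<^sup>2) * max 0 (1 - t\<^sup>2) ^ m"
    using assms by (auto simp: max_def)
  ultimately show ?thesis
    unfolding poly_bump_def[abs_def]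
    by (simp only:) (simp add: algebra_simps power2_eq_square)
qed

lemma funpow_deriv_poly_bump:
  assumes "k < m"
  shows "\<exists>q'. (deriv ^^ k) (poly_bump q m) = poly_bump q' (m - k)"
  using assms
proof (induction k)
  case 0
  then show ?case by auto
next
  case (Suc k)
  then obtain q' where q': "(deriv ^^ k) (poly_bump q m) = poly_bump q' (m - k)"
    by auto
  have "m - k = Suc (m - Suc k)" "m - Suc k \<ge> 1"
    using Suc.prems by auto
  then show ?case
    using DERIV_poly_bump[of "m - Suc k" q', THEN DERIV_imp_deriv]
    by (auto simp: q' fun_eq_iff)
qed

lemma poly_bump_bounded:
  assumes "m \<ge> 1"
  obtains C where "\<And>t. \<bar>poly_bump q m t\<bar> \<le> C"
proof -
  have "continuous_on {-1..1} (poly_bump q m)"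
    unfolding poly_bump_def by (intro continuous_intros)
  then have "bounded (poly_bump q m ` {-1..1})"
    by (intro compact_imp_bounded compact_continuous_image) auto
  then obtain C where C: "\<And>t. t \<in> {-1..1} \<Longrightarrow> \<bar>poly_bump q m t\<bar> \<le> C"
    unfolding bounded_iff by (metis image_eqI real_norm_def)
  have "\<bar>poly_bump q m t\<bar> \<le> max 0 C" for t
  proof (cases "\<bar>t\<bar> \<le> 1")
    case True
    then have "t \<in> {-1..1}" by auto
    then show ?thesis using C[of t] by linarith
  next
    case False
    then have "max 0 (1 - t\<^sup>2) = 0"
      using abs_square_le_1[of t] by auto
    then show ?thesis using assms by (simp add: poly_bump_def zero_power)
  qed
  then show ?thesis using that by blast
qed

text \<open>The scaling \<open>K / h ^ k\<close> is the one inherited by an affine image of a single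
  fixed profile, so K stays independent of the width. The derivatives vanish already at distance
  exactly h, so bumps whose supports merely touch have product 0.\<close>

definition bump_class :: "nat \<Rightarrow> real \<Rightarrow> real \<Rightarrow> real \<Rightarrow> (real \<Rightarrow> real) \<Rightarrow> bool" where
  "bump_class N K c h \<theta> \<longleftrightarrow> 0 \<le> K \<and> 0 < h \<and> (\<forall>k\<le>N. \<forall>t.
     (deriv ^^ k) \<theta> field_differentiable (at t) \<and>
     \<bar>(deriv ^^ k) \<theta> t\<bar> \<le> K / h ^ k \<and>
     (h \<le> \<bar>t - c\<bar> \<longrightarrow> (deriv ^^ k) \<theta> t = 0))"

lemma bump_classD:
  assumes "bump_class N K c h \<theta>"
  shows "0 \<le> K" "0 < h"
    and "\<And>k t. k \<le> N \<Longrightarrow> (deriv ^^ k) \<theta> field_differentiable (at t)"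
    and "\<And>k t. k \<le> N \<Longrightarrow> \<bar>(deriv ^^ k) \<theta> t\<bar> \<le> K / h ^ k"
    and "\<And>k t. k \<le> N \<Longrightarrow> h \<le> \<bar>t - c\<bar> \<Longrightarrow> (deriv ^^ k) \<theta> t = 0"
  using assms unfolding bump_class_def by blast+

lemma bump_class_bound: "bump_class N K c h \<theta> \<Longrightarrow> \<bar>\<theta> t\<bar> \<le> K"
  using bump_classD(4)[of N K c h \<theta> 0 t] by simp

lemma bump_class_eq_0: "bump_class N K c h \<theta> \<Longrightarrow> h \<le> \<bar>t - c\<bar> \<Longrightarrow> \<theta> t = 0"
  using bump_classD(5)[of N K c h \<theta> 0 t] by simp

lemma bump_class_mono:
  assumes "bump_class N K c h \<theta>" "K \<le> K'"
  shows "bump_class N K' c h \<theta>"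
proof -
  have "\<bar>(deriv ^^ k) \<theta> t\<bar> \<le> K' / h ^ k" if "k \<le> N" for k t
    using bump_classD(4)[OF assms(1) that, of t] divide_right_mono[OF assms(2), of "h ^ k"]
      bump_classD(2)[OF assms(1)] by force
  then show ?thesis
    using assms unfolding bump_class_def by auto
qed

text \<open>The exponent \<open>N + 2\<close> leaves exponent at least 2 after N derivatives, so
  that the N-th derivative is still differentiable, also at the endpoints of the support.\<close>

lemma bump_class_poly_bump: "\<exists>C. bump_class N C 0 1 (poly_bump q (N + 2))"
proof -
  have "\<exists>C. \<forall>k\<le>N. \<forall>t. \<bar>(deriv ^^ k) (poly_bump q (N + 2)) t\<bar> \<le> C"
  proof -
    have "\<exists>C. \<forall>t. \<bar>(deriv ^^ k) (poly_bump q (N + 2)) t\<bar> \<le> C" if k: "k \<le> N" for k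
    proof -
      have "k < N + 2" using k by simp
      then obtain q' where "(deriv ^^ k) (poly_bump q (N + 2)) = poly_bump q' (N + 2 - k)"
        using funpow_deriv_poly_bump by blast
      moreover obtain C where "\<And>t. \<bar>poly_bump q' (N + 2 - k) t\<bar> \<le> C"
      proof (rule poly_bump_bounded)
        show "1 \<le> N + 2 - k" using k by linarith
      qed blast
      ultimately show ?thesis by auto
    qed
    then obtain C where C: "\<And>k t. k \<le> N \<Longrightarrow> \<bar>(deriv ^^ k) (poly_bump q (N + 2)) t\<bar> \<le> C k"
      by metis
    have "\<bar>(deriv ^^ k) (poly_bump q (N + 2)) t\<bar> \<le> Max (C ` {..N})" if "k \<le> N" for k t
      using order_trans[OF C[OF that] Max_ge[of "C ` {..N}" "C k"]] that by simp
    then show ?thesis by auto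
  qed
  then obtain C where C: "\<And>k t. k \<le> N \<Longrightarrow> \<bar>(deriv ^^ k) (poly_bump q (N + 2)) t\<bar> \<le> C"
    by auto
  have "(deriv ^^ k) (poly_bump q (N + 2)) field_differentiable (at t) \<and>
      (1 \<le> \<bar>t\<bar> \<longrightarrow> (deriv ^^ k) (poly_bump q (N + 2)) t = 0)" if "k \<le> N" for k t
  proof -
    have "k < N + 2" using that by simp
    then obtain q' where q': "(deriv ^^ k) (poly_bump q (N + 2)) = poly_bump q' (N + 2 - k)"
      using funpow_deriv_poly_bump by blast
    have eq: "N + 2 - k = Suc (N + 1 - k)" using that by auto
    have "poly_bump q' (N + 2 - k) field_differentiable (at t)"
      unfolding eq field_differentiable_def
      by (rule exI, rule DERIV_poly_bump) (use that in linarith)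
    moreover have "poly_bump q' (N + 2 - k) t = 0" if "1 \<le> \<bar>t\<bar>"
    proof -
      have "1 \<le> t\<^sup>2" using that abs_le_square_iff[of 1 t] by simp
      then show ?thesis using \<open>k \<le> N\<close> by (simp add: poly_bump_def)
    qed
    ultimately show ?thesis unfolding q' by blast
  qed
  moreover have "\<bar>(deriv ^^ k) (poly_bump q (N + 2)) t\<bar> \<le> max 0 C" if "k \<le> N" for k t
    using C[OF that, of t] by linarith
  ultimately have "bump_class N (max 0 C) 0 1 (poly_bump q (N + 2))"
    unfolding bump_class_def by simp
  then show ?thesis by blast
qed

lemma funpow_deriv_affine:
  fixes g :: "real \<Rightarrow> real"
  assumes "\<And>j t. j < k \<Longrightarrow> (deriv ^^ j) g field_differentiable (at t)" "h \<noteq> 0"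
  shows "(deriv ^^ k) (\<lambda>t. a * g ((t - c) / h)) = (\<lambda>t. a / h ^ k * (deriv ^^ k) g ((t - c) / h))"
  using assms(1)
proof (induction k)
  case 0
  then show ?case by simp
next
  case (Suc k)
  have IH: "(deriv ^^ k) (\<lambda>t. a * g ((t - c) / h)) = (\<lambda>t. a / h ^ k * (deriv ^^ k) g ((t - c) / h))"
    using Suc by simp
  have "((\<lambda>t. a / h ^ k * (deriv ^^ k) g ((t - c) / h)) has_real_derivative
      a / h ^ Suc k * (deriv ^^ Suc k) g ((t - c) / h)) (at t)" for t
  proof -
    have "((deriv ^^ k) g has_real_derivative (deriv ^^ Suc k) g ((t - c) / h)) (at ((t - c) / h))"
      using Suc.prems[of k "(t - c) / h"] by (simp add: field_differentiable_derivI)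
    moreover have "((\<lambda>t. (t - c) / h) has_real_derivative 1 / h) (at t)"
      using \<open>h \<noteq> 0\<close> by (auto intro!: derivative_eq_intros)
    ultimately have "((\<lambda>t. (deriv ^^ k) g ((t - c) / h)) has_real_derivative
        (deriv ^^ Suc k) g ((t - c) / h) * (1 / h)) (at t)"
      by (rule DERIV_chain2)
    from DERIV_cmult[OF this, of "a / h ^ k"] show ?thesis
      by (simp add: field_simps)
  qed
  then show ?case
    by (auto simp: IH fun_eq_iff intro!: DERIV_imp_deriv)
qed

lemma bump_class_affine:
  assumes "bump_class N K 0 1 g" "h > 0"
  shows "bump_class N (\<bar>a\<bar> * K) c h (\<lambda>t. a * g ((t - c) / h))"
proof -
  note g = bump_classD[OF assms(1)]
  have eq: "(deriv ^^ k) (\<lambda>t. a * g ((t - c) / h)) = (\<lambda>t. a / h ^ k * (deriv ^^ k) g ((t - c) / h))"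
    if "k \<le> N" for k
    using that g(3) assms(2) by (intro funpow_deriv_affine) auto
  show ?thesis
    unfolding bump_class_def
  proof (intro conjI allI impI)
    show "0 \<le> \<bar>a\<bar> * K" "0 < h" using g assms by auto
    fix k t assume k: "k \<le> N"
    have "(deriv ^^ k) g field_differentiable (at ((t - c) / h))"
      using g(3)[OF k] .
    moreover have "(\<lambda>t. (t - c) / h) field_differentiable (at t)"
      using assms(2) by (auto intro!: derivative_intros)
    ultimately have "((deriv ^^ k) g \<circ> (\<lambda>t. (t - c) / h)) field_differentiable (at t)"
      by (intro field_differentiable_compose)
    then show "(deriv ^^ k) (\<lambda>t. a * g ((t - c) / h)) field_differentiable (at t)"
      unfolding eq[OF k] o_def
      by (intro field_differentiable_mult field_differentiable_const)
    have "\<bar>(deriv ^^ k) g ((t - c) / h)\<bar> \<le> K" using g(4)[OF k] by simp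
    then have "\<bar>a\<bar> / h ^ k * \<bar>(deriv ^^ k) g ((t - c) / h)\<bar> \<le> \<bar>a\<bar> / h ^ k * K"
      using assms(2) by (intro mult_left_mono) auto
    then show "\<bar>(deriv ^^ k) (\<lambda>t. a * g ((t - c) / h)) t\<bar> \<le> \<bar>a\<bar> * K / h ^ k"
      unfolding eq[OF k] using assms(2) by (simp add: abs_mult)
    assume "h \<le> \<bar>t - c\<bar>"
    then have "1 \<le> \<bar>(t - c) / h\<bar>" using assms(2) by simp
    then show "(deriv ^^ k) (\<lambda>t. a * g ((t - c) / h)) t = 0"
      unfolding eq[OF k] using g(5)[OF k] by simp
  qed
qed

lemma bump_class_isCont: "bump_class N K c h \<theta> \<Longrightarrow> isCont \<theta> t"
  using bump_classD(3)[of N K c h \<theta> 0 t] by (simp add: field_differentiable_imp_continuous_at)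

lemma bump_class_measurable:
  assumes "bump_class N K c h \<theta>"
  shows "\<theta> \<in> borel_measurable borel"
  using bump_class_isCont[OF assms]
  by (intro borel_measurable_continuous_onI continuous_at_imp_continuous_on) auto

lemma bump_class_integrable:
  assumes "bump_class N K c h \<theta>"
  shows "integrable lborel \<theta>"
proof -
  have "integrable lborel (\<lambda>t. indicator {c - h..c + h} t *\<^sub>R \<theta> t)"
    by (intro borel_integrable_compact continuous_at_imp_continuous_on)
       (auto intro: bump_class_isCont[OF assms])
  also have "(\<lambda>t. indicator {c - h..c + h} t *\<^sub>R \<theta> t) = \<theta>"
  proof
    fix t show "indicator {c - h..c + h} t *\<^sub>R \<theta> t = \<theta> t"
      using bump_class_eq_0[OF assms, of t]
      by (cases "h \<le> \<bar>t - c\<bar>") (auto simp: indicator_def)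
  qed
  finally show ?thesis .
qed

text \<open>Interpolates between the mean value bound, used for increments up to h, and the triangle
  inequality, used beyond: measured in units of h, an increment of size at most 1 is below its own
  power \<eta>, and a larger one has power at least 1. For \<open>k = sfloor \<beta>\<close> and
  \<eta> the remainder, the exponent of h is \<beta> itself.\<close>

lemma bump_class_hoelder:
  assumes \<theta>: "bump_class N K c h \<theta>" and k: "k < N" and \<eta>: "0 < \<eta>" "\<eta> \<le> 1"
  shows "\<bar>(deriv ^^ k) \<theta> (t + s) - (deriv ^^ k) \<theta> t\<bar> \<le> 2 * (K / h powr (real k + \<eta>)) * \<bar>s\<bar> powr \<eta>"
proof -
  let ?u = "(deriv ^^ k) \<theta>"
  note D = bump_classD[OF \<theta>]
  have triv: "\<bar>?u (t + s) - ?u t\<bar> \<le> 2 * (K / h ^ k)"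
    using D(4)[of k "t + s"] D(4)[of k t] k by linarith
  have "norm (?u (t + s) - ?u t) \<le> K / h ^ Suc k * norm (t + s - t)"
  proof (rule field_differentiable_bound[of UNIV ?u "(deriv ^^ Suc k) \<theta>"])
    show "(?u has_real_derivative (deriv ^^ Suc k) \<theta> z) (at z within UNIV)" for z
      using D(3)[of k z] k by (simp add: field_differentiable_derivI)
    show "norm ((deriv ^^ Suc k) \<theta> z) \<le> K / h ^ Suc k" for z
      using D(4)[of "Suc k" z] k by simp
  qed auto
  then have lip: "\<bar>?u (t + s) - ?u t\<bar> \<le> K / h ^ k * (\<bar>s\<bar> / h)"
    by (simp add: mult.commute)
  have K: "0 \<le> K / h ^ k" using D(1,2) by simp
  have "\<bar>?u (t + s) - ?u t\<bar> \<le> 2 * (K / h ^ k) * (\<bar>s\<bar> / h) powr \<eta>"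
  proof (cases "\<bar>s\<bar> / h \<le> 1")
    case True
    have "\<bar>s\<bar> / h \<le> (\<bar>s\<bar> / h) powr \<eta>"
    proof (cases "s = 0")
      case False
      then show ?thesis
        using powr_mono'[of \<eta> 1 "\<bar>s\<bar> / h"] \<eta> True D(2) by simp
    qed simp
    then have "K / h ^ k * (\<bar>s\<bar> / h) \<le> K / h ^ k * (\<bar>s\<bar> / h) powr \<eta>"
      using K by (intro mult_left_mono)
    moreover have "0 \<le> K / h ^ k * (\<bar>s\<bar> / h) powr \<eta>"
      using K by (intro mult_nonneg_nonneg) auto
    ultimately show ?thesis using lip by linarith
  next
    case False
    then have "1 \<le> (\<bar>s\<bar> / h) powr \<eta>"
      using \<eta> by (intro ge_one_powr_ge_zero) auto
    then have "2 * (K / h ^ k) * 1 \<le> 2 * (K / h ^ k) * (\<bar>s\<bar> / h) powr \<eta>"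
      using K by (intro mult_left_mono) auto
    then show ?thesis using triv by simp
  qed
  also have "\<dots> = 2 * (K / h powr (real k + \<eta>)) * \<bar>s\<bar> powr \<eta>"
    using D(2) by (simp add: powr_divide powr_add powr_realpow)
  finally show ?thesis .
qed

section \<open>Nikolskii norms of tensor products\<close>

lemma sfloor_bounds:
  assumes "0 < a"
  shows "0 < a - real (sfloor a)" "a - real (sfloor a) \<le> 1"
proof -
  have "0 < \<lceil>a\<rceil>" using assms by simp
  then have "real (sfloor a) = real_of_int \<lceil>a\<rceil> - 1"
    by (simp add: sfloor_def)
  moreover have "real_of_int \<lceil>a\<rceil> - 1 < a" "a \<le> real_of_int \<lceil>a\<rceil>"
    by linarith+
  ultimately show "0 < a - real (sfloor a)" "a - real (sfloor a) \<le> 1" by auto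
qed

lemma ennpow_ennreal: "0 \<le> x \<Longrightarrow> ennpow (ennreal x) a = ennreal (x powr a)"
  by (simp add: ennpow_def)

lemma ennpow_mono:
  assumes "x \<le> y" "0 \<le> a"
  shows "ennpow x a \<le> ennpow y a"
proof (cases "y = \<infinity>")
  case False
  then obtain x' y' where "x = ennreal x'" "y = ennreal y'" "0 \<le> x'" "x' \<le> y'"
    using assms(1) by (cases x; cases y) (auto simp: top_unique)
  then show ?thesis
    using assms(2) by (auto simp: ennpow_ennreal intro!: ennreal_leI powr_mono2)
qed (auto simp: ennpow_def)

text \<open>The factor 4 makes Minkowski's inequality unnecessary: \<open>2 (Q/2)\<^sup>r \<le> Q\<^sup>r\<close>.\<close>

lemma Lr_norm_le_two_sets:
  assumes r: "1 \<le> r"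
    and F: "\<And>x. x \<in> Rspace I \<Longrightarrow> \<bar>F x\<bar> \<le> B1 * indicator S1 x + B2 * indicator S2 x"
    and B: "0 \<le> B1" "0 \<le> B2"
    and S: "S1 \<in> sets (lebI I)" "S2 \<in> sets (lebI I)"
    and V: "emeasure (lebI I) S1 \<le> ennreal V1" "emeasure (lebI I) S2 \<le> ennreal V2" "0 < V1" "0 < V2"
    and Q: "4 * (B1 * V1 powr enn2real (inverse r)) \<le> Q" "4 * (B2 * V2 powr enn2real (inverse r)) \<le> Q"
  shows "Lr_norm I r F \<le> ennreal Q"
proof (cases "r = \<infinity>")
  case True
  \<comment> \<open>For \<open>r = \<infinity>\<close> the exponent of the volumes is 0; positivity
    of V1 and V2 is needed because \<open>0 powr 0\<close> is 0, not 1.\<close>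
  then have Q: "4 * B1 \<le> Q" "4 * B2 \<le> Q"
    using Q V by auto
  have "\<bar>F x\<bar> \<le> Q" if "x \<in> Rspace I" for x
  proof -
    have "B1 * indicator S1 x + B2 * indicator S2 x \<le> B1 + B2"
      using B by (auto simp: indicator_def)
    then show ?thesis using F[OF that] Q B by linarith
  qed
  then show ?thesis
    using True by (auto simp: Lr_norm_def sup_norm_def intro!: SUP_least ennreal_leI)
next
  case False
  then obtain s where s: "r = ennreal s" "0 \<le> s" by (cases r) auto
  have s1: "1 \<le> s" using r s by (simp flip: ennreal_1)
  have \<rho>: "enn2real (inverse r) = 1 / s"
    using s s1 by (simp add: inverse_ennreal divide_inverse)
  have Q0: "0 \<le> Q" using Q B by (smt (verit) mult_nonneg_nonneg powr_ge_zero)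
  have pw: "(2 * B) powr s * V \<le> (Q / 2) powr s"
    if "4 * (B * V powr (1 / s)) \<le> Q" "0 \<le> B" "0 < V" for B V
  proof -
    have "(2 * B) powr s * V = (2 * B * V powr (1 / s)) powr s"
      using that s1 by (simp add: powr_mult powr_powr)
    also have "\<dots> \<le> (Q / 2) powr s"
      using that s1 by (intro powr_mono2) auto
    finally show ?thesis .
  qed
  have "(\<integral>\<^sup>+x. ennreal (\<bar>F x\<bar> powr s) \<partial>lebI I)
      \<le> (\<integral>\<^sup>+x. ennreal ((2 * B1) powr s) * indicator S1 x + ennreal ((2 * B2) powr s) * indicator S2 x \<partial>lebI I)"
  proof (rule nn_integral_mono)
    fix x assume "x \<in> space (lebI I)"
    then have x: "x \<in> Rspace I" by (simp add: space_PiM)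
    have "\<bar>F x\<bar> powr s \<le> (2 * B1) powr s * indicator S1 x + (2 * B2) powr s * indicator S2 x"
    proof -
      have le: "\<bar>F x\<bar> powr s \<le> (2 * B) powr s" if "\<bar>F x\<bar> \<le> 2 * B" for B
        using that s1 by (intro powr_mono2) auto
      \<comment> \<open>On the overlap of the two sets B1 + B2 is at most twice the larger bound, so
        every point is charged to a single set.\<close>
      have "\<bar>F x\<bar> \<le> 2 * B1 \<and> x \<in> S1 \<or> \<bar>F x\<bar> \<le> 2 * B2 \<and> x \<in> S2 \<or> F x = 0"
        using F[OF x] B by (cases "x \<in> S1"; cases "x \<in> S2") auto
      then show ?thesis
        using le[of B1] le[of B2] by (auto simp: indicator_def add_increasing add_increasing2)
    qed
    then have "ennreal (\<bar>F x\<bar> powr s)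
        \<le> ennreal ((2 * B1) powr s * indicator S1 x + (2 * B2) powr s * indicator S2 x)"
      by (rule ennreal_leI)
    also have "\<dots> = ennreal ((2 * B1) powr s) * indicator S1 x + ennreal ((2 * B2) powr s) * indicator S2 x"
      by (auto simp: indicator_def ennreal_plus)
    finally show "ennreal (\<bar>F x\<bar> powr s)
        \<le> ennreal ((2 * B1) powr s) * indicator S1 x + ennreal ((2 * B2) powr s) * indicator S2 x" .
  qed
  also have "\<dots> = ennreal ((2 * B1) powr s) * emeasure (lebI I) S1 + ennreal ((2 * B2) powr s) * emeasure (lebI I) S2"
    using S by (simp add: nn_integral_add nn_integral_cmult)
  also have "\<dots> \<le> ennreal ((2 * B1) powr s) * ennreal V1 + ennreal ((2 * B2) powr s) * ennreal V2"
    using V by (intro add_mono mult_left_mono) auto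
  also have "\<dots> = ennreal ((2 * B1) powr s * V1 + (2 * B2) powr s * V2)"
    using V by (simp add: ennreal_mult ennreal_plus)
  also have "\<dots> \<le> ennreal (Q powr s)"
  proof (rule ennreal_leI)
    have "(2 * B1) powr s * V1 + (2 * B2) powr s * V2 \<le> (Q / 2) powr s + (Q / 2) powr s"
      using Q B V \<rho> by (intro add_mono pw) auto
    also have "\<dots> = Q powr s * (2 / 2 powr s)"
      using Q0 by (simp add: powr_divide)
    also have "\<dots> \<le> Q powr s * 1"
      using powr_mono[of 1 s 2] s1 by (intro mult_left_mono) auto
    finally show "(2 * B1) powr s * V1 + (2 * B2) powr s * V2 \<le> Q powr s" by simp
  qed
  finally have "ennpow (\<integral>\<^sup>+x. ennreal (\<bar>F x\<bar> powr s) \<partial>lebI I) (1 / s) \<le> ennpow (ennreal (Q powr s)) (1 / s)"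
    using s1 by (intro ennpow_mono) auto
  also have "\<dots> = ennreal Q"
    using Q0 s1 by (simp add: ennpow_ennreal powr_powr)
  finally show ?thesis
    using False s by (simp add: Lr_norm_def)
qed

interpretation lborel_product: product_sigma_finite "\<lambda>_::nat. lborel :: real measure"
  by standard

lemma emeasure_box_le:
  assumes "finite I" "\<And>j. j \<in> I \<Longrightarrow> S j \<in> sets lborel"
    and "\<And>j. j \<in> I \<Longrightarrow> emeasure lborel (S j) \<le> ennreal (v j)" "\<And>j. j \<in> I \<Longrightarrow> 0 \<le> v j"
  shows "emeasure (lebI I) (Pi\<^sub>E I S) \<le> ennreal (\<Prod>j\<in>I. v j)"
proof -
  have "emeasure (lebI I) (Pi\<^sub>E I S) = (\<Prod>j\<in>I. emeasure lborel (S j))"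
    using assms by (intro lborel_product.emeasure_PiM) auto
  also have "\<dots> \<le> (\<Prod>j\<in>I. ennreal (v j))"
    using assms by (intro prod_mono_ennreal) auto
  also have "\<dots> = ennreal (\<Prod>j\<in>I. v j)"
    using assms by (intro prod_ennreal) auto
  finally show ?thesis .
qed

lemma funpow_deriv_lincomb:
  fixes f g :: "real \<Rightarrow> real"
  assumes "\<And>j t. j < k \<Longrightarrow> (deriv ^^ j) f field_differentiable (at t)"
    and "\<And>j t. j < k \<Longrightarrow> (deriv ^^ j) g field_differentiable (at t)"
  shows "(deriv ^^ k) (\<lambda>u. a * f u + b * g u) = (\<lambda>u. a * (deriv ^^ k) f u + b * (deriv ^^ k) g u)"
  using assms
proof (induction k)
  case 0
  then show ?case by simp
next
  case (Suc k)
  have "((\<lambda>u. a * (deriv ^^ k) f u + b * (deriv ^^ k) g u) has_real_derivative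
      a * (deriv ^^ Suc k) f t + b * (deriv ^^ Suc k) g t) (at t)" for t
    using Suc.prems(1)[of k t] Suc.prems(2)[of k t]
    by (intro DERIV_add DERIV_cmult) (simp_all add: field_differentiable_derivI)
  moreover have "(deriv ^^ k) (\<lambda>u. a * f u + b * g u) = (\<lambda>u. a * (deriv ^^ k) f u + b * (deriv ^^ k) g u)"
    using Suc by simp
  ultimately have "deriv ((deriv ^^ k) (\<lambda>u. a * f u + b * g u)) t =
      a * (deriv ^^ Suc k) f t + b * (deriv ^^ Suc k) g t" for t
    by (metis DERIV_imp_deriv)
  then show ?case
    unfolding funpow.simps o_apply by blast
qed

text \<open>One shape for all functions that occur: A = 0 gives the base density, A > 0 an
  alternative, and integrating out coordinates changes only the index set and A.\<close>

definition tensor_sum ::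
  "nat set \<Rightarrow> (nat \<Rightarrow> real \<Rightarrow> real) \<Rightarrow> real \<Rightarrow> (nat \<Rightarrow> real \<Rightarrow> real) \<Rightarrow> (nat \<Rightarrow> real) \<Rightarrow> real" where
  "tensor_sum I \<phi> A \<psi> x = (\<Prod>j\<in>I. \<phi> j (x j)) + A * (\<Prod>j\<in>I. \<psi> j (x j))"

lemma tensor_sum_upd:
  assumes "finite I" "i \<in> I"
  shows "tensor_sum I \<phi> A \<psi> (x(i := u)) =
    (\<Prod>j\<in>I - {i}. \<phi> j (x j)) * \<phi> i u + A * (\<Prod>j\<in>I - {i}. \<psi> j (x j)) * \<psi> i u"
proof -
  have "(\<Prod>j\<in>I. \<theta> j ((x(i := u)) j)) = (\<Prod>j\<in>I - {i}. \<theta> j (x j)) * \<theta> i u"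
    for \<theta> :: "nat \<Rightarrow> real \<Rightarrow> real"
    using assms by (subst prod.remove[of I i]) (auto intro!: prod.cong)
  then show ?thesis by (simp add: tensor_sum_def)
qed

text \<open>Here v stands for what an operation in direction i makes of the i-th factor: a
  derivative or an increment. D is its size relative to the bound of the factor, and S contains the
  positions at which it is nonzero; an increment enlarges S beyond the support of the
  factor.\<close>

lemma tensor_bound:
  fixes \<theta> :: "nat \<Rightarrow> real \<Rightarrow> real"
  assumes "finite I" "i \<in> I" "x \<in> Rspace I"
    and \<theta>: "\<And>j. j \<in> I \<Longrightarrow> bump_class N (K j) (c j) (h j) (\<theta> j)"
    and v: "\<bar>v\<bar> \<le> K i * D" "x i \<notin> S \<Longrightarrow> v = 0"
  shows "\<bar>(\<Prod>j\<in>I - {i}. \<theta> j (x j)) * v\<bar> \<le>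
    (\<Prod>j\<in>I. K j) * D * indicator (Pi\<^sub>E I (\<lambda>j. if j = i then S else {c j - h j..c j + h j})) x"
proof (cases "x \<in> Pi\<^sub>E I (\<lambda>j. if j = i then S else {c j - h j..c j + h j})")
  case True
  have "\<bar>(\<Prod>j\<in>I - {i}. \<theta> j (x j)) * v\<bar> = (\<Prod>j\<in>I - {i}. \<bar>\<theta> j (x j)\<bar>) * \<bar>v\<bar>"
    by (simp add: abs_mult abs_prod)
  also have "\<dots> \<le> (\<Prod>j\<in>I - {i}. K j) * (K i * D)"
    using \<theta> v(1) by (intro mult_mono prod_mono prod_nonneg)
      (auto intro: bump_class_bound bump_classD(1))
  also have "\<dots> = (\<Prod>j\<in>I. K j) * D"
    using assms(1,2) by (subst prod.remove[of I i]) auto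
  finally show ?thesis using True by simp
next
  case False
  then obtain j where j: "j \<in> I" "x j \<notin> (if j = i then S else {c j - h j..c j + h j})"
    using assms(3) by (auto simp: PiE_iff)
  have "(\<Prod>j\<in>I - {i}. \<theta> j (x j)) * v = 0"
  proof (cases "j = i")
    case True
    then show ?thesis using j v(2) by auto
  next
    case False
    then have "h j \<le> \<bar>x j - c j\<bar>" using j by auto
    then have "\<theta> j (x j) = 0" using bump_class_eq_0[OF \<theta>[OF j(1)]] by simp
    then show ?thesis using False j assms(1) by (auto intro!: prod_zero)
  qed
  then show ?thesis using False by simp
qed

lemma tensor_sum_measurable:
  assumes "\<And>j. j \<in> I \<Longrightarrow> \<phi> j \<in> borel_measurable borel" "\<And>j. j \<in> I \<Longrightarrow> \<psi> j \<in> borel_measurable borel"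
  shows "tensor_sum I \<phi> A \<psi> \<in> borel_measurable (lebI I)"
proof -
  have "(\<lambda>x. \<Prod>j\<in>I. \<theta> j (x j)) \<in> borel_measurable (lebI I)"
    if "\<And>j. j \<in> I \<Longrightarrow> \<theta> j \<in> borel_measurable borel" for \<theta> :: "nat \<Rightarrow> real \<Rightarrow> real"
  proof (rule borel_measurable_prod)
    fix j assume j: "j \<in> I"
    have "(\<lambda>x. x j) \<in> measurable (lebI I) borel"
      using measurable_component_singleton[OF j, of "\<lambda>_. lborel"] by simp
    then show "(\<lambda>x. \<theta> j (x j)) \<in> borel_measurable (lebI I)"
      using that[OF j] by (rule measurable_compose)
  qed
  then show ?thesis
    using assms unfolding tensor_sum_def[abs_def] by simp
qed

text \<open>Each summand is bounded by height times a power of D on a box, so membership reduces to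
  numerical inequalities. The constant 4 is that of \<open>Lr_norm_le_two_sets\<close>; 8 includes
  the 2 of the Hoelder bound, and the 2 inside the power accounts for the translated box. The case p
  i = 1, k = 0 is left to \<open>n0\<close>: there height times volume does not decrease under
  dilation, so no such estimate could be met with a small Q.\<close>

lemma nikolskii_tensor_sum:
  assumes I: "finite I"
    and \<phi>: "\<And>j. j \<in> I \<Longrightarrow> bump_class N (K1 j) (c1 j) (h1 j) (\<phi> j)"
    and \<psi>: "\<And>j. j \<in> I \<Longrightarrow> bump_class N (K2 j) (c2 j) (h2 j) (\<psi> j)"
    and p: "\<And>j. j \<in> I \<Longrightarrow> 1 \<le> p j"
    and \<beta>: "\<And>j. j \<in> I \<Longrightarrow> 0 < \<beta> j" "\<And>j. j \<in> I \<Longrightarrow> sfloor (\<beta> j) < N"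
    and n0: "\<And>i. i \<in> I \<Longrightarrow> p i = 1 \<Longrightarrow> Lr_norm I (p i) (tensor_sum I \<phi> A \<psi>) \<le> ennreal (Q i)"
    and n1: "\<And>i k. i \<in> I \<Longrightarrow> k \<le> sfloor (\<beta> i) \<Longrightarrow> p i \<noteq> 1 \<or> 0 < k \<Longrightarrow>
      4 * ((\<Prod>j\<in>I. K1 j) / h1 i ^ k * (\<Prod>j\<in>I. 2 * h1 j) powr enn2real (inverse (p i))) \<le> Q i"
    and n2: "\<And>i k. i \<in> I \<Longrightarrow> k \<le> sfloor (\<beta> i) \<Longrightarrow>
      4 * (\<bar>A\<bar> * (\<Prod>j\<in>I. K2 j) / h2 i ^ k * (\<Prod>j\<in>I. 2 * h2 j) powr enn2real (inverse (p i))) \<le> Q i"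
    and n3: "\<And>i. i \<in> I \<Longrightarrow> 8 * ((\<Prod>j\<in>I. K1 j) / h1 i powr \<beta> i *
        (2 * (\<Prod>j\<in>I. 2 * h1 j)) powr enn2real (inverse (p i))) \<le> Q i"
    and n4: "\<And>i. i \<in> I \<Longrightarrow> 8 * (\<bar>A\<bar> * (\<Prod>j\<in>I. K2 j) / h2 i powr \<beta> i *
        (2 * (\<Prod>j\<in>I. 2 * h2 j)) powr enn2real (inverse (p i))) \<le> Q i"
  shows "tensor_sum I \<phi> A \<psi> \<in> nikolskii I p \<beta> Q"
proof -
  let ?F = "tensor_sum I \<phi> A \<psi>"
  let ?a = "\<lambda>i x. \<Prod>j\<in>I - {i}. \<phi> j (x j)"
  let ?b = "\<lambda>i x. \<Prod>j\<in>I - {i}. \<psi> j (x j)"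
  note h1 = bump_classD(2)[OF \<phi>]
  note h2 = bump_classD(2)[OF \<psi>]
  have dn: "(deriv ^^ k) (\<lambda>u. ?F (x(i := u))) =
      (\<lambda>u. ?a i x * (deriv ^^ k) (\<phi> i) u + A * ?b i x * (deriv ^^ k) (\<psi> i) u)"
    if "i \<in> I" "k \<le> N" for i k x
  proof -
    have "(\<lambda>u. ?F (x(i := u))) = (\<lambda>u. ?a i x * \<phi> i u + A * ?b i x * \<psi> i u)"
      using tensor_sum_upd[OF I that(1)] by auto
    moreover have "(deriv ^^ k) (\<lambda>u. ?a i x * \<phi> i u + A * ?b i x * \<psi> i u) =
        (\<lambda>u. ?a i x * (deriv ^^ k) (\<phi> i) u + A * ?b i x * (deriv ^^ k) (\<psi> i) u)"
      using that bump_classD(3)[OF \<phi>[OF that(1)]] bump_classD(3)[OF \<psi>[OF that(1)]]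
      by (intro funpow_deriv_lincomb) auto
    ultimately show ?thesis by simp
  qed
  have partial: "partial i k ?F x =
      ?a i x * (deriv ^^ k) (\<phi> i) (x i) + A * ?b i x * (deriv ^^ k) (\<psi> i) (x i)"
    if "i \<in> I" "k \<le> N" for i k x
    unfolding partial_def dn[OF that] ..
  have K1: "0 \<le> (\<Prod>j\<in>I. K1 j)" using bump_classD(1)[OF \<phi>] by (intro prod_nonneg) auto
  have K2: "0 \<le> (\<Prod>j\<in>I. K2 j)" using bump_classD(1)[OF \<psi>] by (intro prod_nonneg) auto
  have vol1: "0 < (\<Prod>j\<in>I. 2 * h1 j)" using h1 by (intro prod_pos) auto
  have vol2: "0 < (\<Prod>j\<in>I. 2 * h2 j)" using h2 by (intro prod_pos) auto
  have box_sets: "Pi\<^sub>E I (\<lambda>j. if j = i then S else {c j - h j..c j + h j}) \<in> sets (lebI I)"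
    if "S \<in> sets borel" for i S and c h :: "nat \<Rightarrow> real"
    using I that by (intro sets_PiM_I_finite) auto
  have box_vol: "emeasure (lebI I) (Pi\<^sub>E I (\<lambda>j. if j = i then {c j - h j..c j + h j} else {c j - h j..c j + h j}))
      \<le> ennreal (\<Prod>j\<in>I. 2 * h j)" if "\<And>j. j \<in> I \<Longrightarrow> 0 < h j" for i and c h :: "nat \<Rightarrow> real"
    using I that by (intro emeasure_box_le) (auto simp: less_imp_le)
  \<comment> \<open>An increment in direction i lives on the box together with its shift by -t,
    which at most doubles the volume.\<close>
  have box_vol2: "emeasure (lebI I) (Pi\<^sub>E I (\<lambda>j. if j = i
        then {c i - h i..c i + h i} \<union> {c i - t - h i..c i - t + h i} else {c j - h j..c j + h j}))
      \<le> ennreal (2 * (\<Prod>j\<in>I. 2 * h j))" if "i \<in> I" "\<And>j. j \<in> I \<Longrightarrow> 0 < h j"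
    for i t and c h :: "nat \<Rightarrow> real"
  proof -
    have "emeasure lborel ({c i - h i..c i + h i} \<union> {c i - t - h i..c i - t + h i}) \<le>
        emeasure lborel {c i - h i..c i + h i} + emeasure lborel {c i - t - h i..c i - t + h i}"
      by (intro emeasure_subadditive) auto
    also have "\<dots> = ennreal (4 * h i)"
      using that(2)[OF that(1)] by (simp flip: ennreal_plus)
    finally have "emeasure (lebI I) (Pi\<^sub>E I (\<lambda>j. if j = i
        then {c i - h i..c i + h i} \<union> {c i - t - h i..c i - t + h i} else {c j - h j..c j + h j}))
      \<le> ennreal (\<Prod>j\<in>I. (if j = i then 2 else 1) * (2 * h j))"
      using I that by (intro emeasure_box_le) (auto simp: less_imp_le)
    also have "(\<Prod>j\<in>I. (if j = i then 2 else 1) * (2 * h j)) = 2 * (\<Prod>j\<in>I. 2 * h j)"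
      using I that(1) by (simp add: prod.distrib)
    finally show ?thesis .
  qed
  show ?thesis
    unfolding nikolskii_def
  proof (intro CollectI conjI ballI allI impI)
    show "?F \<in> borel_measurable (lebI I)"
      using bump_class_measurable[OF \<phi>] bump_class_measurable[OF \<psi>] by (rule tensor_sum_measurable)
    fix i assume i: "i \<in> I"
    note D1 = bump_classD[OF \<phi>[OF i]]
    note D2 = bump_classD[OF \<psi>[OF i]]
    show "(deriv ^^ k) (\<lambda>u. ?F (x(i := u))) field_differentiable at t"
      if "k < sfloor (\<beta> i)" for x k t
      unfolding dn[OF i less_imp_le[OF less_trans[OF that \<beta>(2)[OF i]]]]
      using that \<beta>(2)[OF i] D1(3)[of k t] D2(3)[of k t]
      by (intro field_differentiable_add field_differentiable_mult field_differentiable_const) auto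
    show "Lr_norm I (p i) (partial i k ?F) \<le> ennreal (Q i)" if k: "k \<le> sfloor (\<beta> i)" for k
    proof (cases "p i = 1 \<and> k = 0")
      case True
      have "partial i 0 ?F = ?F" by (simp add: partial_def fun_eq_iff)
      then show ?thesis using True n0[OF i] by simp
    next
      case False
      let ?S = "\<lambda>c h. Pi\<^sub>E I (\<lambda>j. if j = i then {c j - h j..c j + h j} else {c j - h j..c j + h j})"
      have kN: "k \<le> N" using k \<beta>(2)[OF i] by simp
      show ?thesis
      proof (rule Lr_norm_le_two_sets[where
            ?B1.0 = "(\<Prod>j\<in>I. K1 j) / h1 i ^ k" and ?B2.0 = "\<bar>A\<bar> * (\<Prod>j\<in>I. K2 j) / h2 i ^ k" and
            ?S1.0 = "?S c1 h1" and ?S2.0 = "?S c2 h2" and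
            ?V1.0 = "\<Prod>j\<in>I. 2 * h1 j" and ?V2.0 = "\<Prod>j\<in>I. 2 * h2 j"])
        fix x assume x: "x \<in> Rspace I"
        have "\<bar>?a i x * (deriv ^^ k) (\<phi> i) (x i)\<bar> \<le> (\<Prod>j\<in>I. K1 j) * (1 / h1 i ^ k) *
            indicator (Pi\<^sub>E I (\<lambda>j. if j = i then {c1 i - h1 i..c1 i + h1 i} else {c1 j - h1 j..c1 j + h1 j})) x"
          using D1(4)[OF kN, of "x i"] D1(5)[OF kN, of "x i"]
          by (intro tensor_bound[OF I i x \<phi>]) auto
        moreover have "\<bar>?b i x * (deriv ^^ k) (\<psi> i) (x i)\<bar> \<le> (\<Prod>j\<in>I. K2 j) * (1 / h2 i ^ k) *
            indicator (Pi\<^sub>E I (\<lambda>j. if j = i then {c2 i - h2 i..c2 i + h2 i} else {c2 j - h2 j..c2 j + h2 j})) x"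
          using D2(4)[OF kN, of "x i"] D2(5)[OF kN, of "x i"]
          by (intro tensor_bound[OF I i x \<psi>]) auto
        then have "\<bar>A\<bar> * \<bar>?b i x * (deriv ^^ k) (\<psi> i) (x i)\<bar> \<le> \<bar>A\<bar> * ((\<Prod>j\<in>I. K2 j) * (1 / h2 i ^ k) *
            indicator (Pi\<^sub>E I (\<lambda>j. if j = i then {c2 i - h2 i..c2 i + h2 i} else {c2 j - h2 j..c2 j + h2 j})) x)"
          by (rule mult_left_mono) auto
        ultimately have "\<bar>?a i x * (deriv ^^ k) (\<phi> i) (x i)\<bar> + \<bar>A * ?b i x * (deriv ^^ k) (\<psi> i) (x i)\<bar> \<le>
          (\<Prod>j\<in>I. K1 j) * (1 / h1 i ^ k) *
            indicator (Pi\<^sub>E I (\<lambda>j. if j = i then {c1 i - h1 i..c1 i + h1 i} else {c1 j - h1 j..c1 j + h1 j})) x +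
           \<bar>A\<bar> * ((\<Prod>j\<in>I. K2 j) * (1 / h2 i ^ k) *
            indicator (Pi\<^sub>E I (\<lambda>j. if j = i then {c2 i - h2 i..c2 i + h2 i} else {c2 j - h2 j..c2 j + h2 j})) x)"
          by (simp add: abs_mult mult.assoc)
        then show "\<bar>partial i k ?F x\<bar> \<le> (\<Prod>j\<in>I. K1 j) / h1 i ^ k * indicator (?S c1 h1) x +
            \<bar>A\<bar> * (\<Prod>j\<in>I. K2 j) / h2 i ^ k * indicator (?S c2 h2) x"
          unfolding partial[OF i kN]
          by (intro order_trans[OF abs_triangle_ineq]) (simp cong: if_cong)
      next
        show "1 \<le> p i" using p[OF i] .
        show "0 \<le> (\<Prod>j\<in>I. K1 j) / h1 i ^ k" "0 \<le> \<bar>A\<bar> * (\<Prod>j\<in>I. K2 j) / h2 i ^ k"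
          using K1 K2 h1[OF i] h2[OF i] by (auto intro!: divide_nonneg_nonneg mult_nonneg_nonneg)
        show "?S c1 h1 \<in> sets (lebI I)" "?S c2 h2 \<in> sets (lebI I)"
          using I by (intro sets_PiM_I_finite; simp)+
        show "emeasure (lebI I) (?S c1 h1) \<le> ennreal (\<Prod>j\<in>I. 2 * h1 j)"
          by (rule box_vol[OF h1])
        show "emeasure (lebI I) (?S c2 h2) \<le> ennreal (\<Prod>j\<in>I. 2 * h2 j)"
          by (rule box_vol[OF h2])
        show "4 * ((\<Prod>j\<in>I. K1 j) / h1 i ^ k * (\<Prod>j\<in>I. 2 * h1 j) powr enn2real (inverse (p i))) \<le> Q i"
          using n1[OF i k] False by blast
      qed (fact vol1 vol2 n2[OF i k])+
    qed
    let ?s = "sfloor (\<beta> i)"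
    let ?\<eta> = "\<beta> i - real ?s"
    show "Lr_norm I (p i) (\<lambda>x. partial i ?s ?F (x(i := x i + t)) - partial i ?s ?F x)
        \<le> ennreal (Q i * \<bar>t\<bar> powr ?\<eta>)" for t
    proof -
      let ?S = "\<lambda>c h. Pi\<^sub>E I (\<lambda>j. if j = i then {c i - h i..c i + h i} \<union> {c i - t - h i..c i - t + h i}
        else {c j - h j..c j + h j})"
      let ?D1 = "2 / h1 i powr \<beta> i * \<bar>t\<bar> powr ?\<eta>"
      let ?D2 = "2 / h2 i powr \<beta> i * \<bar>t\<bar> powr ?\<eta>"
      have sN: "?s \<le> N" using \<beta>(2)[OF i] by simp
      \<comment> \<open>Moves the Hoelder factor 2 out of D, turning the hypotheses with 8 into the
        form with 4 and multiplying by the power of |t|.\<close>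
      have sc: "4 * (a * (2 / b * c) * v) \<le> Q i * c"
        if "8 * (a / b * v) \<le> Q i" "0 \<le> c" for a b c v :: real
        using mult_right_mono[OF that] by (simp add: algebra_simps)
      show ?thesis
      proof (rule Lr_norm_le_two_sets[where
            ?B1.0 = "(\<Prod>j\<in>I. K1 j) * ?D1" and ?B2.0 = "\<bar>A\<bar> * (\<Prod>j\<in>I. K2 j) * ?D2" and
            ?S1.0 = "?S c1 h1" and ?S2.0 = "?S c2 h2" and
            ?V1.0 = "2 * (\<Prod>j\<in>I. 2 * h1 j)" and ?V2.0 = "2 * (\<Prod>j\<in>I. 2 * h2 j)"])
        fix x assume x: "x \<in> Rspace I"
        let ?d1 = "(deriv ^^ ?s) (\<phi> i) (x i + t) - (deriv ^^ ?s) (\<phi> i) (x i)"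
        let ?d2 = "(deriv ^^ ?s) (\<psi> i) (x i + t) - (deriv ^^ ?s) (\<psi> i) (x i)"
        have ab: "?a i (x(i := u)) = ?a i x" "?b i (x(i := u)) = ?b i x" for u
          by (auto intro!: prod.cong)
        have eq: "partial i ?s ?F (x(i := x i + t)) - partial i ?s ?F x = ?a i x * ?d1 + A * (?b i x * ?d2)"
          unfolding partial[OF i sN] ab by (simp add: algebra_simps)
        have "\<bar>?a i x * ?d1\<bar> \<le> (\<Prod>j\<in>I. K1 j) * ?D1 * indicator (?S c1 h1) x"
        proof (rule tensor_bound[OF I i x \<phi>])
          show "\<bar>?d1\<bar> \<le> K1 i * ?D1"
            using bump_class_hoelder[OF \<phi>[OF i] \<beta>(2)[OF i] sfloor_bounds[OF \<beta>(1)[OF i]], of "x i" t]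
            by (simp add: mult.commute mult.left_commute)
          assume "x i \<notin> {c1 i - h1 i..c1 i + h1 i} \<union> {c1 i - t - h1 i..c1 i - t + h1 i}"
          then have "h1 i \<le> \<bar>x i - c1 i\<bar>" "h1 i \<le> \<bar>x i + t - c1 i\<bar>" by auto
          then show "?d1 = 0" using D1(5)[OF sN] by simp
        qed
        moreover have "\<bar>?b i x * ?d2\<bar> \<le> (\<Prod>j\<in>I. K2 j) * ?D2 * indicator (?S c2 h2) x"
        proof (rule tensor_bound[OF I i x \<psi>])
          show "\<bar>?d2\<bar> \<le> K2 i * ?D2"
            using bump_class_hoelder[OF \<psi>[OF i] \<beta>(2)[OF i] sfloor_bounds[OF \<beta>(1)[OF i]], of "x i" t]
            by (simp add: mult.commute mult.left_commute)
          assume "x i \<notin> {c2 i - h2 i..c2 i + h2 i} \<union> {c2 i - t - h2 i..c2 i - t + h2 i}"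
          then have "h2 i \<le> \<bar>x i - c2 i\<bar>" "h2 i \<le> \<bar>x i + t - c2 i\<bar>" by auto
          then show "?d2 = 0" using D2(5)[OF sN] by simp
        qed
        then have "\<bar>A\<bar> * \<bar>?b i x * ?d2\<bar> \<le> \<bar>A\<bar> * ((\<Prod>j\<in>I. K2 j) * ?D2 * indicator (?S c2 h2) x)"
          by (rule mult_left_mono) auto
        ultimately have "\<bar>?a i x * ?d1\<bar> + \<bar>A * (?b i x * ?d2)\<bar> \<le> (\<Prod>j\<in>I. K1 j) * ?D1 * indicator (?S c1 h1) x
            + \<bar>A\<bar> * ((\<Prod>j\<in>I. K2 j) * ?D2 * indicator (?S c2 h2) x)"
          unfolding abs_mult[of A] by (rule add_mono)
        then show "\<bar>partial i ?s ?F (x(i := x i + t)) - partial i ?s ?F x\<bar> \<le>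
            (\<Prod>j\<in>I. K1 j) * ?D1 * indicator (?S c1 h1) x + \<bar>A\<bar> * (\<Prod>j\<in>I. K2 j) * ?D2 * indicator (?S c2 h2) x"
          unfolding eq using abs_triangle_ineq[of "?a i x * ?d1" "A * (?b i x * ?d2)"]
          by (simp add: mult.assoc)
      next
        show "4 * ((\<Prod>j\<in>I. K1 j) * ?D1 * (2 * (\<Prod>j\<in>I. 2 * h1 j)) powr enn2real (inverse (p i)))
            \<le> Q i * \<bar>t\<bar> powr ?\<eta>"
          by (rule sc[OF n3[OF i]]) simp
        show "4 * (\<bar>A\<bar> * (\<Prod>j\<in>I. K2 j) * ?D2 * (2 * (\<Prod>j\<in>I. 2 * h2 j)) powr enn2real (inverse (p i)))
            \<le> Q i * \<bar>t\<bar> powr ?\<eta>"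
          by (rule sc[OF n4[OF i]]) simp
        show "1 \<le> p i" using p[OF i] .
        show "0 \<le> (\<Prod>j\<in>I. K1 j) * ?D1" "0 \<le> \<bar>A\<bar> * (\<Prod>j\<in>I. K2 j) * ?D2"
          using K1 K2 by (auto intro!: divide_nonneg_nonneg mult_nonneg_nonneg)
        show "?S c1 h1 \<in> sets (lebI I)" "?S c2 h2 \<in> sets (lebI I)"
          by (rule box_sets, simp)+
        show "emeasure (lebI I) (?S c1 h1) \<le> ennreal (2 * (\<Prod>j\<in>I. 2 * h1 j))"
          by (rule box_vol2[OF i h1])
        show "emeasure (lebI I) (?S c2 h2) \<le> ennreal (2 * (\<Prod>j\<in>I. 2 * h2 j))"
          by (rule box_vol2[OF i h2])
      qed (use vol1 vol2 in auto)
    qed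
  qed
qed

section \<open>Densities of tensor product form\<close>

text \<open>Keeps \<open>{1..d}\<close> from being rewritten to \<open>{Suc 0..d}\<close>.\<close>

declare One_nat_def [simp del]

lemma tensor_sum_integral:
  assumes I: "finite I"
    and "\<And>j. j \<in> I \<Longrightarrow> integrable lborel (\<phi> j)" "\<And>j. j \<in> I \<Longrightarrow> integrable lborel (\<psi> j)"
  shows "integrable (lebI I) (tensor_sum I \<phi> A \<psi>)"
    and "integral\<^sup>L (lebI I) (tensor_sum I \<phi> A \<psi>) =
      (\<Prod>j\<in>I. integral\<^sup>L lborel (\<phi> j)) + A * (\<Prod>j\<in>I. integral\<^sup>L lborel (\<psi> j))"
proof -
  note int = lborel_product.product_integrable_prod[OF I]
  note eq = lborel_product.product_integral_prod[OF I]
  show "integrable (lebI I) (tensor_sum I \<phi> A \<psi>)"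
    unfolding tensor_sum_def[abs_def] using int[of \<phi>] int[of \<psi>] assms by simp
  show "integral\<^sup>L (lebI I) (tensor_sum I \<phi> A \<psi>) =
      (\<Prod>j\<in>I. integral\<^sup>L lborel (\<phi> j)) + A * (\<Prod>j\<in>I. integral\<^sup>L lborel (\<psi> j))"
    unfolding tensor_sum_def[abs_def] using int[of \<phi>] int[of \<psi>] eq[of \<phi>] eq[of \<psi>] assms by simp
qed

text \<open>By Fubini each integrated coordinate multiplies the base term by 1 and the perturbation
  by the integral of its factor. A single mean-zero factor outside I therefore removes the
  perturbation.\<close>

lemma marginal_tensor_sum:
  assumes I: "I \<subseteq> {1..d}"
    and int: "\<And>j. j \<in> {1..d} \<Longrightarrow> integrable lborel (\<phi> j)" "\<And>j. j \<in> {1..d} \<Longrightarrow> integrable lborel (\<psi> j)"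
    and one: "\<And>j. j \<in> {1..d} \<Longrightarrow> integral\<^sup>L lborel (\<phi> j) = 1"
  shows "marginal d I (tensor_sum {1..d} \<phi> A \<psi>) =
    tensor_sum I \<phi> (A * (\<Prod>j\<in>{1..d} - I. integral\<^sup>L lborel (\<psi> j))) \<psi>"
proof
  fix x :: "nat \<Rightarrow> real"
  let ?J = "{1..d} - I"
  have split: "(\<Prod>j\<in>{1..d}. \<theta> j (merge I ?J (x, y) j)) = (\<Prod>j\<in>I. \<theta> j (x j)) * (\<Prod>j\<in>?J. \<theta> j (y j))"
    for \<theta> :: "nat \<Rightarrow> real \<Rightarrow> real" and y
  proof -
    have "(\<Prod>j\<in>{1..d}. \<theta> j (merge I ?J (x, y) j)) =
        (\<Prod>j\<in>?J. \<theta> j (merge I ?J (x, y) j)) * (\<Prod>j\<in>I. \<theta> j (merge I ?J (x, y) j))"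
      using I by (intro prod.subset_diff) auto
    moreover have "(\<Prod>j\<in>?J. \<theta> j (merge I ?J (x, y) j)) = (\<Prod>j\<in>?J. \<theta> j (y j))"
      by (intro prod.cong) (auto simp: merge_def)
    moreover have "(\<Prod>j\<in>I. \<theta> j (merge I ?J (x, y) j)) = (\<Prod>j\<in>I. \<theta> j (x j))"
      by (intro prod.cong) (auto simp: merge_def)
    ultimately show ?thesis by simp
  qed
  have i1: "integrable (lebI ?J) (\<lambda>y. \<Prod>j\<in>?J. \<phi> j (y j))"
    and i2: "integrable (lebI ?J) (\<lambda>y. \<Prod>j\<in>?J. \<psi> j (y j))"
    using int by (auto intro!: lborel_product.product_integrable_prod)
  have e1: "(\<integral>y. (\<Prod>j\<in>?J. \<phi> j (y j)) \<partial>lebI ?J) = 1"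
    using lborel_product.product_integral_prod[of ?J \<phi>] int one by simp
  have e2: "(\<integral>y. (\<Prod>j\<in>?J. \<psi> j (y j)) \<partial>lebI ?J) = (\<Prod>j\<in>?J. integral\<^sup>L lborel (\<psi> j))"
    using lborel_product.product_integral_prod[of ?J \<psi>] int by simp
  have "marginal d I (tensor_sum {1..d} \<phi> A \<psi>) x =
      (\<integral>y. (\<Prod>j\<in>I. \<phi> j (x j)) * (\<Prod>j\<in>?J. \<phi> j (y j))
        + (A * (\<Prod>j\<in>I. \<psi> j (x j))) * (\<Prod>j\<in>?J. \<psi> j (y j)) \<partial>lebI ?J)"
    unfolding marginal_def tensor_sum_def split by (simp add: mult.assoc)
  also have "\<dots> = (\<integral>y. (\<Prod>j\<in>I. \<phi> j (x j)) * (\<Prod>j\<in>?J. \<phi> j (y j)) \<partial>lebI ?J)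
      + (\<integral>y. (A * (\<Prod>j\<in>I. \<psi> j (x j))) * (\<Prod>j\<in>?J. \<psi> j (y j)) \<partial>lebI ?J)"
    using i1 i2 by (intro Bochner_Integration.integral_add) simp_all
  also have "\<dots> = tensor_sum I \<phi> (A * (\<Prod>j\<in>?J. integral\<^sup>L lborel (\<psi> j))) \<psi> x"
    by (simp add: e1 e2 tensor_sum_def)
  finally show "marginal d I (tensor_sum {1..d} \<phi> A \<psi>) x =
    tensor_sum I \<phi> (A * (\<Prod>j\<in>?J. integral\<^sup>L lborel (\<psi> j))) \<psi> x" .
qed

text \<open>Outside J both products share the same nonnegative factors, so domination has to be
  checked on the block only and is inherited by every larger index set.\<close>

lemma tensor_sum_nonneg:
  assumes "finite I" "J \<subseteq> I"
    and "\<And>j t. j \<in> I \<Longrightarrow> 0 \<le> \<phi> j t"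
    and "\<And>j. j \<in> I - J \<Longrightarrow> \<psi> j = \<phi> j"
    and dom: "\<bar>A * (\<Prod>j\<in>J. \<psi> j (x j))\<bar> \<le> (\<Prod>j\<in>J. \<phi> j (x j))"
  shows "\<bar>A * (\<Prod>j\<in>I. \<psi> j (x j))\<bar> \<le> (\<Prod>j\<in>I. \<phi> j (x j))" "0 \<le> tensor_sum I \<phi> A \<psi> x"
proof -
  have split: "(\<Prod>j\<in>I. \<theta> j (x j)) = (\<Prod>j\<in>I - J. \<theta> j (x j)) * (\<Prod>j\<in>J. \<theta> j (x j))"
    for \<theta> :: "nat \<Rightarrow> real \<Rightarrow> real"
    using assms(1,2) by (intro prod.subset_diff)
  have R: "0 \<le> (\<Prod>j\<in>I - J. \<phi> j (x j))" using assms(3) by (intro prod_nonneg) auto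
  have eq: "(\<Prod>j\<in>I - J. \<psi> j (x j)) = (\<Prod>j\<in>I - J. \<phi> j (x j))"
    using assms(4) by (intro prod.cong) auto
  have "\<bar>A * (\<Prod>j\<in>I. \<psi> j (x j))\<bar> = (\<Prod>j\<in>I - J. \<phi> j (x j)) * \<bar>A * (\<Prod>j\<in>J. \<psi> j (x j))\<bar>"
    unfolding split[of \<psi>] eq using R by (simp add: abs_mult)
  also have "\<dots> \<le> (\<Prod>j\<in>I. \<phi> j (x j))"
    unfolding split[of \<phi>] using R dom by (intro mult_left_mono)
  finally show *: "\<bar>A * (\<Prod>j\<in>I. \<psi> j (x j))\<bar> \<le> (\<Prod>j\<in>I. \<phi> j (x j))" .
  then show "0 \<le> tensor_sum I \<phi> A \<psi> x"
    unfolding tensor_sum_def by linarith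
qed

text \<open>Using \<phi> itself as perturbation factor outside J keeps the density factorised: only
  the factor of block J changes. The conditions on the perturbation are asked only for index sets
  containing J, since all other marginals are those of the base density.\<close>

lemma tensor_sum_in_class:
  assumes P: "partition_on {1..d} P" "J \<in> P"
    and \<phi>: "\<And>j. j \<in> {1..d} \<Longrightarrow> bump_class N (K1 j) (c1 j) (h1 j) (\<phi> j)"
    and \<psi>: "\<And>j. j \<in> {1..d} \<Longrightarrow> bump_class N (K2 j) (c2 j) (h2 j) (\<psi> j)"
    and \<phi>1: "\<And>j. j \<in> {1..d} \<Longrightarrow> integral\<^sup>L lborel (\<phi> j) = 1" "\<And>j t. j \<in> {1..d} \<Longrightarrow> 0 \<le> \<phi> j t"
    and \<psi>0: "\<And>j. j \<in> J \<Longrightarrow> integral\<^sup>L lborel (\<psi> j) = 0"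
    and \<psi>\<phi>: "\<And>j. j \<in> {1..d} - J \<Longrightarrow> \<psi> j = \<phi> j"
    and dom: "\<And>x. \<bar>A * (\<Prod>j\<in>J. \<psi> j (x j))\<bar> \<le> (\<Prod>j\<in>J. \<phi> j (x j))"
    and p: "\<And>j. j \<in> {1..d} \<Longrightarrow> 1 \<le> p j"
    and \<beta>: "\<And>j. j \<in> {1..d} \<Longrightarrow> 0 < \<beta> j" "\<And>j. j \<in> {1..d} \<Longrightarrow> sfloor (\<beta> j) < N"
    and L: "\<And>i. i \<in> {1..d} \<Longrightarrow> 0 < L i" "\<And>i. i \<in> {1..d} \<Longrightarrow> p i = 1 \<Longrightarrow> 1 \<le> L i"
    and n1: "\<And>I i k. I \<subseteq> {1..d} \<Longrightarrow> i \<in> I \<Longrightarrow> k \<le> sfloor (\<beta> i) \<Longrightarrow> p i \<noteq> 1 \<or> 0 < k \<Longrightarrow>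
      4 * ((\<Prod>j\<in>I. K1 j) / h1 i ^ k * (\<Prod>j\<in>I. 2 * h1 j) powr enn2real (inverse (p i))) \<le> L i"
    and n2: "\<And>I i k. J \<subseteq> I \<Longrightarrow> I \<subseteq> {1..d} \<Longrightarrow> i \<in> I \<Longrightarrow> k \<le> sfloor (\<beta> i) \<Longrightarrow>
      4 * (\<bar>A\<bar> * (\<Prod>j\<in>I. K2 j) / h2 i ^ k * (\<Prod>j\<in>I. 2 * h2 j) powr enn2real (inverse (p i))) \<le> L i"
    and n3: "\<And>I i. I \<subseteq> {1..d} \<Longrightarrow> i \<in> I \<Longrightarrow> 8 * ((\<Prod>j\<in>I. K1 j) / h1 i powr \<beta> i *
        (2 * (\<Prod>j\<in>I. 2 * h1 j)) powr enn2real (inverse (p i))) \<le> L i"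
    and n4: "\<And>I i. J \<subseteq> I \<Longrightarrow> I \<subseteq> {1..d} \<Longrightarrow> i \<in> I \<Longrightarrow> 8 * (\<bar>A\<bar> * (\<Prod>j\<in>I. K2 j) / h2 i powr \<beta> i *
        (2 * (\<Prod>j\<in>I. 2 * h2 j)) powr enn2real (inverse (p i))) \<le> L i"
  shows "tensor_sum {1..d} \<phi> A \<psi> \<in> nikolskii_densities_indep d p \<beta> L P"
proof -
  let ?f = "tensor_sum {1..d} \<phi> A \<psi>"
  have J: "J \<subseteq> {1..d}" "J \<noteq> {}"
    using P unfolding partition_on_def by auto
  have int: "integrable lborel (\<phi> j)" "integrable lborel (\<psi> j)" if "j \<in> {1..d}" for j
    using bump_class_integrable \<phi>[OF that] \<psi>[OF that] by blast+
  \<comment> \<open>The amplitude surviving in the marginal on I: if some j in J is integrated out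
    its factor has mean 0, and otherwise only factors of mean 1 are integrated out.\<close>
  define A' where "A' I = (if J \<subseteq> I then A else 0)" for I
  have marg: "marginal d I ?f = tensor_sum I \<phi> (A' I) \<psi>" if "I \<subseteq> {1..d}" for I
  proof -
    have "(\<Prod>j\<in>{1..d} - I. integral\<^sup>L lborel (\<psi> j)) = (if J \<subseteq> I then 1 else 0)"
    proof (cases "J \<subseteq> I")
      case True
      have "(\<Prod>j\<in>{1..d} - I. integral\<^sup>L lborel (\<psi> j)) = (\<Prod>j\<in>{1..d} - I. 1)"
      proof (rule prod.cong)
        fix j assume "j \<in> {1..d} - I"
        then have "j \<in> {1..d} - J" "j \<in> {1..d}" using True by auto
        then show "integral\<^sup>L lborel (\<psi> j) = 1" using \<psi>\<phi> \<phi>1(1) by metis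
      qed simp
      then show ?thesis using True by simp
    next
      case False
      then show ?thesis using \<psi>0 J by (auto intro!: prod_zero)
    qed
    then show ?thesis
      using marginal_tensor_sum[OF that int(1) int(2) \<phi>1(1), where A = A] by (auto simp: A'_def)
  qed
  have nonneg: "0 \<le> tensor_sum I \<phi> (A' I) \<psi> x" if "I \<subseteq> {1..d}" for I x
  proof (cases "J \<subseteq> I")
    case True
    have "finite I" using that finite_subset by blast
    then have "0 \<le> tensor_sum I \<phi> A \<psi> x"
      using True that \<phi>1(2) \<psi>\<phi> by (intro tensor_sum_nonneg(2)[where J = J] dom) auto
    then show ?thesis using True by (simp add: A'_def)
  next
    case False
    then show ?thesis
      using that \<phi>1(2) by (auto simp: A'_def tensor_sum_def intro!: prod_nonneg)
  qed
  have total: "(\<integral>\<^sup>+x. ennreal (tensor_sum I \<phi> (A' I) \<psi> x) \<partial>lebI I) = 1" if "I \<subseteq> {1..d}" for I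
  proof -
    have fin: "finite I" using that finite_subset by blast
    have I: "j \<in> I \<Longrightarrow> j \<in> {1..d}" for j using that by auto
    \<comment> \<open>Either the amplitude is 0, or I contains the nonempty J and hence a factor of
      mean 0: no marginal gains mass.\<close>
    have z: "A' I * (\<Prod>j\<in>I. integral\<^sup>L lborel (\<psi> j)) = 0"
      using \<psi>0 J fin by (auto simp: A'_def prod_zero_iff)
    have "integral\<^sup>L (lebI I) (tensor_sum I \<phi> (A' I) \<psi>) = 1"
      using tensor_sum_integral(2)[OF fin int(1)[OF I] int(2)[OF I], where A = "A' I"] z \<phi>1(1)[OF I] by simp
    then show ?thesis
      using nn_integral_eq_integral[OF tensor_sum_integral(1)[OF fin int(1)[OF I] int(2)[OF I], where A = "A' I"]]
        nonneg[OF that] by simp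
  qed
  have f: "?f = tensor_sum {1..d} \<phi> (A' {1..d}) \<psi>"
    using J by (simp add: A'_def)
  have "prob_density d ?f"
    unfolding prob_density_def
  proof (intro conjI ballI)
    show "?f \<in> borel_measurable (lebI {1..d})"
      using bump_class_measurable[OF \<phi>] bump_class_measurable[OF \<psi>] by (rule tensor_sum_measurable)
    show "0 \<le> ?f x" for x using nonneg[of "{1..d}" x] f by simp
    show "(\<integral>\<^sup>+x. ennreal (?f x) \<partial>lebI {1..d}) = 1" using total[of "{1..d}"] f by simp
  qed
  moreover have "continuous_on (Rspace {1..d}) ?f"
  proof -
    have "continuous_on (Rspace {1..d}) (\<lambda>x. \<theta> j (x j))" if "\<And>t. isCont (\<theta> j) t"
      for \<theta> :: "nat \<Rightarrow> real \<Rightarrow> real" and j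
    proof (rule continuous_on_compose2[of UNIV "\<theta> j"])
      show "continuous_on UNIV (\<theta> j)" using that by (simp add: continuous_at_imp_continuous_on)
      show "continuous_on (Rspace {1..d}) (\<lambda>x. x j)"
        by (rule continuous_on_subset[OF continuous_on_product_coordinates]) simp
    qed simp
    then show ?thesis
      unfolding tensor_sum_def[abs_def]
      using bump_class_isCont[OF \<phi>] bump_class_isCont[OF \<psi>]
      by (intro continuous_on_add continuous_on_mult continuous_on_const continuous_on_prod) auto
  qed
  moreover have "marginal d I ?f \<in> nikolskii I p \<beta> L" if I: "I \<noteq> {}" "I \<subseteq> {1..d}" for I
    unfolding marg[OF I(2)]
  proof (rule nikolskii_tensor_sum)
    have I': "j \<in> I \<Longrightarrow> j \<in> {1..d}" for j using I by auto
    show "finite I" using I finite_subset by blast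
    show "bump_class N (K1 j) (c1 j) (h1 j) (\<phi> j)" "bump_class N (K2 j) (c2 j) (h2 j) (\<psi> j)"
      "1 \<le> p j" "0 < \<beta> j" "sfloor (\<beta> j) < N" if "j \<in> I" for j
      using \<phi> \<psi> p \<beta> I'[OF that] by auto
    \<comment> \<open>The exceptional L1 case: a nonnegative marginal of total mass 1 has norm
      exactly 1.\<close>
    show "Lr_norm I (p i) (tensor_sum I \<phi> (A' I) \<psi>) \<le> ennreal (L i)" if "i \<in> I" "p i = 1" for i
      using total[OF I(2)] nonneg[OF I(2)] that L(2)[OF I'[OF that(1)]] ennpow_ennreal[of 1 1]
      by (auto simp: Lr_norm_def)
    show "4 * ((\<Prod>j\<in>I. K1 j) / h1 i ^ k * (\<Prod>j\<in>I. 2 * h1 j) powr enn2real (inverse (p i))) \<le> L i"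
      if "i \<in> I" "k \<le> sfloor (\<beta> i)" "p i \<noteq> 1 \<or> 0 < k" for i k
      by (rule n1[OF I(2) that])
    show "4 * (\<bar>A' I\<bar> * (\<Prod>j\<in>I. K2 j) / h2 i ^ k * (\<Prod>j\<in>I. 2 * h2 j) powr enn2real (inverse (p i))) \<le> L i"
      if "i \<in> I" "k \<le> sfloor (\<beta> i)" for i k
      using n2[OF _ I(2) that] L(1)[OF I'[OF that(1)]] by (auto simp: A'_def less_imp_le)
    show "8 * ((\<Prod>j\<in>I. K1 j) / h1 i powr \<beta> i *
        (2 * (\<Prod>j\<in>I. 2 * h1 j)) powr enn2real (inverse (p i))) \<le> L i"
      if "i \<in> I" for i
      by (rule n3[OF I(2) that])
    show "8 * (\<bar>A' I\<bar> * (\<Prod>j\<in>I. K2 j) / h2 i powr \<beta> i *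
        (2 * (\<Prod>j\<in>I. 2 * h2 j)) powr enn2real (inverse (p i))) \<le> L i"
      if "i \<in> I" for i
      using n4[OF _ I(2) that] L(1)[OF I'[OF that]] by (auto simp: A'_def less_imp_le)
  qed
  moreover have "?f x = (\<Prod>I\<in>P. marginal d I ?f (restrict x I))" for x
  proof -
    have finP: "finite P" using P(1) finite_elements by blast
    have sub: "I \<subseteq> {1..d}" if "I \<in> P" for I
      using P(1) that unfolding partition_on_def by auto
    have m: "marginal d I ?f (restrict x I) =
        (if I = J then tensor_sum J \<phi> A \<psi> x else (\<Prod>j\<in>I. \<phi> j (x j)))" if "I \<in> P" for I
    proof -
      \<comment> \<open>Blocks are nonempty and disjoint, so among the marginals over blocks only
        that of J sees the perturbation.\<close>
      have "J \<subseteq> I \<longleftrightarrow> I = J"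
        using P J that unfolding partition_on_def disjoint_def by blast
      then show ?thesis
        using marg[OF sub[OF that]] by (auto simp: tensor_sum_def A'_def)
    qed
    have disj: "A \<inter> B = {}" if "A \<in> P" "B \<in> P" "A \<noteq> B" for A B
      using P(1) that unfolding partition_on_def disjoint_def by simp
    have "\<Union>P = {1..d}" using P(1) unfolding partition_on_def by simp
    then have "\<Union>(P - {J}) = {1..d} - J"
      using disj[OF _ P(2)] P(2) by fast
    moreover have "(\<Prod>j\<in>\<Union>(P - {J}). \<phi> j (x j)) = (\<Prod>I\<in>P - {J}. \<Prod>j\<in>I. \<phi> j (x j))"
    proof (subst prod.Union_disjoint)
      show "\<forall>A\<in>P - {J}. finite A" using sub finite_subset by blast
      show "\<forall>A\<in>P - {J}. \<forall>B\<in>P - {J}. A \<noteq> B \<longrightarrow> A \<inter> B = {}"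
        using disj by simp
    qed simp
    ultimately have R: "(\<Prod>I\<in>P - {J}. \<Prod>j\<in>I. \<phi> j (x j)) = (\<Prod>j\<in>{1..d} - J. \<phi> j (x j))" by simp
    have "(\<Prod>I\<in>P. marginal d I ?f (restrict x I)) = tensor_sum J \<phi> A \<psi> x * (\<Prod>j\<in>{1..d} - J. \<phi> j (x j))"
      using finP P(2) by (subst prod.remove[of P J]) (auto simp: m R[symmetric] intro!: prod.cong)
    moreover have "?f x = tensor_sum J \<phi> A \<psi> x * (\<Prod>j\<in>{1..d} - J. \<phi> j (x j))"
    proof -
      have split: "(\<Prod>j\<in>{1..d}. \<theta> j (x j)) = (\<Prod>j\<in>{1..d} - J. \<theta> j (x j)) * (\<Prod>j\<in>J. \<theta> j (x j))"
        for \<theta> :: "nat \<Rightarrow> real \<Rightarrow> real"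
        using J by (intro prod.subset_diff) auto
      have "(\<Prod>j\<in>{1..d} - J. \<psi> j (x j)) = (\<Prod>j\<in>{1..d} - J. \<phi> j (x j))"
        using \<psi>\<phi> by (intro prod.cong) auto
      then show ?thesis
        unfolding tensor_sum_def split[of \<phi>] split[of \<psi>] by (simp add: algebra_simps)
    qed
    ultimately show ?thesis by simp
  qed
  ultimately show ?thesis
    unfolding nikolskii_densities_indep_def nikolskii_densities_def by blast
qed

section \<open>Testing a product law against a mixture\<close>

text \<open>Both measures agree on boxes, by Tonelli. This identifies the likelihood ratio of a
  sample as the product of the ratios of single observations.\<close>

lemma PiM_density:
  assumes K: "finite K" and N: "sigma_finite_measure N" "sigma_finite_measure (density N g)"
    and g: "g \<in> borel_measurable N"
  shows "PiM K (\<lambda>_. density N g) = density (PiM K (\<lambda>_. N)) (\<lambda>\<omega>. \<Prod>k\<in>K. g (\<omega> k))"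
proof -
  interpret N: product_sigma_finite "\<lambda>_. N"
    using N by (simp add: product_sigma_finite_def)
  interpret D: product_sigma_finite "\<lambda>_. density N g"
    using N by (simp add: product_sigma_finite_def)
  have g': "(\<lambda>\<omega>. \<Prod>k\<in>K. g (\<omega> k)) \<in> borel_measurable (PiM K (\<lambda>_. N))"
  proof (rule borel_measurable_prod_ennreal)
    fix k assume "k \<in> K"
    then show "(\<lambda>\<omega>. g (\<omega> k)) \<in> borel_measurable (PiM K (\<lambda>_. N))"
      by (intro measurable_compose[OF _ g] measurable_component_singleton)
  qed
  have "density (PiM K (\<lambda>_. N)) (\<lambda>\<omega>. \<Prod>k\<in>K. g (\<omega> k)) = PiM K (\<lambda>_. density N g)"
  proof (rule D.PiM_eqI[OF K])
    show "sets (density (PiM K (\<lambda>_. N)) (\<lambda>\<omega>. \<Prod>k\<in>K. g (\<omega> k))) = sets (PiM K (\<lambda>_. density N g))"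
      by (auto intro!: sets_PiM_cong)
    fix A assume "\<And>i. i \<in> K \<Longrightarrow> A i \<in> sets (density N g)"
    then have A: "A i \<in> sets N" if "i \<in> K" for i using that by simp
    have "emeasure (density (PiM K (\<lambda>_. N)) (\<lambda>\<omega>. \<Prod>k\<in>K. g (\<omega> k))) (Pi\<^sub>E K A)
        = (\<integral>\<^sup>+\<omega>. (\<Prod>k\<in>K. g (\<omega> k)) * indicator (Pi\<^sub>E K A) \<omega> \<partial>PiM K (\<lambda>_. N))"
      using g' A K by (intro emeasure_density sets_PiM_I_finite)
    also have "\<dots> = (\<integral>\<^sup>+\<omega>. (\<Prod>k\<in>K. g (\<omega> k) * indicator (A k) (\<omega> k)) \<partial>PiM K (\<lambda>_. N))"
    proof (rule nn_integral_cong)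
      fix \<omega> assume "\<omega> \<in> space (PiM K (\<lambda>_. N))"
      then have "(indicator (Pi\<^sub>E K A) \<omega> :: ennreal) = (\<Prod>k\<in>K. indicator (A k) (\<omega> k))"
        using K by (auto simp: indicator_def space_PiM PiE_iff prod_zero_iff)
      then show "(\<Prod>k\<in>K. g (\<omega> k)) * indicator (Pi\<^sub>E K A) \<omega> = (\<Prod>k\<in>K. g (\<omega> k) * indicator (A k) (\<omega> k))"
        by (simp add: prod.distrib)
    qed
    also have "\<dots> = (\<Prod>k\<in>K. \<integral>\<^sup>+x. g x * indicator (A k) x \<partial>N)"
      using g A by (intro N.product_nn_integral_prod[OF K]) auto
    also have "\<dots> = (\<Prod>k\<in>K. emeasure (density N g) (A k))"
      using g A by (intro prod.cong refl emeasure_density[symmetric]) auto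
    finally show "emeasure (density (PiM K (\<lambda>_. N)) (\<lambda>\<omega>. \<Prod>k\<in>K. g (\<omega> k))) (Pi\<^sub>E K A)
        = (\<Prod>k\<in>K. emeasure (density N g) (A k))" .
  qed
  then show ?thesis by simp
qed

text \<open>Bounds from below the sum of the two error probabilities of any test. Z is the
  likelihood ratio of the uniform mixture; integrating a pointwise inequality between min(1, Z) and
  (Z - 1)^2 leaves only its variance. In the second moment the cross terms equal exactly 1, since
  the u m have mean 0 and vanishing products; the M diagonal terms, each at most 1 + exp(n \<kappa>)
  with n = \<open>card K\<close>, are divided by M^2.\<close>

lemma mixture_test:
  fixes u :: "nat \<Rightarrow> 'a \<Rightarrow> real" and K :: "nat set" and \<kappa> :: real and M :: nat
  assumes "prob_space N" and K: "finite K" and M: "1 \<le> M"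
    and u: "\<And>m. u m \<in> borel_measurable N" "\<And>m x. \<bar>u m x\<bar> \<le> 1"
    and u0: "\<And>m. m \<in> {1..M} \<Longrightarrow> integral\<^sup>L N (u m) = 0"
    and u2: "\<And>m. m \<in> {1..M} \<Longrightarrow> (\<integral>x. (u m x)\<^sup>2 \<partial>N) \<le> \<kappa>"
    and disj: "\<And>m m' x. m \<noteq> m' \<Longrightarrow> u m x * u m' x = 0"
    and E: "E \<in> sets (PiM K (\<lambda>_. N))"
  shows "3 / 4 - exp (card K * \<kappa>) / M \<le>
    measure (PiM K (\<lambda>_. N)) (space (PiM K (\<lambda>_. N)) - E) +
    (\<Sum>m\<in>{1..M}. measure (PiM K (\<lambda>_. density N (\<lambda>x. ennreal (1 + u m x)))) E) / M"
proof -
  interpret N: prob_space N by fact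
  interpret P: finite_product_prob_space "\<lambda>_. N" K
    by standard (fact K)
  let ?Q = "PiM K (\<lambda>_. N)"
  have Q: "prob_space ?Q" by (rule P.prob_space_axioms)
  define T where "T m \<omega> = (\<Prod>k\<in>K. 1 + u m (\<omega> k))" for m \<omega>
  have u_nonneg: "0 \<le> 1 + u m x" for m x using u(2)[of m x] by linarith
  have bi: "integrable N v" if "v \<in> borel_measurable N" "\<And>x. \<bar>v x\<bar> \<le> B" for v :: "'a \<Rightarrow> real" and B
    using that by (intro N.integrable_const_bound[of _ B]) auto
  have iu: "integrable N (u m)" for m using u by (intro bi[of _ 1])
  have iu2: "integrable N (\<lambda>x. (u m x)\<^sup>2)" for m
    using u by (intro bi[of _ 1]) (auto simp: abs_square_le_1)
  have iuu: "integrable N (\<lambda>x. u m x * u m' x)" for m m'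
    using u by (intro bi[of _ 1]) (auto simp: abs_mult mult_le_one)
  have i1: "integrable N (\<lambda>x. 1 + u m x)" for m using iu by simp
  have i2: "integrable N (\<lambda>x. (1 + u m x) * (1 + u m' x))" for m m'
    using iu[of m] iu[of m'] iuu[of m m'] by (simp add: algebra_simps)
  have iT: "integrable ?Q (T m)" for m
    unfolding T_def using P.product_integrable_prod[OF K, of "\<lambda>_ x. 1 + u m x"] i1 by simp
  have eT: "integral\<^sup>L ?Q (T m) = 1" if "m \<in> {1..M}" for m
    unfolding T_def using P.product_integral_prod[OF K, of "\<lambda>_ x. 1 + u m x"] i1 iu u0[OF that]
    by (simp add: N.prob_space)
  have iTT: "integrable ?Q (\<lambda>\<omega>. T m \<omega> * T m' \<omega>)" for m m'
    unfolding T_def prod.distrib[symmetric]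
    using P.product_integrable_prod[OF K, of "\<lambda>_ x. (1 + u m x) * (1 + u m' x)"] i2 by simp
  have eTT: "(\<integral>\<omega>. T m \<omega> * T m' \<omega> \<partial>?Q) \<le> 1 + (if m = m' then exp (card K * \<kappa>) else 0)"
    if m: "m \<in> {1..M}" "m' \<in> {1..M}" for m m'
  proof -
    have "(\<integral>\<omega>. T m \<omega> * T m' \<omega> \<partial>?Q) = (\<integral>x. (1 + u m x) * (1 + u m' x) \<partial>N) ^ card K"
      unfolding T_def prod.distrib[symmetric]
      using P.product_integral_prod[OF K, of "\<lambda>_ x. (1 + u m x) * (1 + u m' x)"] i2 by simp
    also have "(\<integral>x. (1 + u m x) * (1 + u m' x) \<partial>N) = (\<integral>x. 1 + u m x + u m' x + u m x * u m' x \<partial>N)"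
      by (simp add: algebra_simps)
    also have "\<dots> = 1 + (\<integral>x. u m x * u m' x \<partial>N)"
      using iu iuu u0 m by (simp add: N.prob_space)
    finally have eq: "(\<integral>\<omega>. T m \<omega> * T m' \<omega> \<partial>?Q) = (1 + (\<integral>x. u m x * u m' x \<partial>N)) ^ card K" .
    show ?thesis
    proof (cases "m = m'")
      case True
      have "0 \<le> (\<integral>x. (u m x)\<^sup>2 \<partial>N)" by simp
      then have "(1 + (\<integral>x. (u m x)\<^sup>2 \<partial>N)) ^ card K \<le> exp \<kappa> ^ card K"
        using u2[OF m(1)] exp_ge_add_one_self[of \<kappa>] by (intro power_mono) linarith+
      then show ?thesis
        unfolding eq using True by (simp add: power2_eq_square exp_of_nat_mult)
    next
      case False
      have "(\<integral>x. u m x * u m' x \<partial>N) = 0"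
        by (simp only: disj[OF False] integral_zero)
      then show ?thesis unfolding eq by simp
    qed
  qed
  define Z where "Z \<omega> = (\<Sum>m\<in>{1..M}. T m \<omega>) / M" for \<omega>
  have iZ: "integrable ?Q Z" unfolding Z_def using iT by simp
  have eZ: "integral\<^sup>L ?Q Z = 1" unfolding Z_def using iT eT M by simp
  have Z2: "(Z \<omega>)\<^sup>2 = (\<Sum>m\<in>{1..M}. \<Sum>m'\<in>{1..M}. T m \<omega> * T m' \<omega>) / (real M)\<^sup>2" for \<omega>
    unfolding Z_def by (simp add: power2_eq_square sum_product)
  have iZ2: "integrable ?Q (\<lambda>\<omega>. (Z \<omega>)\<^sup>2)" unfolding Z2 using iTT by simp
  have eZ2: "(\<integral>\<omega>. (Z \<omega>)\<^sup>2 \<partial>?Q) \<le> 1 + exp (card K * \<kappa>) / M"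
  proof -
    have "(\<integral>\<omega>. (Z \<omega>)\<^sup>2 \<partial>?Q) = (\<Sum>m\<in>{1..M}. \<Sum>m'\<in>{1..M}. \<integral>\<omega>. T m \<omega> * T m' \<omega> \<partial>?Q) / (real M)\<^sup>2"
      unfolding Z2 using iTT by simp
    also have "\<dots> \<le> (\<Sum>m\<in>{1..M}. \<Sum>m'\<in>{1..M}. 1 + (if m = m' then exp (card K * \<kappa>) else 0)) / (real M)\<^sup>2"
      by (intro divide_right_mono sum_mono eTT) auto
    also have "(\<Sum>m\<in>{1..M}. \<Sum>m'\<in>{1..M}. 1 + (if m = m' then exp (card K * \<kappa>) else 0))
        = (real M)\<^sup>2 + M * exp (card K * \<kappa>)"
      by (simp add: sum.distrib power2_eq_square algebra_simps)
    also have "\<dots> / (real M)\<^sup>2 = 1 + exp (card K * \<kappa>) / M"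
      using M by (simp add: field_simps power2_eq_square)
    finally show ?thesis .
  qed
  have T_nonneg: "0 \<le> T m \<omega>" for m \<omega> unfolding T_def using u_nonneg by (intro prod_nonneg) auto
  have iET: "integrable ?Q (\<lambda>\<omega>. indicator E \<omega> * T m \<omega>)" for m
    using integrable_mult_indicator[OF E iT[of m]] by simp
  have PE: "measure (PiM K (\<lambda>_. density N (\<lambda>x. ennreal (1 + u m x)))) E = (\<integral>\<omega>. indicator E \<omega> * T m \<omega> \<partial>?Q)"
    if m: "m \<in> {1..M}" for m
  proof -
    have D: "prob_space (density N (\<lambda>x. ennreal (1 + u m x)))"
    proof
      have "(\<integral>\<^sup>+x. ennreal (1 + u m x) \<partial>N) = ennreal (\<integral>x. 1 + u m x \<partial>N)"
        using i1 u_nonneg by (intro nn_integral_eq_integral) auto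
      also have "\<dots> = 1" using iu u0[OF m] by (simp add: N.prob_space)
      finally show "emeasure (density N (\<lambda>x. ennreal (1 + u m x)))
          (space (density N (\<lambda>x. ennreal (1 + u m x)))) = 1"
        using u(1) by (simp add: emeasure_density cong: nn_integral_cong)
    qed
    have "PiM K (\<lambda>_. density N (\<lambda>x. ennreal (1 + u m x))) = density ?Q (\<lambda>\<omega>. \<Prod>k\<in>K. ennreal (1 + u m (\<omega> k)))"
      using D u(1) by (intro PiM_density[OF K])
        (auto intro: prob_space_imp_sigma_finite N.sigma_finite_measure_axioms)
    also have "(\<lambda>\<omega>. \<Prod>k\<in>K. ennreal (1 + u m (\<omega> k))) = (\<lambda>\<omega>. ennreal (T m \<omega>))"
      unfolding T_def using u_nonneg by (auto simp: prod_ennreal)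
    finally have "emeasure (PiM K (\<lambda>_. density N (\<lambda>x. ennreal (1 + u m x)))) E
        = (\<integral>\<^sup>+\<omega>. ennreal (T m \<omega>) * indicator E \<omega> \<partial>?Q)"
      using E iT[of m] by (simp add: emeasure_density)
    also have "\<dots> = (\<integral>\<^sup>+\<omega>. ennreal (indicator E \<omega> * T m \<omega>) \<partial>?Q)"
      by (intro nn_integral_cong) (auto simp: indicator_def)
    also have "\<dots> = ennreal (\<integral>\<omega>. indicator E \<omega> * T m \<omega> \<partial>?Q)"
      using iET T_nonneg by (intro nn_integral_eq_integral) auto
    finally show ?thesis
      using T_nonneg by (simp add: measure_def)
  qed
  have iE: "integrable ?Q (indicator (space ?Q - E) :: _ \<Rightarrow> real)"
    using E by (intro integrable_real_indicator) (auto simp: P.emeasure_eq_measure)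
  have iEZ: "integrable ?Q (\<lambda>\<omega>. indicator E \<omega> * Z \<omega>)"
    using integrable_mult_indicator[OF E iZ] by simp
  have "3 / 4 - exp (card K * \<kappa>) / M \<le> 3 / 4 - ((\<integral>\<omega>. (Z \<omega>)\<^sup>2 \<partial>?Q) - 1)"
    using eZ2 by simp
  also have "\<dots> = (\<integral>\<omega>. 3 / 4 - ((Z \<omega>)\<^sup>2 - 2 * Z \<omega> + 1) \<partial>?Q)"
    using iZ iZ2 eZ by (simp add: prob_space.prob_space[OF Q])
  also have "\<dots> \<le> (\<integral>\<omega>. indicator (space ?Q - E) \<omega> + indicator E \<omega> * Z \<omega> \<partial>?Q)"
  proof (rule integral_mono)
    show "integrable ?Q (\<lambda>\<omega>. 3 / 4 - ((Z \<omega>)\<^sup>2 - 2 * Z \<omega> + 1))"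
      using iZ iZ2 by simp
    show "integrable ?Q (\<lambda>\<omega>. indicator (space ?Q - E) \<omega> + indicator E \<omega> * Z \<omega>)"
      using iE iEZ by simp
    fix \<omega> assume \<omega>: "\<omega> \<in> space ?Q"
    \<comment> \<open>The two squares say that 3/4 - (Z - 1)^2 is at most 1 and at most Z; the
      constant 3/4 is what completes the second square.\<close>
    have "0 \<le> (Z \<omega> - 1)\<^sup>2" "0 \<le> (Z \<omega> - 1 / 2)\<^sup>2" by simp_all
    then have "3 / 4 - ((Z \<omega>)\<^sup>2 - 2 * Z \<omega> + 1) \<le> 1" "3 / 4 - ((Z \<omega>)\<^sup>2 - 2 * Z \<omega> + 1) \<le> Z \<omega>"
      by (auto simp: power2_eq_square algebra_simps)
    then show "3 / 4 - ((Z \<omega>)\<^sup>2 - 2 * Z \<omega> + 1) \<le> indicator (space ?Q - E) \<omega> + indicator E \<omega> * Z \<omega>"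
      using \<omega> by (cases "\<omega> \<in> E") auto
  qed
  also have "\<dots> = measure ?Q (space ?Q - E) + (\<integral>\<omega>. indicator E \<omega> * Z \<omega> \<partial>?Q)"
    using iE iEZ E by simp
  also have "(\<integral>\<omega>. indicator E \<omega> * Z \<omega> \<partial>?Q) = (\<integral>\<omega>. (\<Sum>m\<in>{1..M}. indicator E \<omega> * T m \<omega>) / M \<partial>?Q)"
    by (simp add: Z_def sum_distrib_left)
  also have "\<dots> = (\<Sum>m\<in>{1..M}. \<integral>\<omega>. indicator E \<omega> * T m \<omega> \<partial>?Q) / M"
    unfolding integral_divide_zero by (subst Bochner_Integration.integral_sum[OF iET]) (rule refl)
  also have "\<dots> = (\<Sum>m\<in>{1..M}. measure (PiM K (\<lambda>_. density N (\<lambda>x. ennreal (1 + u m x)))) E) / M"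
    by (simp add: PE)
  finally show ?thesis .
qed

text \<open>The marginal over all coordinates is an integral over the one-point space
  \<open>lebI {}\<close>, hence the density itself, and its L1 norm is 1. Any member of the class
  thus certifies that the L1 constraint is compatible with being a density.\<close>

lemma class_nonempty_imp_L_ge_1:
  assumes "f \<in> nikolskii_densities d p \<beta> L" "i \<in> {1..d}" "p i = 1"
  shows "1 \<le> L i"
proof -
  have d: "{1..d} \<noteq> {}" using assms(2) by auto
  have f: "prob_density d f" "marginal d {1..d} f \<in> nikolskii {1..d} p \<beta> L"
    using assms(1) d unfolding nikolskii_densities_def by auto
  have marg: "marginal d {1..d} f x = f x" if "x \<in> Rspace {1..d}" for x
  proof -
    have "merge {1..d} {} (x, y) = x" for y
      using that by (auto simp: merge_def PiE_def extensional_def fun_eq_iff)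
    then show ?thesis
      by (simp add: marginal_def PiM_empty lebesgue_integral_count_space_finite)
  qed
  have "Lr_norm {1..d} (p i) (partial i 0 (marginal d {1..d} f)) \<le> ennreal (L i)"
    using f(2) assms(2) unfolding nikolskii_def by blast
  moreover have "partial i 0 (marginal d {1..d} f) = marginal d {1..d} f"
    by (simp add: partial_def fun_eq_iff)
  moreover have "(\<integral>\<^sup>+x. ennreal (\<bar>marginal d {1..d} f x\<bar> powr 1) \<partial>lebI {1..d}) = 1"
  proof -
    have "(\<integral>\<^sup>+x. ennreal (\<bar>marginal d {1..d} f x\<bar> powr 1) \<partial>lebI {1..d}) = (\<integral>\<^sup>+x. ennreal (f x) \<partial>lebI {1..d})"
      using f(1) by (intro nn_integral_cong) (simp add: marg space_PiM prob_density_def)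
    then show ?thesis using f(1) by (simp add: prob_density_def)
  qed
  ultimately have "ennpow 1 1 \<le> ennreal (L i)"
    using assms(3) by (simp add: Lr_norm_def)
  then show ?thesis
    using ennpow_ennreal[of 1 1] by simp
qed

section \<open>From testing errors to the minimax risk\<close>

lemma risk_ge:
  assumes q: "1 \<le> q" and \<phi>: "0 < \<phi>" and s: "0 \<le> s"
    and E: "E \<in> sets (sample_law d n f)" "1 / 4 \<le> measure (sample_law d n f) E"
    and far: "\<And>\<omega>. \<omega> \<in> E \<Longrightarrow> \<exists>x\<in>Rspace {1..d}. s \<le> \<bar>fhat \<omega> x - f x\<bar>"
  shows "ennreal (s / \<phi> / 4) \<le> risk d n q \<phi> fhat f"
proof -
  let ?l = "\<lambda>\<omega>. ennpow (ennreal (inverse \<phi>) * sup_norm {1..d} (\<lambda>x. fhat \<omega> x - f x)) q"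
  \<comment> \<open>Markov's inequality in a form that suits the lower integral: only the minorant
    on the left has to be measurable, not the loss.\<close>
  have l: "ennreal ((s / \<phi>) powr q) * indicator E \<omega> \<le> ?l \<omega>" for \<omega>
  proof (cases "\<omega> \<in> E")
    case True
    then obtain x where x: "x \<in> Rspace {1..d}" "s \<le> \<bar>fhat \<omega> x - f x\<bar>" using far by blast
    have "ennreal s \<le> ennreal \<bar>fhat \<omega> x - f x\<bar>" using x(2) by (rule ennreal_leI)
    also have "\<dots> \<le> sup_norm {1..d} (\<lambda>x. fhat \<omega> x - f x)"
      unfolding sup_norm_def using x(1) by (rule SUP_upper)
    finally have "ennreal (inverse \<phi>) * ennreal s \<le> ennreal (inverse \<phi>) * sup_norm {1..d} (\<lambda>x. fhat \<omega> x - f x)"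
      by (intro mult_left_mono) auto
    then have "ennpow (ennreal (inverse \<phi>) * ennreal s) q \<le> ?l \<omega>"
      using q by (intro ennpow_mono) auto
    moreover have "ennreal (inverse \<phi>) * ennreal s = ennreal (s / \<phi>)"
      using \<phi> s by (simp add: divide_inverse mult.commute flip: ennreal_mult)
    ultimately show ?thesis using True \<phi> s by (simp add: ennpow_ennreal)
  qed simp
  have "ennreal (1 / 4) \<le> emeasure (sample_law d n f) E"
  proof (cases "emeasure (sample_law d n f) E = \<top>")
    case False
    then show ?thesis using E(2) by (simp add: emeasure_eq_ennreal_measure ennreal_leI)
  qed simp
  then have "ennreal ((s / \<phi>) powr q) * ennreal (1 / 4) \<le> ennreal ((s / \<phi>) powr q) * emeasure (sample_law d n f) E"
    by (intro mult_left_mono) auto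
  also have "\<dots> = (\<integral>\<^sup>+\<omega>. ennreal ((s / \<phi>) powr q) * indicator E \<omega> \<partial>sample_law d n f)"
    using E(1) by (simp add: nn_integral_cmult_indicator)
  also have "\<dots> \<le> (\<integral>\<^sup>+\<omega>. ?l \<omega> \<partial>sample_law d n f)"
    by (intro nn_integral_mono l)
  finally have "ennpow (ennreal ((s / \<phi>) powr q) * ennreal (1 / 4)) (1 / q) \<le> risk d n q \<phi> fhat f"
    unfolding risk_def using q by (intro ennpow_mono) auto
  moreover have "ennreal ((s / \<phi>) powr q) * ennreal (1 / 4) = ennreal ((s / \<phi>) powr q * (1 / 4))"
    by (rule ennreal_mult[symmetric]) auto
  moreover have "ennpow (ennreal ((s / \<phi>) powr q * (1 / 4))) (1 / q) = ennreal (s / \<phi> * (1 / 4) powr (1 / q))"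
  proof -
    have "((s / \<phi>) powr q * (1 / 4)) powr (1 / q) = s / \<phi> * (1 / 4) powr (1 / q)"
      using q s \<phi> by (subst powr_mult) (auto simp: powr_powr)
    then show ?thesis by (simp only: ennpow_ennreal[OF mult_nonneg_nonneg[OF powr_ge_zero], of "1 / 4"]) 
  qed
  \<comment> \<open>Since q is at least 1, the root of 1/4 is at least 1/4, which gives a bound free
    of q.\<close>
  moreover have "s / \<phi> / 4 \<le> s / \<phi> * (1 / 4) powr (1 / q)"
  proof -
    have "1 / 4 \<le> (1 / 4 :: real) powr (1 / q)"
      using powr_mono'[of "1 / q" 1 "1 / 4 :: real"] q by simp
    then show ?thesis using mult_left_mono[of "1 / 4" "(1 / 4) powr (1 / q)" "s / \<phi>"] s \<phi> by simp
  qed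
  ultimately show ?thesis
    by (metis ennreal_leI order_trans)
qed

text \<open>Any estimator defines a test by closeness to f0 at the points z m. If it is far from f0,
  it errs under f0; if it is close, it is at distance at least s from f m at z m, as f m and f0
  differ there by 2 s. The mixture bound 3/4 - 1/4 = 1/2 forces one of these events, under f0 or
  some f m, to have probability at least 1/4. The u m are the relative perturbations f m / f0 -
  1.\<close>

lemma minimax_risk_ge:
  fixes u :: "nat \<Rightarrow> (nat \<Rightarrow> real) \<Rightarrow> real" and M :: nat
  assumes q: "1 \<le> q" and \<phi>: "0 < \<phi>" and s: "0 \<le> s" and M: "1 \<le> M"
    and fhat: "fhat \<in> estimators d n"
    and f0: "f0 \<in> F" "prob_density d f0" and f: "\<And>m. m \<in> {1..M} \<Longrightarrow> f m \<in> F"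
    and fu: "\<And>m x. m \<in> {1..M} \<Longrightarrow> x \<in> Rspace {1..d} \<Longrightarrow> f m x = f0 x * (1 + u m x)"
    and u: "\<And>m. u m \<in> borel_measurable (lebI {1..d})" "\<And>m x. \<bar>u m x\<bar> \<le> 1"
    and u0: "\<And>m. m \<in> {1..M} \<Longrightarrow> (\<integral>x. f0 x * u m x \<partial>lebI {1..d}) = 0"
    and u2: "\<And>m. m \<in> {1..M} \<Longrightarrow> (\<integral>x. f0 x * (u m x)\<^sup>2 \<partial>lebI {1..d}) \<le> \<kappa>"
    and disj: "\<And>m m' x. m \<noteq> m' \<Longrightarrow> u m x * u m' x = 0"
    and pt: "\<And>m. m \<in> {1..M} \<Longrightarrow> z m \<in> Rspace {1..d}"
      "\<And>m. m \<in> {1..M} \<Longrightarrow> 2 * s \<le> \<bar>f m (z m) - f0 (z m)\<bar>"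
    and small: "exp (n * \<kappa>) / M \<le> 1 / 4"
  shows "ennreal (s / \<phi> / 4) \<le> (SUP f\<in>F. risk d n q \<phi> fhat f)"
proof -
  let ?leb = "lebI {1..d}"
  define N where "N = density ?leb (\<lambda>x. ennreal (f0 x))"
  have f0_meas [measurable]: "f0 \<in> borel_measurable ?leb"
    and f0_nonneg: "\<And>x. x \<in> space ?leb \<Longrightarrow> 0 \<le> f0 x"
    and f0_int: "(\<integral>\<^sup>+x. ennreal (f0 x) \<partial>?leb) = 1"
    using f0(2) by (auto simp: prob_density_def space_PiM)
  have N: "prob_space N"
  proof
    show "emeasure N (space N) = 1"
      using f0_int by (simp add: N_def emeasure_density cong: nn_integral_cong)
  qed
  have sets_N: "sets N = sets ?leb" "space N = space ?leb" by (auto simp: N_def)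
  have uN: "u m \<in> borel_measurable N" for m
    using u(1) by (simp add: N_def)
  have intN: "(\<integral>x. v x \<partial>N) = (\<integral>x. f0 x * v x \<partial>?leb)" if "v \<in> borel_measurable ?leb" for v
    unfolding N_def using that f0_nonneg
    by (subst integral_density) auto
  have law0: "sample_law d n f0 = PiM {1..n} (\<lambda>_. N)"
    by (simp add: sample_law_def N_def)
  have law: "sample_law d n (f m) = PiM {1..n} (\<lambda>_. density N (\<lambda>x. ennreal (1 + u m x)))"
    if m: "m \<in> {1..M}" for m
  proof -
    have "density N (\<lambda>x. ennreal (1 + u m x)) = density ?leb (\<lambda>x. ennreal (f0 x) * ennreal (1 + u m x))"
      unfolding N_def using u(1) by (intro density_density_eq) auto
    also have "\<dots> = density ?leb (\<lambda>x. ennreal (f m x))"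
    proof (rule density_cong)
      show "(\<lambda>x. ennreal (f0 x) * ennreal (1 + u m x)) \<in> borel_measurable ?leb"
        using u(1) by simp
      have eq: "ennreal (f0 x) * ennreal (1 + u m x) = ennreal (f m x)" if "x \<in> space ?leb" for x
      proof -
        have "0 \<le> 1 + u m x" using u(2)[of m x] by linarith
        then show ?thesis
          using fu[OF m, of x] f0_nonneg[OF that] that by (simp add: ennreal_mult space_PiM)
      qed
      then show "AE x in ?leb. ennreal (f0 x) * ennreal (1 + u m x) = ennreal (f m x)" by simp
      show "(\<lambda>x. ennreal (f m x)) \<in> borel_measurable ?leb"
        using u(1) by (subst measurable_cong[OF eq[symmetric]]) auto
    qed
    finally show ?thesis by (simp add: sample_law_def)
  qed
  have sets_law: "sets (sample_law d n h) = sets (PiM {1..n} (\<lambda>_. ?leb))" for h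
    unfolding sample_law_def by (intro sets_PiM_cong) auto
  have space_law: "space (sample_law d n h) = space (PiM {1..n} (\<lambda>_. ?leb))" for h
    using sets_eq_imp_space_eq[OF sets_law] .
  \<comment> \<open>Finitely many evaluation points keep E measurable; an event defined through the
    sup norm need not be.\<close>
  define E where "E = {\<omega> \<in> space (PiM {1..n} (\<lambda>_. ?leb)). \<forall>m\<in>{1..M}. \<bar>fhat \<omega> (z m) - f0 (z m)\<bar> < s}"
  have E: "E \<in> sets (PiM {1..n} (\<lambda>_. ?leb))"
    unfolding E_def
  proof (rule sets.sets_Collect_finite_All)
    fix m assume "m \<in> {1..M}"
    then have [measurable]: "(\<lambda>\<omega>. fhat \<omega> (z m)) \<in> borel_measurable (PiM {1..n} (\<lambda>_. ?leb))"
      using fhat pt(1) by (auto simp: estimators_def)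
    show "{\<omega> \<in> space (PiM {1..n} (\<lambda>_. ?leb)). \<bar>fhat \<omega> (z m) - f0 (z m)\<bar> < s} \<in> sets (PiM {1..n} (\<lambda>_. ?leb))"
      by measurable
  qed simp
  have "3 / 4 - exp (card {1..n} * \<kappa>) / M \<le>
      measure (PiM {1..n} (\<lambda>_. N)) (space (PiM {1..n} (\<lambda>_. N)) - E) +
      (\<Sum>m\<in>{1..M}. measure (PiM {1..n} (\<lambda>_. density N (\<lambda>x. ennreal (1 + u m x)))) E) / M"
  proof (rule mixture_test[OF N _ M])
    show "integral\<^sup>L N (u m) = 0" if "m \<in> {1..M}" for m
      using intN[OF u(1)] u0[OF that] by simp
    show "(\<integral>x. (u m x)\<^sup>2 \<partial>N) \<le> \<kappa>" if "m \<in> {1..M}" for m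
      using intN[of "\<lambda>x. (u m x)\<^sup>2"] u(1) u2[OF that] by simp
    show "E \<in> sets (PiM {1..n} (\<lambda>_. N))"
      using E sets_law[of f0] law0 by simp
  qed (use uN u(2) disj in auto)
  then have half: "1 / 2 \<le> measure (sample_law d n f0) (space (PiM {1..n} (\<lambda>_. ?leb)) - E) +
      (\<Sum>m\<in>{1..M}. measure (sample_law d n (f m)) E) / M"
    using small by (simp add: law law0[symmetric] space_law)
  show ?thesis
  proof (cases "1 / 4 \<le> measure (sample_law d n f0) (space (PiM {1..n} (\<lambda>_. ?leb)) - E)")
    case True
    have "ennreal (s / \<phi> / 4) \<le> risk d n q \<phi> fhat f0"
    proof (rule risk_ge[OF q \<phi> s _ True])
      show "space (PiM {1..n} (\<lambda>_. ?leb)) - E \<in> sets (sample_law d n f0)"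
        using E by (simp add: sets_law sets.compl_sets)
      fix \<omega> assume "\<omega> \<in> space (PiM {1..n} (\<lambda>_. ?leb)) - E"
      then show "\<exists>x\<in>Rspace {1..d}. s \<le> \<bar>fhat \<omega> x - f0 x\<bar>"
        using pt(1) unfolding E_def by force
    qed
    also have "\<dots> \<le> (SUP f\<in>F. risk d n q \<phi> fhat f)" using f0(1) by (rule SUP_upper)
    finally show ?thesis .
  next
    case False
    have "\<exists>m\<in>{1..M}. 1 / 4 \<le> measure (sample_law d n (f m)) E"
    proof (rule ccontr)
      assume "\<not> ?thesis"
      then have "(\<Sum>m\<in>{1..M}. measure (sample_law d n (f m)) E) \<le> (\<Sum>m\<in>{1..M}. 1 / 4)"
        by (intro sum_mono) (auto simp: not_le less_imp_le)
      then have "(\<Sum>m\<in>{1..M}. measure (sample_law d n (f m)) E) / M \<le> 1 / 4"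
        using M by (simp add: field_simps)
      then show False using half False by linarith
    qed
    then obtain m where m: "m \<in> {1..M}" "1 / 4 \<le> measure (sample_law d n (f m)) E" by blast
    have "ennreal (s / \<phi> / 4) \<le> risk d n q \<phi> fhat (f m)"
    proof (rule risk_ge[OF q \<phi> s _ m(2)])
      show "E \<in> sets (sample_law d n (f m))" using E by (simp add: sets_law)
      fix \<omega> assume "\<omega> \<in> E"
      then have "\<bar>fhat \<omega> (z m) - f0 (z m)\<bar> < s" using m(1) by (simp add: E_def)
      then have "s \<le> \<bar>fhat \<omega> (z m) - f m (z m)\<bar>" using pt(2)[OF m(1)] by linarith
      then show "\<exists>x\<in>Rspace {1..d}. s \<le> \<bar>fhat \<omega> x - f m x\<bar>" using pt(1)[OF m(1)] by blast
    qed
    also have "\<dots> \<le> (SUP f\<in>F. risk d n q \<phi> fhat f)" using f[OF m(1)] by (rule SUP_upper)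
    finally show ?thesis .
  qed
qed

section \<open>The perturbed densities\<close>

text \<open>The contribution of one coordinate to the chi-square distance. The base is bounded below
  only near the bump, which suffices because the numerator vanishes elsewhere.\<close>

lemma chi_square_factor:
  assumes \<psi>: "bump_class N C c h \<psi>" and \<phi>: "\<phi> \<in> borel_measurable borel"
    and b: "0 < b" "\<And>t. \<bar>t - c\<bar> < h \<Longrightarrow> b \<le> \<phi> t"
  shows "integrable lborel (\<lambda>t. (\<psi> t)\<^sup>2 / \<phi> t)"
    and "(\<integral>t. (\<psi> t)\<^sup>2 / \<phi> t \<partial>lborel) \<le> C\<^sup>2 / b * (2 * h)"
proof -
  note [measurable] = bump_class_measurable[OF \<psi>] \<phi>
  have h: "0 < h" by (rule bump_classD(2)[OF \<psi>])
  have bound: "0 \<le> (\<psi> t)\<^sup>2 / \<phi> t \<and> (\<psi> t)\<^sup>2 / \<phi> t \<le> C\<^sup>2 / b * indicator {c - h..c + h} t" for t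
  proof (cases "\<bar>t - c\<bar> < h")
    case True
    have "(\<psi> t)\<^sup>2 \<le> C\<^sup>2" using bump_class_bound[OF \<psi>, of t] by (simp add: abs_le_square_iff[symmetric])
    then have "(\<psi> t)\<^sup>2 / \<phi> t \<le> C\<^sup>2 / b" using b True by (intro frac_le) auto
    moreover have "t \<in> {c - h..c + h}" "0 < \<phi> t" using True b(1) b(2)[OF True] by (auto simp: abs_if split: if_splits)
    ultimately show ?thesis by simp
  next
    case False
    then show ?thesis using bump_class_eq_0[OF \<psi>, of t] b by simp
  qed
  have int: "integrable lborel (\<lambda>t. C\<^sup>2 / b * indicator {c - h..c + h} t)"
    by (intro integrable_mult_right integrable_real_indicator) (auto simp: h less_imp_le)
  show i: "integrable lborel (\<lambda>t. (\<psi> t)\<^sup>2 / \<phi> t)"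
  proof (rule Bochner_Integration.integrable_bound[OF int])
    show "AE t in lborel. norm ((\<psi> t)\<^sup>2 / \<phi> t) \<le> norm (C\<^sup>2 / b * indicator {c - h..c + h} t)"
      using bound by (intro AE_I2) (smt (verit) real_norm_def)
  qed measurable
  have "(\<integral>t. (\<psi> t)\<^sup>2 / \<phi> t \<partial>lborel) \<le> (\<integral>t. C\<^sup>2 / b * indicator {c - h..c + h} t \<partial>lborel)"
    using bound by (intro integral_mono[OF i int]) auto
  also have "\<dots> = C\<^sup>2 / b * (2 * h)"
    using h by simp
  finally show "(\<integral>t. (\<psi> t)\<^sup>2 / \<phi> t \<partial>lborel) \<le> C\<^sup>2 / b * (2 * h)" .
qed

text \<open>The chi-square distance factorises over coordinates: those in J contribute at most
  \<open>C\<^sup>2 / b * (2 * h j)\<close>, all others 1. Disjointness in the single coordinate j0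
  already makes the products of different perturbations vanish.\<close>

lemma tensor_minimax_risk_ge:
  fixes \<psi> :: "nat \<Rightarrow> nat \<Rightarrow> real \<Rightarrow> real" and M :: nat
  assumes q: "1 \<le> q" and y: "0 < y" and s: "0 \<le> s" and M: "1 \<le> M"
    and fhat: "fhat \<in> estimators d n"
    and J: "J \<subseteq> {1..d}" "j0 \<in> J"
    and \<phi>: "\<And>j. j \<in> {1..d} \<Longrightarrow> \<phi> j \<in> borel_measurable borel" "\<And>j t. j \<in> {1..d} \<Longrightarrow> 0 \<le> \<phi> j t"
      "\<And>j. j \<in> {1..d} \<Longrightarrow> integrable lborel (\<phi> j)" "\<And>j. j \<in> {1..d} \<Longrightarrow> integral\<^sup>L lborel (\<phi> j) = 1"
    and \<psi>: "\<And>m j. m \<in> {1..M} \<Longrightarrow> j \<in> J \<Longrightarrow> bump_class N C (c m j) (h j) (\<psi> m j)"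
      "\<And>m j. m \<in> {1..M} \<Longrightarrow> j \<in> J \<Longrightarrow> integral\<^sup>L lborel (\<psi> m j) = 0"
      "\<And>m j. m \<in> {1..M} \<Longrightarrow> j \<in> {1..d} - J \<Longrightarrow> \<psi> m j = \<phi> j"
    and b: "0 < b" "\<And>m j t. m \<in> {1..M} \<Longrightarrow> j \<in> J \<Longrightarrow> \<bar>t - c m j\<bar> < h j \<Longrightarrow> b \<le> \<phi> j t"
    and disj: "\<And>m m' t. m \<in> {1..M} \<Longrightarrow> m' \<in> {1..M} \<Longrightarrow> m \<noteq> m' \<Longrightarrow> \<psi> m j0 t * \<psi> m' j0 t = 0"
    and dom: "\<And>m x. m \<in> {1..M} \<Longrightarrow> \<bar>A * (\<Prod>j\<in>J. \<psi> m j (x j))\<bar> \<le> (\<Prod>j\<in>J. \<phi> j (x j))"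
    and F: "tensor_sum {1..d} \<phi> 0 \<phi> \<in> F" "prob_density d (tensor_sum {1..d} \<phi> 0 \<phi>)"
      "\<And>m. m \<in> {1..M} \<Longrightarrow> tensor_sum {1..d} \<phi> A (\<psi> m) \<in> F"
    and z: "\<And>m. m \<in> {1..M} \<Longrightarrow> z m \<in> Rspace {1..d}"
      "\<And>m. m \<in> {1..M} \<Longrightarrow> 2 * s \<le> \<bar>A * (\<Prod>j\<in>{1..d}. \<psi> m j (z m j))\<bar>"
    and small: "exp (n * (A\<^sup>2 * (\<Prod>j\<in>J. C\<^sup>2 / b * (2 * h j)))) / M \<le> 1 / 4"
  shows "ennreal (s / y / 4) \<le> (SUP f\<in>F. risk d n q y fhat f)"
proof -
  let ?D = "{1..d}"
  let ?\<phi> = "\<lambda>x. \<Prod>j\<in>?D. \<phi> j (x j)"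
  let ?\<psi> = "\<lambda>m x. \<Prod>j\<in>?D. \<psi> m j (x j)"
  \<comment> \<open>Where the base vanishes the quotient is 0 by convention, and by domination its
    numerator is 0 as well, so f m = f0 (1 + u m) holds everywhere. Indices outside
    \<open>{1..M}\<close> get 0 so that the bounds hold for all m.\<close>
  define u where "u m x = (if m \<in> {1..M} then A * ?\<psi> m x / ?\<phi> x else 0)" for m x
  have f0: "tensor_sum ?D \<phi> 0 \<phi> = ?\<phi>" by (simp add: tensor_sum_def fun_eq_iff)
  have \<phi>_nonneg: "0 \<le> ?\<phi> x" for x using \<phi>(2) by (intro prod_nonneg) auto
  have domD: "\<bar>A * ?\<psi> m x\<bar> \<le> ?\<phi> x" if "m \<in> {1..M}" for m x
    using tensor_sum_nonneg(1)[OF _ J(1), of \<phi> "\<psi> m" A x] \<phi>(2) \<psi>(3)[OF that] dom[OF that] by simp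
  have jD: "j \<in> J \<Longrightarrow> j \<in> ?D" for j using J by auto
  have \<psi>_meas: "\<psi> m j \<in> borel_measurable borel" "integrable lborel (\<psi> m j)"
    if "m \<in> {1..M}" "j \<in> ?D" for m j
    using \<psi>(1)[OF that(1), of j] \<psi>(3)[OF that(1), of j] \<phi>(1,3)[OF that(2)] that(2)
      bump_class_measurable bump_class_integrable by (cases "j \<in> J"; force)+
  have prod_meas: "(\<lambda>x. \<Prod>j\<in>?D. \<theta> j (x j)) \<in> borel_measurable (lebI ?D)"
    if "\<And>j. j \<in> ?D \<Longrightarrow> \<theta> j \<in> borel_measurable borel" for \<theta> :: "nat \<Rightarrow> real \<Rightarrow> real"
    using tensor_sum_measurable[of ?D \<theta> \<theta> 0] that by (simp add: tensor_sum_def[abs_def])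
  have fu0: "?\<phi> x * u m x = A * ?\<psi> m x" if "m \<in> {1..M}" for m x
    using domD[OF that, of x] that by (cases "?\<phi> x = 0") (auto simp: u_def)
  show ?thesis
  proof (rule minimax_risk_ge[OF q y s M fhat F(1,2), where u = u and f = "\<lambda>m. tensor_sum ?D \<phi> A (\<psi> m)" and z = z])
    show "tensor_sum ?D \<phi> A (\<psi> m) \<in> F" if "m \<in> {1..M}" for m by (rule F(3)[OF that])
    show "tensor_sum ?D \<phi> A (\<psi> m) x = tensor_sum ?D \<phi> 0 \<phi> x * (1 + u m x)" if "m \<in> {1..M}" for m x
      unfolding f0 using fu0[OF that, of x] by (simp add: tensor_sum_def algebra_simps)
    show "u m \<in> borel_measurable (lebI ?D)" for m
    proof (cases "m \<in> {1..M}")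
      case True
      then have "u m = (\<lambda>x. A * ?\<psi> m x / ?\<phi> x)" by (simp add: u_def fun_eq_iff)
      moreover have "?\<psi> m \<in> borel_measurable (lebI ?D)" "?\<phi> \<in> borel_measurable (lebI ?D)"
        using prod_meas[OF \<psi>_meas(1)[OF True]] prod_meas[OF \<phi>(1)] by simp_all
      ultimately show ?thesis by simp
    next
      case False
      then have "u m = (\<lambda>x. 0)" by (auto simp: u_def fun_eq_iff)
      then show ?thesis by simp
    qed
    show "\<bar>u m x\<bar> \<le> 1" for m x
    proof (cases "m \<in> {1..M} \<and> 0 < ?\<phi> x")
      case True
      then show ?thesis using domD[of m x] by (simp add: u_def)
    next
      case False
      then have "m \<notin> {1..M} \<or> ?\<phi> x = 0" using \<phi>_nonneg[of x] by argo
      then have "u m x = 0" unfolding u_def by (metis div_by_0)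
      then show ?thesis by simp
    qed
    show "(\<integral>x. tensor_sum ?D \<phi> 0 \<phi> x * u m x \<partial>lebI ?D) = 0" if m: "m \<in> {1..M}" for m
    proof -
      have "(\<integral>x. tensor_sum ?D \<phi> 0 \<phi> x * u m x \<partial>lebI ?D) = A * (\<integral>x. ?\<psi> m x \<partial>lebI ?D)"
        unfolding f0 fu0[OF m] by simp
      also have "(\<integral>x. ?\<psi> m x \<partial>lebI ?D) = (\<Prod>j\<in>?D. integral\<^sup>L lborel (\<psi> m j))"
        using \<psi>_meas(2)[OF m] by (intro lborel_product.product_integral_prod) auto
      also have "\<dots> = 0"
        using \<psi>(2)[OF m J(2)] jD[OF J(2)] by (intro prod_zero) auto
      finally show ?thesis by simp
    qed
    show "(\<integral>x. tensor_sum ?D \<phi> 0 \<phi> x * (u m x)\<^sup>2 \<partial>lebI ?D) \<le> A\<^sup>2 * (\<Prod>j\<in>J. C\<^sup>2 / b * (2 * h j))"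
      if m: "m \<in> {1..M}" for m
    proof -
      let ?r = "\<lambda>j t. (\<psi> m j t)\<^sup>2 / \<phi> j t"
      \<comment> \<open>As \<psi> = \<phi> here, the quotient \<phi>^2 / \<phi> equals \<phi> even
        at zeros of \<phi>.\<close>
      have r_rest: "?r j = \<phi> j" if "j \<in> ?D - J" for j
        using \<psi>(3)[OF m that] by (auto simp: power2_eq_square fun_eq_iff)
      have r_J: "integrable lborel (?r j)" "integral\<^sup>L lborel (?r j) \<le> C\<^sup>2 / b * (2 * h j)" if "j \<in> J" for j
        using chi_square_factor[OF \<psi>(1)[OF m that] \<phi>(1)[OF jD[OF that]] b(1)] b(2)[OF m that] by auto
      have r_int: "integrable lborel (?r j)" if "j \<in> ?D" for j
        using r_J(1)[of j] r_rest[of j] \<phi>(3)[OF that] that by (cases "j \<in> J") auto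
      have "?\<phi> x * (u m x)\<^sup>2 = A\<^sup>2 * (\<Prod>j\<in>?D. ?r j (x j))" for x
        using m by (simp add: u_def prod_dividef prod.distrib power_divide power_mult_distrib power2_eq_square)
      then have "(\<integral>x. tensor_sum ?D \<phi> 0 \<phi> x * (u m x)\<^sup>2 \<partial>lebI ?D) = A\<^sup>2 * (\<integral>x. (\<Prod>j\<in>?D. ?r j (x j)) \<partial>lebI ?D)"
        unfolding f0 by simp
      also have "(\<integral>x. (\<Prod>j\<in>?D. ?r j (x j)) \<partial>lebI ?D) = (\<Prod>j\<in>?D. integral\<^sup>L lborel (?r j))"
        using r_int by (intro lborel_product.product_integral_prod) auto
      also have "\<dots> = (\<Prod>j\<in>?D - J. integral\<^sup>L lborel (?r j)) * (\<Prod>j\<in>J. integral\<^sup>L lborel (?r j))"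
        using J by (intro prod.subset_diff) auto
      also have "(\<Prod>j\<in>?D - J. integral\<^sup>L lborel (?r j)) = 1"
        using r_rest \<phi>(4) by (intro prod.neutral) auto
      also have "1 * (\<Prod>j\<in>J. integral\<^sup>L lborel (?r j)) \<le> (\<Prod>j\<in>J. C\<^sup>2 / b * (2 * h j))"
        unfolding mult_1
      proof (rule prod_mono)
        fix j assume j: "j \<in> J"
        have "0 \<le> integral\<^sup>L lborel (?r j)" using \<phi>(2)[OF jD[OF j]] by (intro Bochner_Integration.integral_nonneg) auto
        then show "0 \<le> integral\<^sup>L lborel (?r j) \<and> integral\<^sup>L lborel (?r j) \<le> C\<^sup>2 / b * (2 * h j)"
          using r_J(2)[OF j] by simp
      qed
      finally show ?thesis by (simp add: mult_left_mono)
    qed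
    show "u m x * u m' x = 0" if "m \<noteq> m'" for m m' x
    proof (cases "m \<in> {1..M} \<and> m' \<in> {1..M}")
      case True
      have "?\<psi> m x * ?\<psi> m' x = (\<Prod>j\<in>?D. \<psi> m j (x j) * \<psi> m' j (x j))" by (simp add: prod.distrib)
      also have "\<dots> = 0"
        using disj[of m m' "x j0"] True that jD[OF J(2)] by (intro prod_zero) auto
      finally show ?thesis by (auto simp: u_def)
    qed (auto simp: u_def)
    show "2 * s \<le> \<bar>tensor_sum ?D \<phi> A (\<psi> m) (z m) - tensor_sum ?D \<phi> 0 \<phi> (z m)\<bar>" if "m \<in> {1..M}" for m
      using z(2)[OF that] by (simp add: tensor_sum_def)
    show "exp (n * (A\<^sup>2 * (\<Prod>j\<in>J. C\<^sup>2 / b * (2 * h j)))) / M \<le> 1 / 4" by (rule small)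
  qed (use z in auto)
qed

section \<open>Profiles, dilation and scaling of the perturbation\<close>

lemma bump_profiles:
  obtains C b W g where "1 \<le> C" "bump_class N C 0 1 W" "bump_class N C 0 1 g"
    "\<And>t. 0 \<le> W t" "integral\<^sup>L lborel W = 1" "integral\<^sup>L lborel g = 0" "0 < g (1 / 2)"
    "0 < b" "\<And>t. \<bar>t\<bar> \<le> 1 / 2 \<Longrightarrow> b \<le> W t"
proof -
  let ?w = "poly_bump [:1:] (N + 2)"
  let ?g = "poly_bump [:0, 1:] (N + 2)"
  obtain C1 where C1: "bump_class N C1 0 1 ?w" using bump_class_poly_bump by blast
  obtain C2 where C2: "bump_class N C2 0 1 ?g" using bump_class_poly_bump by blast
  define Z where "Z = integral\<^sup>L lborel ?w"
  have w_nonneg: "0 \<le> ?w t" for t by (simp add: poly_bump_def)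
  \<comment> \<open>Half of the support is where the base stays bounded below, with 3/4 = 1 -
    (1/2)^2; the perturbations will be placed in the dilate of this interval.\<close>
  have w_ge: "(3 / 4) ^ (N + 2) \<le> ?w t" if "\<bar>t\<bar> \<le> 1 / 2" for t
  proof -
    have "t\<^sup>2 \<le> (1 / 2)\<^sup>2" using that by (intro power2_le_iff_abs_le[THEN iffD2]) auto
    then have "3 / 4 \<le> max 0 (1 - t\<^sup>2)" by (simp add: power2_eq_square)
    then have "(3 / 4) ^ (N + 2) \<le> max 0 (1 - t\<^sup>2) ^ (N + 2)" by (rule power_mono) simp
    moreover have "?w t = max 0 (1 - t\<^sup>2) ^ (N + 2)" by (simp add: poly_bump_def)
    ultimately show ?thesis by (simp only:)
  qed
  have Z: "0 < Z"
  proof -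
    have "0 < (3 / 4 :: real) ^ (N + 2)" by simp
    also have "\<dots> = (\<integral>t. (3 / 4) ^ (N + 2) * indicator {-1/2..1/2::real} t \<partial>lborel)" by simp
    also have "\<dots> \<le> Z" unfolding Z_def
    proof (rule integral_mono[OF _ bump_class_integrable[OF C1]])
      show "integrable lborel (\<lambda>t. (3 / 4) ^ (N + 2) * indicator {-1/2..1/2::real} t :: real)"
        by (intro integrable_mult_right integrable_real_indicator) auto
      fix t :: real
      show "(3 / 4) ^ (N + 2) * indicator {-1/2..1/2::real} t \<le> ?w t"
      proof (cases "\<bar>t\<bar> \<le> 1 / 2")
        case True
        then have "t \<in> {-1/2..1/2}" by auto
        then show ?thesis using w_ge[OF True] by simp
      next
        case False
        then have "t \<notin> {-1/2..1/2}" by auto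
        then show ?thesis using w_nonneg[of t] by simp
      qed
    qed
    finally show ?thesis .
  qed
  \<comment> \<open>Normalised to mass 1; the trivial shift and scale match the form of
    \<open>bump_class_affine\<close>.\<close>
  define W where "W t = 1 / Z * ?w ((t - 0) / 1)" for t
  have W: "bump_class N (\<bar>1 / Z\<bar> * C1) 0 1 W"
    unfolding W_def by (rule bump_class_affine[OF C1]) simp
  define C where "C = max 1 (max (\<bar>1 / Z\<bar> * C1) C2)"
  show ?thesis
  proof (rule that[of C W ?g "1 / Z * (3 / 4) ^ (N + 2)"])
    show "1 \<le> C" by (simp add: C_def)
    show "bump_class N C 0 1 W" by (rule bump_class_mono[OF W]) (simp add: C_def)
    show "bump_class N C 0 1 ?g" by (rule bump_class_mono[OF C2]) (simp add: C_def)
    show "0 \<le> W t" for t using Z w_nonneg[of t] by (simp add: W_def)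
    show "integral\<^sup>L lborel W = 1" using Z by (simp add: W_def[abs_def] Z_def)
    have "integral\<^sup>L lborel ?g = (\<integral>t. ?g (0 + (-1) * t) \<partial>lborel)"
      by (subst lborel_integral_real_affine[of "-1" ?g 0]) auto
    also have "(\<lambda>t. ?g (0 + (-1) * t)) = (\<lambda>t. - ?g t)"
      by (simp add: poly_bump_def fun_eq_iff)
    also have "(\<integral>t. - ?g t \<partial>lborel) = - integral\<^sup>L lborel ?g"
      by simp
    finally show "integral\<^sup>L lborel ?g = 0" by simp
    show "0 < ?g (1 / 2)" by (simp add: poly_bump_def power2_eq_square)
    show "0 < 1 / Z * (3 / 4) ^ (N + 2)" using Z by simp
    show "1 / Z * (3 / 4) ^ (N + 2) \<le> W t" if "\<bar>t\<bar> \<le> 1 / 2" for t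
      unfolding W_def diff_0_right div_by_1
      by (rule mult_left_mono[OF w_ge[OF that]]) (use Z in simp)
  qed
qed

lemma enn2real_inverse_bounds:
  assumes "1 \<le> r"
  shows "0 \<le> enn2real (inverse r)" "enn2real (inverse r) \<le> 1" "r \<noteq> 1 \<Longrightarrow> enn2real (inverse r) < 1"
proof -
  show "0 \<le> enn2real (inverse r)" by simp
  have *: "enn2real (inverse r) \<le> 1 \<and> (r \<noteq> 1 \<longrightarrow> enn2real (inverse r) < 1)"
  proof (cases r)
    case (real s)
    then have "1 \<le> s" using assms by (simp flip: ennreal_1)
    moreover have "enn2real (inverse r) = inverse s"
      using real \<open>1 \<le> s\<close> by (simp add: inverse_ennreal)
    moreover have "s \<noteq> 1" if "r \<noteq> 1" using that real by auto
    ultimately show ?thesis by (auto simp: inverse_le_1_iff inverse_less_1_iff)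
  qed simp
  then show "enn2real (inverse r) \<le> 1" "r \<noteq> 1 \<Longrightarrow> enn2real (inverse r) < 1" by auto
qed

text \<open>With N = card I, a bump of height (C/R)^N on a box of volume (2R)^N has norm of order R
  to the power \<rho> N - N - e, where e is the order of smoothness. This exponent is negative
  unless \<rho> = 1 and e = 0, precisely the excluded case, so large R meets the finitely many
  conditions at once. R at least 2 will keep [-1, 1] inside the dilated interval on which the base
  is bounded below.\<close>

lemma dilation_exists:
  fixes C :: real and d :: nat and L \<beta> :: "nat \<Rightarrow> real"
  assumes C: "1 \<le> C" and p: "\<And>j. j \<in> {1..d} \<Longrightarrow> 1 \<le> p j"
    and \<beta>: "\<And>j. j \<in> {1..d} \<Longrightarrow> 0 < \<beta> j" and L: "\<And>j. j \<in> {1..d} \<Longrightarrow> 0 < L j"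
  obtains R where "2 \<le> R"
    "\<And>I i k. I \<subseteq> {1..d} \<Longrightarrow> i \<in> I \<Longrightarrow> k \<le> sfloor (\<beta> i) \<Longrightarrow> p i \<noteq> 1 \<or> 0 < k \<Longrightarrow>
      4 * ((\<Prod>j\<in>I. C / R) / R ^ k * (\<Prod>j\<in>I. 2 * R) powr enn2real (inverse (p i))) \<le> L i"
    "\<And>I i. I \<subseteq> {1..d} \<Longrightarrow> i \<in> I \<Longrightarrow> 8 * ((\<Prod>j\<in>I. C / R) / R powr \<beta> i *
        (2 * (\<Prod>j\<in>I. 2 * R)) powr enn2real (inverse (p i))) \<le> L i"
proof -
  have ev: "\<forall>\<^sub>F R in at_top. B * ((C / R) ^ N / R powr e * (v * (2 * R) ^ N) powr \<rho>) \<le> l"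
    if "0 < l" "0 \<le> v" "\<rho> * N < N + e" for B e v \<rho> l :: real and N :: nat
  proof -
    let ?c = "B * (C ^ N * (v * 2 ^ N) powr \<rho>)"
    have "((\<lambda>R. ?c * R powr (\<rho> * N - N - e)) \<longlongrightarrow> ?c * 0) at_top"
      using that by (intro tendsto_mult tendsto_const tendsto_neg_powr filterlim_ident) auto
    then have "\<forall>\<^sub>F R in at_top. ?c * R powr (\<rho> * N - N - e) < l"
      using that(1) by (intro order_tendstoD(2)) auto
    moreover have "\<forall>\<^sub>F R :: real in at_top. 0 < R" by (rule eventually_gt_at_top)
    ultimately show ?thesis
    proof eventually_elim
      case (elim R)
      have "(C / R) ^ N / R powr e * (v * (2 * R) ^ N) powr \<rho> =
          C ^ N * (v * 2 ^ N) powr \<rho> * (R powr (\<rho> * N) / (R powr N * R powr e))"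
        using elim that by (simp add: power_divide power_mult_distrib powr_mult powr_powr powr_realpow[symmetric] mult.commute)
      also have "R powr (\<rho> * N) / (R powr N * R powr e) = R powr (\<rho> * N - N - e)"
        using elim by (simp add: powr_diff)
      finally show ?case using elim by simp
    qed
  qed
  let ?S = "Sigma (Pow {1..d}) (\<lambda>I. I)"
  have fin: "finite ?S" by (intro finite_SigmaI) (auto intro: finite_subset)
  have S: "fst z \<subseteq> {1..d}" "snd z \<in> fst z" "snd z \<in> {1..d}" "1 \<le> card (fst z)" if "z \<in> ?S" for z
    using that finite_subset[of "fst z" "{1..d}"] card_gt_0_iff[of "fst z"] by (force simp: Suc_le_eq)+
  have "\<forall>\<^sub>F R in at_top. \<forall>z\<in>?S. \<forall>k\<in>{k. k \<le> sfloor (\<beta> (snd z)) \<and> (p (snd z) \<noteq> 1 \<or> 0 < k)}.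
      4 * ((C / R) ^ card (fst z) / R powr real k * (1 * (2 * R) ^ card (fst z)) powr enn2real (inverse (p (snd z)))) \<le> L (snd z)"
  proof (intro eventually_ball_finite[OF fin] ballI eventually_ball_finite)
    fix z assume z: "z \<in> ?S"
    show "finite {k. k \<le> sfloor (\<beta> (snd z)) \<and> (p (snd z) \<noteq> 1 \<or> 0 < k)}" by simp
    fix k assume k: "k \<in> {k. k \<le> sfloor (\<beta> (snd z)) \<and> (p (snd z) \<noteq> 1 \<or> 0 < k)}"
    note \<rho> = enn2real_inverse_bounds[OF p[OF S(3)[OF z]]]
    have c: "1 \<le> real (card (fst z))" using S(4)[OF z] by simp
    have "enn2real (inverse (p (snd z))) * card (fst z) < card (fst z) + real k"
    proof (cases "p (snd z) = 1")
      case True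
      then show ?thesis using k mult_right_mono[OF \<rho>(2), of "card (fst z)"] by simp
    next
      case False
      have "enn2real (inverse (p (snd z))) * real (card (fst z)) < 1 * real (card (fst z))"
        by (rule mult_strict_right_mono[OF \<rho>(3)[OF False]]) (use c in linarith)
      then show ?thesis by simp
    qed
    then show "\<forall>\<^sub>F R in at_top. 4 * ((C / R) ^ card (fst z) / R powr real k *
        (1 * (2 * R) ^ card (fst z)) powr enn2real (inverse (p (snd z)))) \<le> L (snd z)"
      using L[OF S(3)[OF z]] by (intro ev) auto
  qed
  moreover have "\<forall>\<^sub>F R in at_top. \<forall>z\<in>?S. 8 * ((C / R) ^ card (fst z) / R powr \<beta> (snd z) *
      (2 * (2 * R) ^ card (fst z)) powr enn2real (inverse (p (snd z)))) \<le> L (snd z)"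
  proof (intro eventually_ball_finite[OF fin] ballI)
    fix z assume z: "z \<in> ?S"
    note \<rho> = enn2real_inverse_bounds[OF p[OF S(3)[OF z]]]
    have "enn2real (inverse (p (snd z))) * card (fst z) < card (fst z) + \<beta> (snd z)"
      using mult_right_mono[OF \<rho>(2), of "card (fst z)"] \<beta>[OF S(3)[OF z]] by simp
    then show "\<forall>\<^sub>F R in at_top. 8 * ((C / R) ^ card (fst z) / R powr \<beta> (snd z) *
        (2 * (2 * R) ^ card (fst z)) powr enn2real (inverse (p (snd z)))) \<le> L (snd z)"
      using L[OF S(3)[OF z]] by (intro ev) auto
  qed
  moreover have "\<forall>\<^sub>F R :: real in at_top. 2 \<le> R" by (rule eventually_ge_at_top)
  ultimately have "\<forall>\<^sub>F R in at_top. 2 \<le> R \<and> (\<forall>z\<in>?S. \<forall>k\<in>{k. k \<le> sfloor (\<beta> (snd z)) \<and> (p (snd z) \<noteq> 1 \<or> 0 < k)}.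
      4 * ((C / R) ^ card (fst z) / R powr real k * (1 * (2 * R) ^ card (fst z)) powr enn2real (inverse (p (snd z)))) \<le> L (snd z)) \<and>
     (\<forall>z\<in>?S. 8 * ((C / R) ^ card (fst z) / R powr \<beta> (snd z) *
      (2 * (2 * R) ^ card (fst z)) powr enn2real (inverse (p (snd z)))) \<le> L (snd z))"
    by eventually_elim blast
  then obtain R where R: "2 \<le> R" and
    R1: "\<And>z k. z \<in> ?S \<Longrightarrow> k \<in> {k. k \<le> sfloor (\<beta> (snd z)) \<and> (p (snd z) \<noteq> 1 \<or> 0 < k)} \<Longrightarrow>
      4 * ((C / R) ^ card (fst z) / R powr real k * (1 * (2 * R) ^ card (fst z)) powr enn2real (inverse (p (snd z)))) \<le> L (snd z)" and
    R2: "\<And>z. z \<in> ?S \<Longrightarrow> 8 * ((C / R) ^ card (fst z) / R powr \<beta> (snd z) *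
      (2 * (2 * R) ^ card (fst z)) powr enn2real (inverse (p (snd z)))) \<le> L (snd z)"
    using eventually_happens'[OF trivial_limit_at_top_linorder] by (smt (verit) trivial_limit_at_top_linorder)
  show ?thesis
  proof (rule that[OF R])
    show "4 * ((\<Prod>j\<in>I. C / R) / R ^ k * (\<Prod>j\<in>I. 2 * R) powr enn2real (inverse (p i))) \<le> L i"
      if "I \<subseteq> {1..d}" "i \<in> I" "k \<le> sfloor (\<beta> i)" "p i \<noteq> 1 \<or> 0 < k" for I i k
      using R1[of "(I, i)" k] that R by (simp add: powr_realpow)
    show "8 * ((\<Prod>j\<in>I. C / R) / R powr \<beta> i * (2 * (\<Prod>j\<in>I. 2 * R)) powr enn2real (inverse (p i))) \<le> L i"
      if "I \<subseteq> {1..d}" "i \<in> I" for I i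
      using R2[of "(I, i)"] that by simp
  qed
qed

text \<open>Outside J a factor has height C / R and width 2 R; as \<rho> is at most 1 and R at least
  1, the power \<rho> of the width is absorbed by the height. Hence the bound depends neither on R
  nor on the index set I, only on the volume of the bump in J.\<close>

lemma perturbation_norm_le:
  fixes C R \<rho> v :: real
  assumes I: "J \<subseteq> I" "I \<subseteq> {1..d}" and C: "1 \<le> C" and R: "1 \<le> R" and \<rho>: "0 \<le> \<rho>" "\<rho> \<le> 1" and v: "1 \<le> v"
    and h: "\<And>j. j \<in> J \<Longrightarrow> 0 < h j"
  shows "(\<Prod>j\<in>I. if j \<in> J then C else C / R) * (v * (\<Prod>j\<in>I. 2 * (if j \<in> J then h j else R))) powr \<rho>
    \<le> v * (2 * C) ^ d * (\<Prod>j\<in>J. h j) powr \<rho>"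
proof -
  have fin: "finite I" using I(2) finite_subset by blast
  have split: "(\<Prod>j\<in>I. if j \<in> J then a j else b j) = (\<Prod>j\<in>I - J. b j) * (\<Prod>j\<in>J. a j)" for a b :: "nat \<Rightarrow> real"
    by (subst prod.subset_diff[OF I(1) fin]) (auto intro!: arg_cong2[of _ _ _ _ times] prod.cong)
  have cI: "card I = card (I - J) + card J"
    using card_Diff_subset[OF finite_subset[OF I(1) fin] I(1)] card_mono[OF fin I(1)] by simp
  have cd: "card I \<le> d" using card_mono[OF _ I(2)] by simp
  let ?r = "R ^ card (I - J)"
  let ?V = "\<Prod>j\<in>J. h j"
  \<comment> \<open>Collects the part of the volume that is at least 1, so that its power \<rho> is
    at most itself; ?r then cancels against the heights.\<close>
  let ?X = "v * 2 ^ card I * ?r"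
  have r: "1 \<le> ?r" using R by simp
  have V: "0 < ?V" using h by (intro prod_pos) auto
  have "1 \<le> v * 2 ^ card I" using v mult_mono[of 1 v 1 "2 ^ card I"] by simp
  then have X: "1 \<le> ?X" using r mult_mono[of 1 "v * 2 ^ card I" 1 ?r] by simp
  have K: "(\<Prod>j\<in>I. if j \<in> J then C else C / R) = C ^ card I / ?r"
    unfolding split by (simp add: cI power_add power_divide)
  have "(\<Prod>j\<in>I. 2 * (if j \<in> J then h j else R)) = 2 ^ card I * (?r * ?V)"
    using split[of h "\<lambda>_. R"] by (simp add: prod.distrib)
  then have "(v * (\<Prod>j\<in>I. 2 * (if j \<in> J then h j else R))) powr \<rho> = (?X * ?V) powr \<rho>"
    by (simp add: mult.assoc)
  also have "\<dots> = ?X powr \<rho> * ?V powr \<rho>"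
    by (rule powr_mult)
  also have "\<dots> \<le> ?X * ?V powr \<rho>"
    using powr_mono[OF \<rho>(2) X] X by (intro mult_right_mono) auto
  finally have "(\<Prod>j\<in>I. if j \<in> J then C else C / R) * (v * (\<Prod>j\<in>I. 2 * (if j \<in> J then h j else R))) powr \<rho>
      \<le> C ^ card I / ?r * (?X * ?V powr \<rho>)"
    unfolding K using C r by (intro mult_left_mono) auto
  also have "\<dots> = v * (2 * C) ^ card I * ?V powr \<rho>"
    using r R by (simp add: power_mult_distrib)
  also have "\<dots> \<le> v * (2 * C) ^ d * ?V powr \<rho>"
    using C v by (intro mult_right_mono mult_left_mono power_increasing[OF cd]) auto
  finally show ?thesis .
qed

text \<open>Here y is the rate, and the three bounds on a serve the smoothness constraints (16),
  positivity of the density, and the chi-square size (\<open>small\<close>, where 8 h j0 stands for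
  1 / M). The lower bound contains no y, hence no n.\<close>

lemma perturbation_risk_ge:
  fixes d n N :: nat and p :: "nat \<Rightarrow> ennreal" and \<beta> L :: "nat \<Rightarrow> real"
    and C R a b y \<gamma> q :: real and W g :: "real \<Rightarrow> real"
  defines "\<rho> \<equiv> \<lambda>j. enn2real (inverse (p j))"
  defines "h \<equiv> \<lambda>j. y powr ((1 + \<rho> j / \<gamma>) / \<beta> j)"
  assumes q: "1 \<le> q" and P: "partition_on {1..d} P" "J \<in> P" "j0 \<in> J"
    and p: "\<And>j. j \<in> {1..d} \<Longrightarrow> 1 \<le> p j"
    and \<beta>: "\<And>j. j \<in> {1..d} \<Longrightarrow> 0 < \<beta> j" "\<And>j. j \<in> {1..d} \<Longrightarrow> sfloor (\<beta> j) < N"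
    and L: "\<And>i. i \<in> {1..d} \<Longrightarrow> 0 < L i" "\<And>i. i \<in> {1..d} \<Longrightarrow> p i = 1 \<Longrightarrow> 1 \<le> L i"
    and \<gamma>: "0 < \<gamma>" "(\<Sum>j\<in>J. (1 + \<rho> j / \<gamma>) / \<beta> j) = 1 / \<gamma>"
    and C: "1 \<le> C" and W: "bump_class N C 0 1 W" "\<And>t. 0 \<le> W t" "integral\<^sup>L lborel W = 1"
    and g: "bump_class N C 0 1 g" "integral\<^sup>L lborel g = 0" "0 < g (1 / 2)"
    and b: "0 < b" "\<And>t. \<bar>t\<bar> \<le> 1 \<Longrightarrow> b \<le> 1 / R * W (t / R)"
    and R: "2 \<le> R"
    and R1: "\<And>I i k. I \<subseteq> {1..d} \<Longrightarrow> i \<in> I \<Longrightarrow> k \<le> sfloor (\<beta> i) \<Longrightarrow> p i \<noteq> 1 \<or> 0 < k \<Longrightarrow>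
      4 * ((\<Prod>j\<in>I. C / R) / R ^ k * (\<Prod>j\<in>I. 2 * R) powr enn2real (inverse (p i))) \<le> L i"
    and R2: "\<And>I i. I \<subseteq> {1..d} \<Longrightarrow> i \<in> I \<Longrightarrow> 8 * ((\<Prod>j\<in>I. C / R) / R powr \<beta> i *
        (2 * (\<Prod>j\<in>I. 2 * R)) powr enn2real (inverse (p i))) \<le> L i"
    and a: "0 < a" "\<And>i. i \<in> {1..d} \<Longrightarrow> 16 * (2 * C) ^ d * a \<le> L i" "a * C ^ card J \<le> b ^ card J"
    and y: "0 < y" "y \<le> 1" "\<And>j. j \<in> J \<Longrightarrow> h j \<le> 1 / 8"
    and small: "8 * h j0 * exp (n * (a\<^sup>2 * (2 * C\<^sup>2 / b) ^ card J * (y\<^sup>2 * y powr (1 / \<gamma>)))) \<le> 1 / 4"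
    and fhat: "fhat \<in> estimators d n"
  shows "ennreal (a * (g (1 / 2) ^ card J * b ^ (d - card J)) / 8) \<le>
    (SUP f\<in>nikolskii_densities_indep d p \<beta> L P. risk d n q y fhat f)"
proof -
  let ?D = "{1..d}"
  let ?F = "nikolskii_densities_indep d p \<beta> L P"
  have J: "J \<subseteq> ?D" using P unfolding partition_on_def by auto
  have jD: "j \<in> ?D" if "j \<in> J" for j using that J by auto
  have finJ: "finite J" using J finite_subset by blast
  have h_pos: "0 < h j" for j unfolding h_def using y(1) by simp
  have V: "(\<Prod>j\<in>J. h j) = y powr (1 / \<gamma>)"
    unfolding h_def using y(1) \<gamma>(2) by (simp add: powr_sum flip: \<gamma>(2))
  define A where "A = a * y"
  have A: "0 < A" "A \<le> a" using a(1) y(1,2) by (auto simp: A_def mult_left_le)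
  define \<phi> where "\<phi> t = 1 / R * W ((t - 0) / R)" for t
  \<comment> \<open>The alternatives differ only along j0, with spacing twice the half-width;
    touching supports are harmless since bumps vanish at their endpoints.\<close>
  define c where "c m j = (if j = j0 then 2 * h j0 * real m else 0)" for m j
  define \<psi> where "\<psi> m j = (if j \<in> J then (\<lambda>t. 1 * g ((t - c m j) / h j)) else \<phi>)" for m j
  define K2 where "K2 j = (if j \<in> J then C else C / R)" for j
  define h2 where "h2 j = (if j \<in> J then h j else R)" for j
  define c2 where "c2 m j = (if j \<in> J then c m j else 0)" for m j
  \<comment> \<open>So many shifts keep all centres in [0, 1/2]; with half-widths at most 1/8 the
    supports stay in [-1, 1], where the base is at least b.\<close>
  define M where "M = nat \<lfloor>1 / (4 * h j0)\<rfloor>"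
  have \<phi>_bump: "bump_class N (C / R) 0 R \<phi>"
    using bump_class_affine[OF W(1), of R "1 / R" 0] R by (simp add: \<phi>_def[abs_def])
  have \<phi>_nonneg: "0 \<le> \<phi> t" for t using W(2) R by (simp add: \<phi>_def)
  have \<phi>_ge: "b \<le> \<phi> t" if "\<bar>t\<bar> \<le> 1" for t using b(2)[OF that] by (simp add: \<phi>_def)
  have \<phi>_int: "integral\<^sup>L lborel \<phi> = 1"
  proof -
    have "integral\<^sup>L lborel \<phi> = \<bar>R\<bar> *\<^sub>R (\<integral>t. \<phi> (0 + R * t) \<partial>lborel)"
      using R by (intro lborel_integral_real_affine) simp
    then show ?thesis using R W(3) by (simp add: \<phi>_def)
  qed
  have \<psi>_bump: "bump_class N C (c m j) (h j) (\<psi> m j)" if "j \<in> J" for m j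
    using bump_class_affine[OF g(1) h_pos, of 1 "c m j" j] that by (simp add: \<psi>_def)
  have \<psi>_int: "integral\<^sup>L lborel (\<psi> m j) = 0" if "j \<in> J" for m j
  proof -
    have "integral\<^sup>L lborel (\<psi> m j) = \<bar>h j\<bar> *\<^sub>R (\<integral>t. \<psi> m j (c m j + h j * t) \<partial>lborel)"
      using h_pos[of j] by (intro lborel_integral_real_affine) simp
    then show ?thesis using h_pos[of j] g(2) that by (simp add: \<psi>_def)
  qed
  have \<psi>2_bump: "bump_class N (K2 j) (c2 m j) (h2 j) (\<psi> m j)" for m j
    using \<psi>_bump[of j m] \<phi>_bump by (cases "j \<in> J") (auto simp: K2_def c2_def h2_def \<psi>_def)
  have h0: "0 < h j0" "h j0 \<le> 1 / 8" using h_pos y(3)[OF P(3)] by auto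
  \<comment> \<open>Rounding down a number of size at least 2 loses at most half of it, hence M is
    at least 1 / (8 h j0).\<close>
  have "2 \<le> 1 / (4 * h j0)" using h0 by (simp add: field_simps)
  then have M_eq: "real M = of_int \<lfloor>1 / (4 * h j0)\<rfloor>" unfolding M_def by (subst of_nat_nat) (use h0 in auto)
  have M_le: "real M \<le> 1 / (4 * h j0)" unfolding M_eq by linarith
  have M_ge: "1 / (8 * h j0) \<le> real M"
  proof -
    have "1 / (8 * h j0) = 1 / (4 * h j0) / 2" by simp
    moreover have "1 / (4 * h j0) - 1 \<le> real M" unfolding M_eq by linarith
    ultimately show ?thesis using \<open>2 \<le> 1 / (4 * h j0)\<close> by linarith
  qed
  have M1: "1 \<le> M"
    unfolding M_def using \<open>2 \<le> 1 / (4 * h j0)\<close> by linarith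
  have hM: "2 * h j0 * real m \<le> 1 / 2" if "m \<in> {1..M}" for m
  proof -
    have "real m \<le> 1 / (4 * h j0)" using that M_le by (meson atLeastAtMost_iff of_nat_mono order_trans)
    then have "2 * h j0 * real m \<le> 2 * h j0 * (1 / (4 * h j0))" using h0 by (intro mult_left_mono) auto
    then show ?thesis using h0 by simp
  qed
  have near: "\<bar>t\<bar> \<le> 1" if "m \<in> {1..M}" "j \<in> J" "\<bar>t - c m j\<bar> < h j" for m j t
  proof -
    have "0 \<le> c m j" "c m j \<le> 1 / 2"
      using hM[OF that(1)] h0 by (auto simp: c_def)
    then show ?thesis using that(3) y(3)[OF that(2)] by linarith
  qed
  have dom: "\<bar>A * (\<Prod>j\<in>J. \<psi> m j (x j))\<bar> \<le> (\<Prod>j\<in>J. \<phi> (x j))" if m: "m \<in> {1..M}" for m x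
  proof (cases "\<forall>j\<in>J. \<bar>x j - c m j\<bar> < h j")
    case True
    have "\<bar>A * (\<Prod>j\<in>J. \<psi> m j (x j))\<bar> = A * (\<Prod>j\<in>J. \<bar>\<psi> m j (x j)\<bar>)"
      using A by (simp add: abs_mult abs_prod)
    also have "\<dots> \<le> a * (\<Prod>j\<in>J. C)"
      using A C bump_class_bound[OF \<psi>_bump] by (intro mult_mono prod_mono prod_nonneg) auto
    also have "\<dots> \<le> b ^ card J" using a(3) by simp
    also have "\<dots> = (\<Prod>j\<in>J. b)" by simp
    also have "\<dots> \<le> (\<Prod>j\<in>J. \<phi> (x j))"
      using b(1) near[OF m] True by (intro prod_mono conjI \<phi>_ge) auto
    finally show ?thesis .
  next
    case False
    then obtain j where j: "j \<in> J" "h j \<le> \<bar>x j - c m j\<bar>" by auto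
    then have "\<psi> m j (x j) = 0" using bump_class_eq_0[OF \<psi>_bump] by blast
    then have "(\<Prod>j\<in>J. \<psi> m j (x j)) = 0" using j finJ by (intro prod_zero) auto
    then show ?thesis using \<phi>_nonneg by (simp add: prod_nonneg)
  qed
  \<comment> \<open>The balance behind the widths: for i in J, h^\<beta> = y y^(\<rho>/\<gamma>), so
    the first ratio equals a. Derivatives of order k < \<beta> cost less because h is at most 1. For
    i outside J the width R is at least 1 and the powers of y only help.\<close>
  have key: "A * y powr (\<rho> i / \<gamma>) / h2 i powr \<beta> i \<le> a" "k \<le> sfloor (\<beta> i) \<Longrightarrow> A * y powr (\<rho> i / \<gamma>) / h2 i ^ k \<le> a"
    if i: "i \<in> ?D" for i k
  proof -
    have \<rho>i: "0 \<le> \<rho> i" "\<rho> i \<le> 1" using enn2real_inverse_bounds[OF p[OF i]] by (auto simp: \<rho>_def)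
    have le: "A * y powr (\<rho> i / \<gamma>) \<le> a * h2 i powr \<beta> i"
    proof (cases "i \<in> J")
      case True
      have "h i powr \<beta> i = y * y powr (\<rho> i / \<gamma>)"
        using y(1) \<beta>(1)[OF i] by (simp add: h_def powr_powr powr_add)
      then show ?thesis using True by (simp add: h2_def A_def)
    next
      case False
      have "y powr (\<rho> i / \<gamma>) \<le> 1" using y \<rho>i(1) \<gamma>(1) by (intro powr_le1) auto
      then have "A * y powr (\<rho> i / \<gamma>) \<le> a * 1" using A by (intro mult_mono) auto
      also have "\<dots> \<le> a * R powr \<beta> i"
        using R \<beta>(1)[OF i] a(1) by (intro mult_left_mono ge_one_powr_ge_zero) auto
      finally show ?thesis using False by (simp add: h2_def)
    qed
    have h2: "0 < h2 i" using h_pos R by (simp add: h2_def)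
    then show "A * y powr (\<rho> i / \<gamma>) / h2 i powr \<beta> i \<le> a" using le by (simp add: divide_le_eq)
    assume k: "k \<le> sfloor (\<beta> i)"
    have "A * y powr (\<rho> i / \<gamma>) \<le> a * h2 i ^ k"
    proof (cases "i \<in> J")
      case True
      have "real k \<le> \<beta> i" using k sfloor_bounds(1)[OF \<beta>(1)[OF i]] by linarith
      then have "h i powr \<beta> i \<le> h i powr real k" using h_pos[of i] y(3)[OF True] by (intro powr_mono') auto
      then have "a * h i powr \<beta> i \<le> a * h i ^ k" using a(1) h_pos[of i] by (simp add: powr_realpow)
      then show ?thesis using le True by (simp add: h2_def)
    next
      case False
      have "y powr (\<rho> i / \<gamma>) \<le> 1" using y \<rho>i(1) \<gamma>(1) by (intro powr_le1) auto
      then have "A * y powr (\<rho> i / \<gamma>) \<le> a * 1" using A by (intro mult_mono) auto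
      also have "\<dots> \<le> a * R ^ k" using R a(1) by (intro mult_left_mono one_le_power) auto
      finally show ?thesis using False by (simp add: h2_def)
    qed
    then show "A * y powr (\<rho> i / \<gamma>) / h2 i ^ k \<le> a" using h2 by (simp add: divide_le_eq)
  qed
  \<comment> \<open>Treats both kinds of constraint at once: (w, v) = (4, 1) for derivatives and (8,
    2) for increments, whence w v at most 16 and the constant 16 in the choice of a.\<close>
  have norm: "w * (\<bar>A'\<bar> * (\<Prod>j\<in>I. K2 j) / s * (v * (\<Prod>j\<in>I. 2 * h2 j)) powr \<rho> i) \<le> L i"
    if I: "J \<subseteq> I" "I \<subseteq> ?D" "i \<in> I" and A': "\<bar>A'\<bar> \<le> A" and s: "0 < s" "A * y powr (\<rho> i / \<gamma>) / s \<le> a"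
      and v: "1 \<le> v" "w * v \<le> 16" "0 \<le> w" for I i A' s v w
  proof -
    have i: "i \<in> ?D" using I by auto
    have \<rho>i: "0 \<le> \<rho> i" "\<rho> i \<le> 1" using enn2real_inverse_bounds[OF p[OF i]] by (auto simp: \<rho>_def)
    have Vp: "(\<Prod>j\<in>J. h j) powr \<rho> i = y powr (\<rho> i / \<gamma>)" unfolding V using y(1) by (simp add: powr_powr)
    have X: "(\<Prod>j\<in>I. K2 j) * (v * (\<Prod>j\<in>I. 2 * h2 j)) powr \<rho> i \<le> v * (2 * C) ^ d * y powr (\<rho> i / \<gamma>)"
      unfolding K2_def h2_def Vp[symmetric]
      using R C \<rho>i v h_pos by (intro perturbation_norm_le[OF I(1,2)]) auto
    have "\<bar>A'\<bar> / s * ((\<Prod>j\<in>I. K2 j) * (v * (\<Prod>j\<in>I. 2 * h2 j)) powr \<rho> i)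
        \<le> A / s * (v * (2 * C) ^ d * y powr (\<rho> i / \<gamma>))"
    proof (rule mult_mono[OF _ X])
      show "\<bar>A'\<bar> / s \<le> A / s" "0 \<le> A / s" using A A' s(1) by (auto intro: divide_right_mono)
      show "0 \<le> (\<Prod>j\<in>I. K2 j) * (v * (\<Prod>j\<in>I. 2 * h2 j)) powr \<rho> i"
        using bump_classD(1)[OF \<psi>2_bump] by (intro mult_nonneg_nonneg prod_nonneg) auto
    qed
    also have "\<dots> = v * (2 * C) ^ d * (A * y powr (\<rho> i / \<gamma>) / s)" by simp
    also have "\<dots> \<le> v * (2 * C) ^ d * a" using s(2) v C by (intro mult_left_mono) auto
    finally have "w * (\<bar>A'\<bar> / s * ((\<Prod>j\<in>I. K2 j) * (v * (\<Prod>j\<in>I. 2 * h2 j)) powr \<rho> i)) \<le> w * (v * (2 * C) ^ d * a)"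
      using v(3) by (rule mult_left_mono)
    also have "\<dots> = w * v * ((2 * C) ^ d * a)" by simp
    also have "\<dots> \<le> 16 * ((2 * C) ^ d * a)" using v C a(1) by (intro mult_right_mono) auto
    also have "\<dots> \<le> L i" using a(2)[OF i] by simp
    finally show ?thesis by (simp add: mult.assoc mult.commute mult.left_commute)
  qed
  \<comment> \<open>A variable amplitude A' covers both the alternatives (A' = A) and the base
    density (A' = 0).\<close>
  have in_class: "tensor_sum ?D (\<lambda>_. \<phi>) A' (\<psi> m) \<in> ?F" if m: "m \<in> {1..M}" and A': "\<bar>A'\<bar> \<le> A" for A' m
  proof (rule tensor_sum_in_class[OF P(1,2), where ?K1.0 = "\<lambda>_. C / R" and ?c1.0 = "\<lambda>_. 0" and ?h1.0 = "\<lambda>_. R"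
        and ?K2.0 = K2 and ?c2.0 = "c2 m" and ?h2.0 = h2 and N = N])
    show "bump_class N (C / R) 0 R \<phi>" by (rule \<phi>_bump)
    show "bump_class N (K2 j) (c2 m j) (h2 j) (\<psi> m j)" for j by (rule \<psi>2_bump)
    show "integral\<^sup>L lborel \<phi> = 1" "0 \<le> \<phi> t" for t by (fact \<phi>_int \<phi>_nonneg)+
    show "integral\<^sup>L lborel (\<psi> m j) = 0" if "j \<in> J" for j by (rule \<psi>_int[OF that])
    show "\<psi> m j = \<phi>" if "j \<in> ?D - J" for j using that by (simp add: \<psi>_def)
    show "\<bar>A' * (\<Prod>j\<in>J. \<psi> m j (x j))\<bar> \<le> (\<Prod>j\<in>J. \<phi> (x j))" for x
    proof -
      have "\<bar>A' * (\<Prod>j\<in>J. \<psi> m j (x j))\<bar> \<le> \<bar>A * (\<Prod>j\<in>J. \<psi> m j (x j))\<bar>"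
        unfolding abs_mult using A' A by (intro mult_right_mono) auto
      then show ?thesis using dom[OF m, of x] by linarith
    qed
    show "4 * (\<bar>A'\<bar> * (\<Prod>j\<in>I. K2 j) / h2 i ^ k * (\<Prod>j\<in>I. 2 * h2 j) powr enn2real (inverse (p i))) \<le> L i"
      if "J \<subseteq> I" "I \<subseteq> ?D" "i \<in> I" "k \<le> sfloor (\<beta> i)" for I i k
      using norm[OF that(1-3) A', of "h2 i ^ k" 1 4] key(2)[of i k] that h_pos R
      by (auto simp: \<rho>_def h2_def)
    show "8 * (\<bar>A'\<bar> * (\<Prod>j\<in>I. K2 j) / h2 i powr \<beta> i * (2 * (\<Prod>j\<in>I. 2 * h2 j)) powr enn2real (inverse (p i))) \<le> L i"
      if "J \<subseteq> I" "I \<subseteq> ?D" "i \<in> I" for I i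
    proof -
      have "0 < h2 i powr \<beta> i" using h_pos[of i] R by (auto simp: h2_def)
      then show ?thesis using norm[OF that A', of "h2 i powr \<beta> i" 2 8] key(1)[of i] that by (auto simp: \<rho>_def)
    qed
  qed (use p \<beta> L R1 R2 in auto)
  have one: "1 \<in> {1..M}" using M1 by simp
  have f0: "tensor_sum ?D (\<lambda>_. \<phi>) 0 (\<lambda>_. \<phi>) \<in> ?F"
  proof -
    have "tensor_sum ?D (\<lambda>_. \<phi>) 0 (\<psi> 1) = tensor_sum ?D (\<lambda>_. \<phi>) 0 (\<lambda>_. \<phi>)"
      by (simp add: tensor_sum_def fun_eq_iff)
    then show ?thesis using in_class[OF one, of 0] A by simp
  qed
  \<comment> \<open>In J each rescaled odd profile takes its value at 1/2 (its centre would be a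
    zero); elsewhere the base factor at 0 is at least b.\<close>
  define z where "z m = (\<lambda>j\<in>?D. if j \<in> J then c m j + h j / 2 else 0)" for m
  define c1 where "c1 = g (1 / 2) ^ card J * b ^ (d - card J)"
  have c1: "0 < c1" using g(3) b(1) by (simp add: c1_def)
  have "ennreal (A * c1 / 2 / y / 4) \<le> (SUP f\<in>?F. risk d n q y fhat f)"
  proof (rule tensor_minimax_risk_ge[OF q y(1) _ M1 fhat J P(3), where \<phi> = "\<lambda>_. \<phi>" and \<psi> = \<psi> and A = A
        and b = b and h = h and c = c and C = C and N = N and z = z])
    show "0 \<le> A * c1 / 2" using A c1 by simp
    show "\<phi> \<in> borel_measurable borel" "integrable lborel \<phi>"
      using bump_class_measurable[OF \<phi>_bump] bump_class_integrable[OF \<phi>_bump] by auto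
    show "b \<le> \<phi> t" if "m \<in> {1..M}" "j \<in> J" "\<bar>t - c m j\<bar> < h j" for m j t
      by (rule \<phi>_ge[OF near[OF that]])
    show "\<psi> m j0 t * \<psi> m' j0 t = 0" if "m \<noteq> m'" for m m' t
    proof (rule ccontr)
      assume "\<psi> m j0 t * \<psi> m' j0 t \<noteq> 0"
      then have "\<bar>t - c m j0\<bar> < h j0" "\<bar>t - c m' j0\<bar> < h j0"
        using bump_class_eq_0[OF \<psi>_bump[OF P(3)]] by (force simp: not_le[symmetric])+
      then have "\<bar>2 * h j0 * real m - 2 * h j0 * real m'\<bar> < 2 * h j0" by (simp add: c_def)
      moreover have "2 * h j0 * real m - 2 * h j0 * real m' = 2 * h j0 * (real m - real m')" by (simp add: algebra_simps)
      ultimately have "2 * h j0 * \<bar>real m - real m'\<bar> < 2 * h j0 * 1" using h0 by (simp add: abs_mult)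
      then have "\<bar>real m - real m'\<bar> < 1" using h0 by simp
      then show False using that by linarith
    qed
    show "tensor_sum ?D (\<lambda>_. \<phi>) A (\<psi> m) \<in> ?F" if "m \<in> {1..M}" for m
      using in_class[OF that, of A] A by simp
    show "prob_density d (tensor_sum ?D (\<lambda>_. \<phi>) 0 (\<lambda>_. \<phi>))"
      using f0 by (simp add: nikolskii_densities_indep_def nikolskii_densities_def)
    show "z m \<in> Rspace ?D" for m by (simp add: z_def)
    show "2 * (A * c1 / 2) \<le> \<bar>A * (\<Prod>j\<in>?D. \<psi> m j (z m j))\<bar>" for m
    proof -
      have "(\<Prod>j\<in>?D. \<psi> m j (z m j)) = (\<Prod>j\<in>?D - J. \<psi> m j (z m j)) * (\<Prod>j\<in>J. \<psi> m j (z m j))"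
        using J by (intro prod.subset_diff) auto
      also have "(\<Prod>j\<in>?D - J. \<psi> m j (z m j)) = (\<Prod>j\<in>?D - J. \<phi> 0)"
        by (intro prod.cong) (auto simp: \<psi>_def z_def)
      also have "\<dots> = \<phi> 0 ^ (d - card J)"
        using card_Diff_subset[OF finJ J] by simp
      also have "(\<Prod>j\<in>J. \<psi> m j (z m j)) = (\<Prod>j\<in>J. g (1 / 2))"
      proof (intro prod.cong refl)
        fix j assume j: "j \<in> J"
        then have "z m j = c m j + h j / 2" using jD by (simp add: z_def)
        then show "\<psi> m j (z m j) = g (1 / 2)" using j h_pos[of j] by (simp add: \<psi>_def)
      qed
      also have "\<dots> = g (1 / 2) ^ card J" by simp
      finally have eq: "(\<Prod>j\<in>?D. \<psi> m j (z m j)) = \<phi> 0 ^ (d - card J) * g (1 / 2) ^ card J" .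
      have "b ^ (d - card J) \<le> \<phi> 0 ^ (d - card J)" using \<phi>_ge[of 0] b(1) by (intro power_mono) auto
      then have "c1 \<le> \<phi> 0 ^ (d - card J) * g (1 / 2) ^ card J"
        unfolding c1_def using g(3) by (simp add: mult.commute)
      then have "A * c1 \<le> A * (\<Prod>j\<in>?D. \<psi> m j (z m j))" unfolding eq using A by simp
      then show ?thesis by (simp add: abs_if)
    qed
    show "exp (n * (A\<^sup>2 * (\<Prod>j\<in>J. C\<^sup>2 / b * (2 * h j)))) / M \<le> 1 / 4"
    proof -
      have "(\<Prod>j\<in>J. C\<^sup>2 / b * (2 * h j)) = (\<Prod>j\<in>J. (2 * C\<^sup>2 / b) * h j)"
        by (simp add: mult.commute mult.left_commute)
      also have "\<dots> = (2 * C\<^sup>2 / b) ^ card J * y powr (1 / \<gamma>)"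
        unfolding prod.distrib V by simp
      finally have "A\<^sup>2 * (\<Prod>j\<in>J. C\<^sup>2 / b * (2 * h j)) = a\<^sup>2 * (2 * C\<^sup>2 / b) ^ card J * (y\<^sup>2 * y powr (1 / \<gamma>))"
        by (simp add: A_def power_mult_distrib)
      \<comment> \<open>Trades the integer M for a power of y, which is easier to handle in the
        limit.\<close>
      moreover have "exp t / M \<le> 8 * h j0 * exp t" for t
      proof -
        have "1 \<le> 8 * h j0 * real M" using M_ge h0 by (simp add: divide_le_eq mult.commute)
        then have "exp t * 1 \<le> exp t * (8 * h j0 * real M)" by (intro mult_left_mono) auto
        then show ?thesis using M1 by (simp add: divide_le_eq mult.commute mult.left_commute)
      qed
      ultimately show ?thesis using small by (metis order_trans)
    qed
  qed (use \<phi>_nonneg \<phi>_int \<psi>_bump \<psi>_int dom f0 b(1) in \<open>auto simp: \<psi>_def\<close>)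
  moreover have "A * c1 / 2 / y / 4 = a * c1 / 8" using y(1) by (simp add: A_def)
  ultimately show ?thesis by (simp only: c1_def)
qed

section \<open>Tuning the amplitude, and the limit in n\<close>

lemma small_constant_exists:
  fixes L :: "nat \<Rightarrow> real" and D :: "nat set"
  assumes "finite D" "\<And>i. i \<in> D \<Longrightarrow> 0 < L i" "0 < u" "0 < t"
  obtains a where "0 < a" "\<And>i. i \<in> D \<Longrightarrow> G * a \<le> L i" "a * K \<le> u" "a\<^sup>2 * H \<le> t"
proof -
  have lim: "((\<lambda>a. G * a) \<longlongrightarrow> G * 0) (at_right 0)" "((\<lambda>a. a * K) \<longlongrightarrow> 0 * K) (at_right 0)"
    "((\<lambda>a. a\<^sup>2 * H) \<longlongrightarrow> 0\<^sup>2 * H) (at_right 0)"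
    by (intro tendsto_intros)+
  have "\<forall>\<^sub>F a in at_right 0. \<forall>i\<in>D. G * a < L i"
    using assms(1,2) lim(1) by (intro eventually_ball_finite ballI order_tendstoD(2)) auto
  moreover have "\<forall>\<^sub>F a in at_right 0. a * K < u" "\<forall>\<^sub>F a in at_right 0. a\<^sup>2 * H < t"
    using assms(3,4) lim(2,3) by (auto intro!: order_tendstoD(2))
  moreover have "\<forall>\<^sub>F a :: real in at_right 0. 0 < a" by (simp add: eventually_at_right_less)
  ultimately have "\<forall>\<^sub>F a in at_right 0. 0 < a \<and> (\<forall>i\<in>D. G * a < L i) \<and> a * K < u \<and> a\<^sup>2 * H < t"
    by eventually_elim blast
  then obtain a where "0 < a" "\<forall>i\<in>D. G * a < L i" "a * K < u" "a\<^sup>2 * H < t"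
    using eventually_happens'[OF trivial_limit_at_right_real] by blast
  then show ?thesis using that[of a] by (auto intro: less_imp_le)
qed

theorem theorem2:
  fixes d :: nat and q :: real
    and \<beta> L :: "nat \<Rightarrow> real" and p :: "nat \<Rightarrow> ennreal" and P :: "nat set set"
  assumes "d \<ge> 1" and "q \<ge> 1"
    and "\<forall>j\<in>{1..d}. 0 < \<beta> j" and "\<forall>j\<in>{1..d}. 1 \<le> p j" and "partition_on {1..d} P"
    and "eff_smoothness \<beta> p P > 0"
    and "\<forall>j\<in>{1..d}. 0 < L j"
    and "nikolskii_densities_indep d p \<beta> L P \<noteq> {}"
  shows "liminf (\<lambda>n. INF fhat\<in>estimators d n. SUP f\<in>nikolskii_densities_indep d p \<beta> L P.
           risk d n q (rate \<beta> p P n) fhat f) > 0"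
proof -
  let ?D = "{1..d}"
  let ?F = "nikolskii_densities_indep d p \<beta> L P"
  have \<beta>: "0 < \<beta> j" and p: "1 \<le> p j" and L: "0 < L j" if "j \<in> ?D" for j
    using assms(3,4,7) that by auto
  define \<gamma> where "\<gamma> = eff_smoothness \<beta> p P"
  define \<rho> where "\<rho> = (\<lambda>j. enn2real (inverse (p j)))"
  have \<gamma>: "0 < \<gamma>" using assms(6) by (simp add: \<gamma>_def)
  have finP: "finite P" using assms(5) finite_elements by blast
  have "P \<noteq> {}" using assms(1,5) unfolding partition_on_def by auto
  \<comment> \<open>A finite nonempty partition attains its infimum, so the worst block
    exists.\<close>
  then have "\<gamma> \<in> block_smoothness \<beta> p ` P"
    unfolding \<gamma>_def eff_smoothness_def using finP by (subst cInf_eq_Min) auto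
  then obtain J where J: "J \<in> P" "\<gamma> = block_smoothness \<beta> p J" by auto
  have JD: "J \<subseteq> ?D" and "J \<noteq> {}" using J(1) assms(5) unfolding partition_on_def by auto
  then obtain j0 where j0: "j0 \<in> J" by auto
  have finJ: "finite J" using JD finite_subset by blast
  have S: "0 < (\<Sum>j\<in>J. 1 / \<beta> j)"
    using finJ \<open>J \<noteq> {}\<close> \<beta> JD by (intro sum_pos) auto
  \<comment> \<open>The definition of the block smoothness, rewritten: \<gamma> times the sum of
    1/\<beta> equals 1 minus the sum of \<rho>/\<beta>; divide by \<gamma>.\<close>
  have esum: "(\<Sum>j\<in>J. (1 + \<rho> j / \<gamma>) / \<beta> j) = 1 / \<gamma>"
  proof -
    have "(\<Sum>j\<in>J. \<rho> j / \<beta> j) = 1 - \<gamma> * (\<Sum>j\<in>J. 1 / \<beta> j)"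
      using S J(2) by (simp add: block_smoothness_def \<rho>_def field_simps)
    moreover have "(\<Sum>j\<in>J. (1 + \<rho> j / \<gamma>) / \<beta> j) = (\<Sum>j\<in>J. 1 / \<beta> j) + (\<Sum>j\<in>J. \<rho> j / \<beta> j) / \<gamma>"
      by (simp add: add_divide_distrib sum.distrib sum_divide_distrib mult.commute)
    ultimately show ?thesis using \<gamma> by (simp add: field_simps)
  qed
  define N where "N = Suc (\<Sum>j\<in>?D. sfloor (\<beta> j))"
  have N: "sfloor (\<beta> j) < N" if "j \<in> ?D" for j
    using member_le_sum[of j ?D "\<lambda>j. sfloor (\<beta> j)"] that by (simp add: N_def)
  \<comment> \<open>Nonemptiness of the class enters here: it yields L i at least 1 in the
    directions with p i = 1.\<close>
  obtain f where "f \<in> ?F" using assms(8) by blast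
  then have L1: "1 \<le> L i" if "i \<in> ?D" "p i = 1" for i
    using class_nonempty_imp_L_ge_1[of f d p \<beta> L i] that by (simp add: nikolskii_densities_indep_def)
  obtain C b0 W g where C: "1 \<le> C" and W: "bump_class N C 0 1 W" "\<And>t. 0 \<le> W t" "integral\<^sup>L lborel W = 1"
    and g: "bump_class N C 0 1 g" "integral\<^sup>L lborel g = 0" "0 < g (1 / 2)"
    and b0: "0 < b0" "\<And>t. \<bar>t\<bar> \<le> 1 / 2 \<Longrightarrow> b0 \<le> W t"
    by (rule bump_profiles[of N]) blast
  obtain R where R: "2 \<le> R" and
    R1: "\<And>I i k. I \<subseteq> ?D \<Longrightarrow> i \<in> I \<Longrightarrow> k \<le> sfloor (\<beta> i) \<Longrightarrow> p i \<noteq> 1 \<or> 0 < k \<Longrightarrow>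
      4 * ((\<Prod>j\<in>I. C / R) / R ^ k * (\<Prod>j\<in>I. 2 * R) powr enn2real (inverse (p i))) \<le> L i" and
    R2: "\<And>I i. I \<subseteq> ?D \<Longrightarrow> i \<in> I \<Longrightarrow> 8 * ((\<Prod>j\<in>I. C / R) / R powr \<beta> i *
        (2 * (\<Prod>j\<in>I. 2 * R)) powr enn2real (inverse (p i))) \<le> L i"
    by (rule dilation_exists[OF C p \<beta> L], assumption+) (rule that)
  define b where "b = b0 / R"
  have b: "0 < b" "\<And>t. \<bar>t\<bar> \<le> 1 \<Longrightarrow> b \<le> 1 / R * W (t / R)"
  proof -
    show "0 < b" using b0 R by (simp add: b_def)
    fix t :: real assume "\<bar>t\<bar> \<le> 1"
    then have "\<bar>t / R\<bar> \<le> 1 / 2" using R by (simp add: field_simps)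
    then have "b0 \<le> W (t / R)" by (rule b0(2))
    then show "b \<le> 1 / R * W (t / R)" using R by (simp add: b_def divide_right_mono)
  qed
  define e where "e j = (1 + \<rho> j / \<gamma>) / \<beta> j" for j
  have e: "0 < e j" if "j \<in> J" for j
  proof -
    have "0 \<le> \<rho> j / \<gamma>" using \<gamma> by (simp add: \<rho>_def)
    then show ?thesis unfolding e_def using \<beta>[of j] that JD by (intro divide_pos_pos) auto
  qed
  define \<theta> where "\<theta> = \<gamma> / (2 * \<gamma> + 1)"
  have \<theta>: "0 < \<theta>" using \<gamma> by (simp add: \<theta>_def)
  \<comment> \<open>The width along j0 is (ln n / n)^\<tau>, so the number of alternatives is of the
    order (n / ln n)^\<tau>.\<close>
  define \<tau> where "\<tau> = \<theta> * e j0"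
  have \<tau>: "0 < \<tau>" using \<theta> e[OF j0] by (simp add: \<tau>_def)
  define H where "H = (2 * C\<^sup>2 / b) ^ card J"
  \<comment> \<open>The last condition makes the exponential term at most n^(\<tau>/2), half the
    exponent available from the number of alternatives.\<close>
  obtain a where a: "0 < a" "\<And>i. i \<in> ?D \<Longrightarrow> 16 * (2 * C) ^ d * a \<le> L i" "a * C ^ card J \<le> b ^ card J"
    "a\<^sup>2 * H \<le> \<tau> / 2"
    using small_constant_exists[of ?D L "b ^ card J" "\<tau> / 2" "16 * (2 * C) ^ d" "C ^ card J" H] L b(1) \<tau> by auto
  define \<delta> where "\<delta> = a * (g (1 / 2) ^ card J * b ^ (d - card J)) / 8"
  have \<delta>: "0 < \<delta>" using a(1) g(3) b(1) by (simp add: \<delta>_def)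
  define x where "x n = ln (real n) / real n" for n :: nat
  have rate: "rate \<beta> p P n = x n powr \<theta>" for n
    by (simp add: rate_def x_def \<theta>_def \<gamma>_def)
  have x0: "x \<longlonglongrightarrow> 0" unfolding x_def by real_asymp
  have x_nonneg: "0 \<le> x n" for n by (cases "n = 0") (auto simp: x_def)
  have ev_h: "\<forall>\<^sub>F n in sequentially. \<forall>j\<in>J. (x n powr \<theta>) powr e j \<le> 1 / 8"
  proof (intro eventually_ball_finite finJ ballI)
    fix j assume j: "j \<in> J"
    have "(\<lambda>n. x n powr (\<theta> * e j)) \<longlonglongrightarrow> 0 powr (\<theta> * e j)"
      using \<theta> e[OF j] by (intro tendsto_powr'[OF x0]) (auto intro!: always_eventually x_nonneg)
    then have "\<forall>\<^sub>F n in sequentially. x n powr (\<theta> * e j) < 1 / 8"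
      by (rule order_tendstoD(2)) simp
    then show "\<forall>\<^sub>F n in sequentially. (x n powr \<theta>) powr e j \<le> 1 / 8"
      by eventually_elim (simp add: powr_powr)
  qed
  \<comment> \<open>The left side is 8 (ln n)^\<tau> n^(-\<tau>/2): the spare half of the exponent
    beats the logarithm.\<close>
  have ev_small: "\<forall>\<^sub>F n in sequentially. 8 * x n powr \<tau> * real n powr (\<tau> / 2) \<le> 1 / 4"
  proof -
    have "(\<lambda>n. 8 * x n powr \<tau> * real n powr (\<tau> / 2)) \<longlonglongrightarrow> 0"
      unfolding x_def using \<tau> by real_asymp
    then have "\<forall>\<^sub>F n in sequentially. 8 * x n powr \<tau> * real n powr (\<tau> / 2) < 1 / 4"
      by (rule order_tendstoD(2)) simp
    then show ?thesis by eventually_elim simp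
  qed
  have ev_x: "\<forall>\<^sub>F n in sequentially. x n < 1" using x0 by (rule order_tendstoD(2)) simp
  have "\<forall>\<^sub>F n in sequentially. ennreal \<delta> \<le> (INF fhat\<in>estimators d n. SUP f\<in>?F. risk d n q (rate \<beta> p P n) fhat f)"
    using ev_h ev_small ev_x eventually_ge_at_top[of 2]
  proof eventually_elim
    case (elim n)
    define y where "y = x n powr \<theta>"
    have x: "0 < x n" using elim(4) by (simp add: x_def)
    have y: "0 < y" "y \<le> 1" using x elim(3) \<theta> by (auto simp: y_def powr_le1)
    have "y\<^sup>2 * y powr (1 / \<gamma>) = y powr (2 + 1 / \<gamma>)"
      using y(1) by (simp add: powr_add)
    also have "\<dots> = x n powr (\<theta> * (2 + 1 / \<gamma>))" by (simp add: y_def powr_powr)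
    \<comment> \<open>This fixes the exponent of the rate: n y^(2 + 1/\<gamma>) is exactly ln n, so
      the exponential becomes a power of n.\<close>
    also have "\<theta> * (2 + 1 / \<gamma>) = 1"
    proof -
      have "2 + 1 / \<gamma> = (2 * \<gamma> + 1) / \<gamma>" using \<gamma> by (simp add: field_simps)
      moreover have "2 * \<gamma> + 1 \<noteq> 0" using \<gamma> by linarith
      ultimately show ?thesis using \<gamma> by (simp add: \<theta>_def)
    qed
    finally have yx: "y\<^sup>2 * y powr (1 / \<gamma>) = x n" using x by simp
    have "exp (n * (a\<^sup>2 * H * x n)) = exp (a\<^sup>2 * H * ln (real n))"
      using elim(4) by (simp add: x_def)
    also have "\<dots> = real n powr (a\<^sup>2 * H)" using elim(4) by (simp add: powr_def)
    also have "\<dots> \<le> real n powr (\<tau> / 2)" using a(4) elim(4) by (intro powr_mono) auto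
    finally have "8 * x n powr \<tau> * exp (n * (a\<^sup>2 * H * x n)) \<le> 8 * x n powr \<tau> * real n powr (\<tau> / 2)"
      by (intro mult_left_mono) auto
    also have "\<dots> \<le> 1 / 4" by (rule elim(2))
    finally have small: "8 * y powr e j0 * exp (n * (a\<^sup>2 * H * (y\<^sup>2 * y powr (1 / \<gamma>)))) \<le> 1 / 4"
      unfolding yx by (simp add: y_def powr_powr \<tau>_def)
    have "ennreal \<delta> \<le> (SUP f\<in>?F. risk d n q y fhat f)" if fhat: "fhat \<in> estimators d n" for fhat
      unfolding \<delta>_def
    proof (rule perturbation_risk_ge[OF assms(2,5) J(1) j0 p \<beta> N L L1 \<gamma> _ C W g b R R1 R2 a(1,2,3) y _ _ fhat])
      show "(\<Sum>j\<in>J. (1 + enn2real (inverse (p j)) / \<gamma>) / \<beta> j) = 1 / \<gamma>" using esum by (simp add: \<rho>_def)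
      show "y powr ((1 + enn2real (inverse (p j)) / \<gamma>) / \<beta> j) \<le> 1 / 8" if "j \<in> J" for j
        using elim(1) that by (simp add: y_def e_def \<rho>_def)
      show "8 * y powr ((1 + enn2real (inverse (p j0)) / \<gamma>) / \<beta> j0) *
          exp (n * (a\<^sup>2 * (2 * C\<^sup>2 / b) ^ card J * (y\<^sup>2 * y powr (1 / \<gamma>)))) \<le> 1 / 4"
        using small by (simp add: e_def \<rho>_def H_def)
    qed
    then show ?case unfolding rate y_def[symmetric] by (intro INF_greatest)
  qed
  then have "ennreal \<delta> \<le> liminf (\<lambda>n. INF fhat\<in>estimators d n. SUP f\<in>?F. risk d n q (rate \<beta> p P n) fhat f)"
    by (rule Liminf_bounded)
  moreover have "0 < ennreal \<delta>" using \<delta> by simp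
  ultimately show ?thesis by (rule less_le_trans[rotated])
qed

end
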